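(* Let $d\geqslant 1$ and let $(\mathbf{X}_k)_{k\geqslant 0}$ be a noncritical ($\rho\neq 1$) $d$-type Galton-Watson process satisfying assumption $(A_1)$ (stated in the context), with extinction probability vector $\mathbf{q}$. If $\rho<1$, assume in addition that for each $i=1,\ldots,d$ the covariance matrix $\mathbf{\Sigma}^i$ of the offspring distribution $p_i$ is finite. Then for all $\mathbf{x}_0\in\mathbb{N}^d\setminus\{\mathbf{0}\}$ and $\mathbf{z}\in\mathbb{N}^d$, $$\lim_{\substack{n\to+\infty\\ k\to+\infty}}\mathbb{P}_{\mathbf{x}_0}\left(\mathbf{X}_k=\mathbf{z}\mid \mathbf{X}_{k+n}\neq\mathbf{0},\ T<+\infty\right)=\overline{\mu}(\mathbf{z}),$$ where the limit is a double limit ($n$ and $k$ tending to infinity simultaneously, in any manner), and $\overline{\mu}$ is the size-biased Yaglom distribution of the associated process $(\overline{\mathbf{X}}_k)_{k\geqslant 0}$ with respect to $\mathbf{q}$, namely $$\overline{\mu}(\mathbf{z})=\frac{\mathbf{z}\cdot\overline{\mathbf{u}}\;\overline{\nu}(\mathbf{z})}{\sum_{\mathbf{y}\in\mathbb{N}^d\setminus\{\mathbf{0}\}}\mathbf{y}\cdot\overline{\mathbf{u}}\;\overline{\nu}(\mathbf{y})}\quad(\mathbf{z}\in\mathbb{N}^d\setminus\{\mathbf{0}\}),\qquad \overline{\mu}(\mathbf{0})=0,$$ with $\overline{\nu}$ the Yaglom distribution of $(\overline{\mathbf{X}}_k)_{k\geqslant 0}$ and $\overline{\mathbf{u}}$ the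 normalized right Perron eigenvector of its mean matrix.
   Context: Notation. $\mathbb{N}=\{0,1,2,\ldots\}$; vectors $\mathbf{x}=(x_1,\ldots,x_d)$; $\mathbf{e}_i$ is the $i$-th unit vector; $\mathbf{0}=(0,\ldots,0)$, $\mathbf{1}=(1,\ldots,1)$; $\mathbf{x}\mathbf{y}$ is the vector with coordinates $x_iy_i$; $\mathbf{x}^{\mathbf{y}}=\prod_{i}x_i^{y_i}$; $\mathbf{x}\cdot\mathbf{y}$ is the scalar product; $\mathbf{x}<\mathbf{y}$ means $x_i<y_i$ for every $i$. A $d$-type Galton-Watson process $(\mathbf{X}_k)_{k\geqslant 0}$ is the Markov chain on $\mathbb{N}^d$ in which, at each generation, every individual of type $i$ independently produces a random offspring vector with law $p_i$ on $\mathbb{N}^d$, and $\mathbf{X}_{k+1}$ is the sum of the offspring vectors of the individuals counted by $\mathbf{X}_k$. The subscript in $\mathbb{P}_{\mathbf{x}},\mathbb{E}_{\mathbf{x}}$ denotes the initial state $\mathbf{X}_0=\mathbf{x}$; $X_{k,j}$ is the $j$-th coordinate of $\mathbf{X}_k$. The offspring generating function is $\mathbf{f}=(f_1,\ldots,f_d)$, $f_i(\mathbf{r})=\sum_{\mathbf{k}\in\mathbb{N}^d}p_i(\mathbf{k})\mathbf{r}^{\mathbf{k}}$. The mean matrix is $\mathbf{M}=(m_{ij})_{1\leqslant i,j\leqslant d}$ with $m_{ij}=\mathbb{E}_{\mathbf{e}_i}(X_{1,j})$. $\rho$ denotes the Perron root of $\mathbf{M}$, and $\mathbf{u},\mathbf{v}$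 the associated right and left (positive) eigenvectors, $\mathbf{M}\mathbf{u}^T=\rho\mathbf{u}^T$, $\mathbf{v}\mathbf{M}=\rho\mathbf{v}$, normalized by $\mathbf{u}\cdot\mathbf{1}=\mathbf{u}\cdot\mathbf{v}=1$. The process is critical, subcritical, supercritical if $\rho=1$, $\rho<1$, $\rho>1$ respectively. The extinction time is $T=\inf\{k\in\mathbb{N}:\mathbf{X}_k=\mathbf{0}\}$, and the extinction probability vector is $\mathbf{q}=(q_1,\ldots,q_d)$, $q_i=\mathbb{P}_{\mathbf{e}_i}(T<+\infty)$. Assumption $(A_1)$: $\mathbf{M}$ has finite entries; the process is nonsingular (the function $\mathbf{f}$ is not identically equal to $\mathbf{r}\mapsto\mathbf{M}\mathbf{r}$) and positive regular (there is $n\geqslant 1$ such that every entry of $\mathbf{M}^n$ is positive); and $\mathbf{q}>\mathbf{0}$. Associated process. For a vector $\mathbf{a}>\mathbf{0}$ with $f_i(\mathbf{a})<+\infty$ for every $i$, the associated process with respect to $\mathbf{a}$, denoted $(\overline{\mathbf{X}}_k)_{k\geqslant 0}$, is the $d$-type Galton-Watson process with offspring generating function $\overline{f}_i(\mathbf{r})=f_i(\mathbf{a}\mathbf{r})/f_i(\mathbf{a})$, $\mathbf{r}\in[0,1]^d$, $i=1,\ldots,d$. Quantities relative to it carry an overline (with the same normalization of eigenvectors). For $\mathbf{a}=\mathbf{q}$ and $\rho\neq 1$ the associated process is subcritical (and equals the original one when $\rho<1$). Yaglom distribution. For a subcritical $d$-type Galton-Watson process $(\mathbf{Y}_k)_{k\geqslant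 0}$ satisfying $(A_1)$, it is known that for all $\mathbf{x}_0,\mathbf{z}\in\mathbb{N}^d\setminus\{\mathbf{0}\}$ the limit $\lim_{k\to+\infty}\mathbb{P}_{\mathbf{x}_0}(\mathbf{Y}_k=\mathbf{z}\mid\mathbf{Y}_k\neq\mathbf{0})$ exists, does not depend on $\mathbf{x}_0$, and defines a probability distribution on $\mathbb{N}^d\setminus\{\mathbf{0}\}$, called the Yaglom distribution of $(\mathbf{Y}_k)_{k\geqslant 0}$. *)

theory Defs
  imports "HOL-Probability.Probability"
begin

text \<open>
  Types are indexed by a finite type \<open>'d\<close>; the unit vector of type \<open>i\<close> is \<open>axis i 1\<close>. On vectors,
  \<open>*\<close>, \<open>1\<close> and \<open>\<le>\<close> are the componentwise library instances, so \<open>{0..1} :: (real ^ 'd) set\<close> is the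
  unit cube.
\<close>

definition vec_power :: "real ^ 'd \<Rightarrow> nat ^ 'd \<Rightarrow> real" where
  "vec_power r k = (\<Prod>j\<in>UNIV. (r $ j) ^ (k $ j))"

definition gen_fun :: "('d::finite \<Rightarrow> (nat ^ 'd) pmf) \<Rightarrow> real ^ 'd \<Rightarrow> real ^ 'd" where
  "gen_fun p r = (\<chi> i. \<Sum>\<^sub>\<infinity>k\<in>UNIV. pmf (p i) k * vec_power r k)"

text \<open>
  The individuals of a population \<open>x\<close> are the pairs \<open>(i, m)\<close> with \<open>m < x $ i\<close>; their offspring
  vectors are independent, that of \<open>(i, m)\<close> having law \<open>p i\<close>.
\<close>

definition individuals :: "nat ^ 'd \<Rightarrow> ('d::finite \<times> nat) set" where
  "individuals x = (SIGMA i:UNIV. {..<x $ i})"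

definition next_generation ::
  "('d::finite \<Rightarrow> (nat ^ 'd) pmf) \<Rightarrow> nat ^ 'd \<Rightarrow> (nat ^ 'd) pmf" where
  "next_generation p x =
     map_pmf (\<lambda>\<xi>. \<Sum>a\<in>individuals x. \<xi> a) (Pi_pmf (individuals x) 0 (\<lambda>(i, m). p i))"

text \<open>
  \<open>P x\<close> is the probability measure under which the chain \<open>X\<close> starts in \<open>x\<close>.
\<close>

definition galton_watson ::
  "('d::finite \<Rightarrow> (nat ^ 'd) pmf) \<Rightarrow> (nat ^ 'd \<Rightarrow> 'a measure) \<Rightarrow> (nat \<Rightarrow> 'a \<Rightarrow> nat ^ 'd) \<Rightarrow> bool" where
  "galton_watson p P X \<longleftrightarrow>
     (\<forall>x. prob_space (P x) \<and>
          (\<forall>k. X k \<in> P x \<rightarrow>\<^sub>M count_space UNIV) \<and>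
          (AE \<omega> in P x. X 0 \<omega> = x) \<and>
          (\<forall>k s y. \<P>(\<omega> in P x. \<forall>j\<le>k. X j \<omega> = s j) > 0 \<longrightarrow>
             \<P>(\<omega> in P x. X (Suc k) \<omega> = y \<bar> \<forall>j\<le>k. X j \<omega> = s j) =
               pmf (next_generation p (s k)) y))"

definition mean_matrix ::
  "(nat ^ 'd \<Rightarrow> 'a measure) \<Rightarrow> (nat \<Rightarrow> 'a \<Rightarrow> nat ^ 'd) \<Rightarrow> real ^ 'd ^ 'd::finite" where
  "mean_matrix P X = (\<chi> i j. \<integral>\<omega>. real (X 1 \<omega> $ j) \<partial>P (axis i 1))"

definition finite_means ::
  "(nat ^ 'd::finite \<Rightarrow> 'a measure) \<Rightarrow> (nat \<Rightarrow> 'a \<Rightarrow> nat ^ 'd) \<Rightarrow> bool" where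
  "finite_means P X \<longleftrightarrow> (\<forall>i j. integrable (P (axis i 1)) (\<lambda>\<omega>. real (X 1 \<omega> $ j)))"

definition extinction_time :: "(nat \<Rightarrow> 'a \<Rightarrow> nat ^ 'd::finite) \<Rightarrow> 'a \<Rightarrow> enat" where
  "extinction_time X \<omega> = (INF k\<in>{k. X k \<omega> = 0}. enat k)"

definition extinction_prob ::
  "(nat ^ 'd \<Rightarrow> 'a measure) \<Rightarrow> (nat \<Rightarrow> 'a \<Rightarrow> nat ^ 'd) \<Rightarrow> real ^ 'd::finite" where
  "extinction_prob P X = (\<chi> i. \<P>(\<omega> in P (axis i 1). extinction_time X \<omega> < \<infinity>))"

text \<open>
  The instance of \<open>^\<close> for matrices is the entrywise power, hence the iteration of \<open>**\<close> below.
\<close>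

definition positive_regular :: "real ^ 'd ^ 'd::finite \<Rightarrow> bool" where
  "positive_regular M \<longleftrightarrow> (\<exists>n\<ge>1. \<forall>i j. (((\<lambda>A. M ** A) ^^ n) (mat 1)) $ i $ j > 0)"

definition nonsingular ::
  "('d::finite \<Rightarrow> (nat ^ 'd) pmf) \<Rightarrow> real ^ 'd ^ 'd \<Rightarrow> bool" where
  "nonsingular p M \<longleftrightarrow> \<not> (\<forall>r\<in>{0..1}. gen_fun p r = M *v r)"

definition assumption_A1 ::
  "('d::finite \<Rightarrow> (nat ^ 'd) pmf) \<Rightarrow> (nat ^ 'd \<Rightarrow> 'a measure) \<Rightarrow> (nat \<Rightarrow> 'a \<Rightarrow> nat ^ 'd) \<Rightarrow> bool" where
  "assumption_A1 p P X \<longleftrightarrow>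
     finite_means P X \<and>
     nonsingular p (mean_matrix P X) \<and>
     positive_regular (mean_matrix P X) \<and>
     (\<forall>i. extinction_prob P X $ i > 0)"

definition complex_eigenvalue :: "real ^ 'd ^ 'd::finite \<Rightarrow> complex \<Rightarrow> bool" where
  "complex_eigenvalue M c \<longleftrightarrow>
     (\<exists>w::complex ^ 'd. w \<noteq> 0 \<and> (\<chi> i j. complex_of_real (M $ i $ j)) *v w = c *s w)"

text \<open>
  The Perron root is the largest modulus of an eigenvalue; the supremum is over a finite nonempty set.
\<close>

definition perron_root :: "real ^ 'd ^ 'd::finite \<Rightarrow> real" where
  "perron_root M = (SUP c\<in>{c. complex_eigenvalue M c}. cmod c)"

definition perron_right_eigenvector :: "real ^ 'd ^ 'd::finite \<Rightarrow> real ^ 'd" where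
  "perron_right_eigenvector M =
     (THE u. (\<forall>i. u $ i > 0) \<and> M *v u = perron_root M *s u \<and> (\<Sum>i\<in>UNIV. u $ i) = 1)"

definition centred_product :: "(nat ^ 'd::finite) pmf \<Rightarrow> 'd \<Rightarrow> 'd \<Rightarrow> nat ^ 'd \<Rightarrow> real" where
  "centred_product \<pi> j l k =
     (real (k $ j) - measure_pmf.expectation \<pi> (\<lambda>k. real (k $ j))) *
     (real (k $ l) - measure_pmf.expectation \<pi> (\<lambda>k. real (k $ l)))"

definition finite_covariance :: "(nat ^ 'd::finite) pmf \<Rightarrow> bool" where
  "finite_covariance \<pi> \<longleftrightarrow> (\<forall>j l. integrable (measure_pmf \<pi>) (centred_product \<pi> j l))"

definition associated_process ::
  "('d::finite \<Rightarrow> (nat ^ 'd) pmf) \<Rightarrow> real ^ 'd \<Rightarrow>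
   (nat ^ 'd \<Rightarrow> 'b measure) \<Rightarrow> (nat \<Rightarrow> 'b \<Rightarrow> nat ^ 'd) \<Rightarrow> bool" where
  "associated_process p a Pa Xa \<longleftrightarrow>
     (\<forall>i. a $ i > 0) \<and>
     (\<forall>i. (\<lambda>k. pmf (p i) k * vec_power a k) summable_on UNIV) \<and>
     (\<exists>pa. galton_watson pa Pa Xa \<and>
           (\<forall>r\<in>{0..1}. \<forall>i. gen_fun pa r $ i = gen_fun p (a * r) $ i / gen_fun p a $ i))"

text \<open>
  The value at \<open>z = 0\<close> is \<open>0\<close>, since all the conditional probabilities vanish there.
\<close>

definition yaglom ::
  "(nat ^ 'd::finite \<Rightarrow> 'a measure) \<Rightarrow> (nat \<Rightarrow> 'a \<Rightarrow> nat ^ 'd) \<Rightarrow> nat ^ 'd \<Rightarrow> real" where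
  "yaglom P X z =
     (THE l. \<forall>x. x \<noteq> 0 \<longrightarrow> (\<lambda>k. \<P>(\<omega> in P x. X k \<omega> = z \<bar> X k \<omega> \<noteq> 0)) \<longlonglongrightarrow> l)"

definition vec_dot :: "nat ^ 'd::finite \<Rightarrow> real ^ 'd \<Rightarrow> real" where
  "vec_dot z u = (\<Sum>j\<in>UNIV. real (z $ j) * u $ j)"

definition size_biased_yaglom ::
  "(nat ^ 'd::finite \<Rightarrow> 'a measure) \<Rightarrow> (nat \<Rightarrow> 'a \<Rightarrow> nat ^ 'd) \<Rightarrow> nat ^ 'd \<Rightarrow> real" where
  "size_biased_yaglom P X z =
     (let u = perron_right_eigenvector (mean_matrix P X)
      in if z = 0 then 0
         else vec_dot z u * yaglom P X z / (\<Sum>\<^sub>\<infinity>y\<in>UNIV - {0}. vec_dot y u * yaglom P X y))"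

end

theory Submission
  imports Defs
begin

text \<open>
  Let \<open>f\<close> be the offspring generating function and \<open>q\<close> the extinction probability vector, a fixed point
  of \<open>f\<close>. Generating functions give \<open>P_x(Y_k = z) = P_x(X_k = z) q^z / q^x\<close> for the associated process
  \<open>Y\<close>, so by the Markov property the conditional probability equals
  \<open>P_x(Y_k = z) P_z(Y_n \<noteq> 0) / P_x(Y_{k+n} \<noteq> 0)\<close>. If \<open>\<rho> < 1\<close> then \<open>q = 1\<close> and \<open>Y\<close> has the law of \<open>X\<close>; if
  \<open>\<rho> > 1\<close> then \<open>q < 1\<close>, and Bernoulli's inequality shows that \<open>Y\<close> is subcritical with finite second moments.

  For a subcritical process with mean matrix \<open>M\<close>, \<open>M u = \<sigma> u\<close>, and finite second moments, a bounded
  functional \<open>h\<close> with \<open>h 0 = 0\<close> satisfies \<open>E_y h(Y_k) = \<Sum>j. y_j E_{e_j} h(Y_k) + O(\<sigma>^{2k} (y \<bullet> u)^2)\<close>,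
  because two subpopulations are rarely both alive. Conditioning on the first generation, the vectors
  \<open>\<sigma>^{-k} (E_{e_i} h(Y_k))_i\<close> follow the iteration of \<open>M / \<sigma>\<close> up to a summable error and hence converge
  to a multiple of \<open>u\<close>. Taking for \<open>h\<close> the indicators of survival and of \<open>{z}\<close> gives constants \<open>\<gamma>\<close> and
  \<open>G z\<close>, and the Yaglom distribution is \<open>G z / \<gamma>\<close>. The measures with weights \<open>\<sigma>^{-k} (z \<bullet> u) P_x(Y_k = z)\<close>
  have constant mass \<open>x \<bullet> u\<close> and are tight by the second moment bound, so \<open>\<Sum>z. (z \<bullet> u) G z = 1\<close>, and both
  sides of the claim equal \<open>(z \<bullet> u) G z\<close>.
\<close>

section \<open>Vector powers and multivariate power series\<close>

lemma vec_power_add: "vec_power r (x + y) = vec_power r x * vec_power r y"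
  by (simp add: vec_power_def power_add prod.distrib)

lemma vec_power_0 [simp]: "vec_power r 0 = 1"
  by (simp add: vec_power_def)

lemma vec_power_axis [simp]: "vec_power r (axis i 1) = r $ i"
proof -
  have "(\<Prod>j\<in>UNIV. (r $ j) ^ (axis i 1 $ j)) = (\<Prod>j\<in>UNIV. if j = i then r $ i else 1)"
    by (intro prod.cong) (auto simp: axis_def)
  then show ?thesis
    by (simp add: vec_power_def prod.delta)
qed

lemma vec_power_mult: "vec_power (a * r) k = vec_power a k * vec_power r k"
  by (simp add: vec_power_def power_mult_distrib prod.distrib)

lemma vec_power_1 [simp]: "vec_power 1 k = 1"
  by (simp add: vec_power_def)

lemma vec_power_zero_base: "vec_power 0 k = (if k = 0 then 1 else 0)"
proof (cases "k = 0")
  case False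
  then obtain j where "k $ j \<noteq> 0"
    by (auto simp: vec_eq_iff)
  then show ?thesis
    using False by (auto simp: vec_power_def intro!: prod_zero)
qed simp

lemma vec_power_nonneg: "(\<And>j. 0 \<le> r $ j) \<Longrightarrow> 0 \<le> vec_power r k"
  by (simp add: vec_power_def prod_nonneg)

lemma vec_power_pos: "(\<And>j. 0 < r $ j) \<Longrightarrow> 0 < vec_power r k"
  by (simp add: vec_power_def prod_pos)

lemma vec_power_mono: "(\<And>j. 0 \<le> r $ j) \<Longrightarrow> (\<And>j. r $ j \<le> s $ j) \<Longrightarrow> vec_power r k \<le> vec_power s k"
  by (auto simp: vec_power_def intro!: prod_mono power_mono)

lemma vec_power_le_1: "(\<And>j. 0 \<le> r $ j) \<Longrightarrow> (\<And>j. r $ j \<le> 1) \<Longrightarrow> vec_power r k \<le> 1"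
  using vec_power_mono[of r 1 k] by simp

lemma cube_iff: "r \<in> {0..1} \<longleftrightarrow> (\<forall>j. 0 \<le> r $ j \<and> r $ j \<le> 1)" for r :: "real ^ 'd"
  by (auto simp: less_eq_vec_def)

lemma vec_power_cube:
  "r \<in> {0..1} \<Longrightarrow> 0 \<le> vec_power r k" "r \<in> {0..1} \<Longrightarrow> vec_power r k \<le> 1"
  unfolding cube_iff by (auto intro!: vec_power_nonneg vec_power_le_1)

section \<open>Weights of population vectors\<close>

lemma vec_dot_add: "vec_dot (x + y) u = vec_dot x u + vec_dot y u"
  by (simp add: vec_dot_def algebra_simps sum.distrib)

lemma vec_dot_0 [simp]: "vec_dot 0 u = 0"
  by (simp add: vec_dot_def)

lemma vec_dot_axis [simp]: "vec_dot (axis i 1) u = u $ i"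
proof -
  have "(\<Sum>j\<in>UNIV. real (axis i 1 $ j) * u $ j) = (\<Sum>j\<in>UNIV. if j = i then u $ i else 0)"
    by (intro sum.cong) (auto simp: axis_def)
  then show ?thesis
    by (simp add: vec_dot_def)
qed

declare vec_power_axis [unfolded One_nat_def, simp] vec_dot_axis [unfolded One_nat_def, simp]

lemma vec_dot_nonneg: "(\<And>j. 0 \<le> u $ j) \<Longrightarrow> 0 \<le> vec_dot x u"
  by (simp add: vec_dot_def sum_nonneg)

lemma vec_dot_ge_component: "(\<And>j. 0 \<le> u $ j) \<Longrightarrow> real (x $ i) * u $ i \<le> vec_dot x u"
  unfolding vec_dot_def by (rule member_le_sum) auto

text \<open>Unit vectors generate \<open>nat ^ 'd\<close>, so a population can be built one
  individual at a time. Together with the branching property this lifts facts about the offspring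
  laws \<open>p i\<close> to whole populations.\<close>

lemma nat_vec_induct [case_names zero step]:
  fixes x :: "nat ^ 'd::finite"
  assumes "P 0" and step: "\<And>x i. P x \<Longrightarrow> P (x + axis i 1)"
  shows "P x"
proof (induction "\<Sum>i\<in>UNIV. x $ i" arbitrary: x)
  case 0
  then have "x = 0"
    by (simp add: vec_eq_iff)
  then show ?case
    using assms(1) by simp
next
  case (Suc n)
  then obtain i where i: "x $ i \<noteq> 0"
    by (metis (no_types, lifting) nat.distinct(1) sum.neutral)
  define y where "y = (\<chi> j. if j = i then x $ i - 1 else x $ j)"
  have x: "x = y + axis i 1"
    using i by (auto simp: y_def vec_eq_iff axis_def)
  have "(\<Sum>j\<in>UNIV. x $ j) = (\<Sum>j\<in>UNIV. y $ j) + (\<Sum>j\<in>UNIV. axis i 1 $ j)"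
    by (subst x) (simp add: sum.distrib)
  also have "(\<Sum>j\<in>UNIV. axis i 1 $ j) = (1::nat)"
    by (simp add: axis_def)
  finally have "n = (\<Sum>j\<in>UNIV. y $ j)"
    using Suc(2) by simp
  then show ?case
    using Suc(1) step x by blast
qed

lemma vec_dot_pos_iff:
  assumes "\<And>j. 0 < u $ j"
  shows "0 < vec_dot x u \<longleftrightarrow> x \<noteq> 0"
proof
  assume "x \<noteq> 0"
  then obtain i where "x $ i \<noteq> 0"
    by (auto simp: vec_eq_iff)
  then have "0 < real (x $ i) * u $ i"
    using assms by simp
  also have "\<dots> \<le> vec_dot x u"
    using assms by (intro vec_dot_ge_component less_imp_le)
  finally show "0 < vec_dot x u" .
qed auto

lemma finite_vec_bounded: "finite {x :: nat ^ 'd::finite. \<forall>i. x $ i \<le> b i}"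
proof -
  have "finite (vec_nth ` {x :: nat ^ 'd. \<forall>i. x $ i \<le> b i})"
    by (rule finite_subset[OF _ finite_PiE[of UNIV "\<lambda>i. {..b i}"]]) auto
  then show ?thesis
    by (rule finite_imageD) (auto simp: inj_on_def vec_nth_inject)
qed

text \<open>With positive weights, a bound on \<open>vec_dot x u\<close> bounds every coordinate.
  These are the truncation sets of the tightness argument.\<close>

lemma finite_vec_dot_le:
  assumes "\<And>j. 0 < u $ j"
  shows "finite {x. vec_dot x u \<le> K}"
proof (rule finite_subset[OF _ finite_vec_bounded])
  show "{x. vec_dot x u \<le> K} \<subseteq> {x. \<forall>i. x $ i \<le> nat \<lceil>K / u $ i\<rceil>}"
  proof safe
    fix x i assume "vec_dot x u \<le> K"
    then have "real (x $ i) * u $ i \<le> K"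
      using vec_dot_ge_component[of u x i] assms by (simp add: less_imp_le order_trans)
    then have "real (x $ i) \<le> K / u $ i"
      using assms by (simp add: field_simps)
    then show "x $ i \<le> nat \<lceil>K / u $ i\<rceil>"
      by linarith
  qed
qed

section \<open>Uniqueness of power series coefficients\<close>

text \<open>Strong induction: once the coefficients below \<open>n\<close> vanish, the series
  divided by \<open>t ^ n\<close> is zero on (0, 1), while its limit as t decreases to 0 is
  \<open>b n\<close>.\<close>

lemma powser_eq_0_right_imp_coeffs_0:
  fixes b :: "nat \<Rightarrow> real"
  assumes "summable (\<lambda>n. \<bar>b n\<bar>)" and zero: "\<And>t. 0 < t \<Longrightarrow> t < 1 \<Longrightarrow> (\<Sum>n. b n * t ^ n) = 0"
  shows "b n = 0"
proof (induction n rule: less_induct)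
  case (less n)
  have summ: "summable (\<lambda>m. b (m + n) * x ^ m)" if "\<bar>x\<bar> < 1" for x :: real
  proof (rule summable_comparison_test'[of "\<lambda>m. \<bar>b (m + n)\<bar>" 0])
    show "summable (\<lambda>m. \<bar>b (m + n)\<bar>)"
      using assms(1) summable_iff_shift[of "\<lambda>n. \<bar>b n\<bar>" n] by simp
    show "norm (b (m + n) * x ^ m) \<le> \<bar>b (m + n)\<bar>" for m
      using that by (simp add: abs_mult power_abs mult_left_le power_le_one)
  qed
  define g where "g = (\<lambda>x. \<Sum>m. b (m + n) * x ^ m)"
  have "(g \<longlongrightarrow> b (0 + n)) (at 0)"
    by (rule powser_limit_0[where s = 1]) (auto simp: g_def intro!: summable_sums summ)
  then have lim: "(g \<longlongrightarrow> b n) (at_right 0)"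
    by (auto intro: tendsto_mono[OF at_le])
  have g0: "g t = 0" if t: "0 < t" "t < 1" for t
  proof -
    have "(\<lambda>k. b k * t ^ k) sums (\<Sum>k. b k * t ^ k)"
    proof (intro summable_sums summable_comparison_test'[OF assms(1), of 0])
      show "norm (b k * t ^ k) \<le> \<bar>b k\<bar>" for k
        using t by (simp add: abs_mult power_abs mult_left_le power_le_one)
    qed
    then have "(\<lambda>k. b k * t ^ k) sums 0"
      using zero[OF t] by simp
    then have "(\<lambda>m. b (m + n) * t ^ (m + n)) sums (0 - (\<Sum>k<n. b k * t ^ k))"
      by (rule sums_split_initial_segment)
    then have "(\<lambda>m. t ^ n * (b (m + n) * t ^ m)) sums 0"
      using less by (simp add: power_add mult_ac)
    then have "(\<lambda>m. b (m + n) * t ^ m) sums 0"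
      using t sums_mult_iff[of "t ^ n" "\<lambda>m. b (m + n) * t ^ m" 0] by simp
    then show ?thesis
      by (simp add: g_def sums_iff)
  qed
  have "\<forall>\<^sub>F t in at_right (0::real). g t = 0"
    using eventually_at_right_less[of 0] eventually_at_right_real[of 0 1]
    by (auto elim!: eventually_mono simp: g0)
  then have "(g \<longlongrightarrow> 0) (at_right 0)"
    by (rule tendsto_eventually)
  then show "b n = 0"
    using lim tendsto_unique[of "at_right (0::real)"] by auto
qed

text \<open>Fixing the exponents one coordinate at a time reduces this to the univariate case.\<close>

lemma infsum_vec_power_eq_0_imp_coeff_0:
  fixes c :: "nat ^ 'd::finite \<Rightarrow> real"
  assumes "(\<lambda>k. \<bar>c k\<bar>) summable_on UNIV"
    and "\<And>r. r \<in> {0..1} \<Longrightarrow> (\<Sum>\<^sub>\<infinity>k\<in>UNIV. c k * vec_power r k) = 0"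
  shows "c z = 0"
proof -
  have summ: "(\<lambda>k. c k * vec_power r k) summable_on D" if "r \<in> {0..1}" for r D
  proof -
    have "(\<lambda>k. norm (c k * vec_power r k)) summable_on UNIV"
      by (rule summable_on_comparison_test[OF assms(1)])
         (use vec_power_cube[OF that] in \<open>auto simp: abs_mult mult_left_le\<close>)
    then have "(\<lambda>k. c k * vec_power r k) summable_on UNIV"
      by (rule abs_summable_summable)
    then show ?thesis
      by (rule summable_on_subset_banach) simp
  qed
  have main: "\<forall>r. (\<forall>j. 0 < r $ j \<and> r $ j \<le> 1) \<longrightarrow> (\<Sum>\<^sub>\<infinity>k\<in>{k. \<forall>j\<in>S. k $ j = z $ j}. c k * vec_power r k) = 0"
    for S :: "'d set"
  proof (induction S rule: finite_induct[OF finite])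
    case 1
    then show ?case
      using assms(2) unfolding cube_iff by (auto intro: less_imp_le)
  next
    case (2 i S)
    show ?case
    proof (intro allI impI)
      fix r :: "real ^ 'd"
      assume r: "\<forall>j. 0 < r $ j \<and> r $ j \<le> 1"
      define D where "D = {k. \<forall>j\<in>S. k $ j = z $ j}"
      \<comment> \<open>\<open>R t\<close> replaces coordinate \<open>i\<close> of \<open>r\<close>
        by \<open>t\<close>, and \<open>b m\<close> collects the terms of exponent \<open>m\<close>
        in that coordinate, taken at \<open>t = 1\<close>. The sum over \<open>D\<close> thus
        becomes a power series in \<open>t\<close> with coefficients \<open>b m\<close>.\<close>
      define R where "R = (\<lambda>t. \<chi> j. if j = i then t else r $ j)"
      define b where "b = (\<lambda>m. \<Sum>\<^sub>\<infinity>k\<in>{k\<in>D. k $ i = m}. c k * vec_power (R 1) k)"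
      have Rp: "vec_power (R t) k = t ^ (k $ i) * vec_power (R 1) k" for t k
      proof -
        have "vec_power (R t) k = (\<Prod>j\<in>UNIV. (if j = i then t else 1) ^ (k $ j) * (R 1 $ j) ^ (k $ j))"
          unfolding vec_power_def by (intro prod.cong) (auto simp: R_def)
        also have "\<dots> = (\<Prod>j\<in>UNIV. if j = i then t ^ (k $ i) else 1) * vec_power (R 1) k"
          unfolding vec_power_def prod.distrib by (intro arg_cong2[where f="(*)"] prod.cong) auto
        finally show ?thesis
          by simp
      qed
      have Rc: "R t \<in> {0..1}" if "0 < t" "t \<le> 1" for t
        using r that unfolding cube_iff by (auto simp: R_def intro: less_imp_le)
      have hs: "((\<lambda>m. b m * t ^ m) has_sum (\<Sum>\<^sub>\<infinity>k\<in>D. c k * vec_power (R t) k)) UNIV"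
        if t: "0 < t" "t \<le> 1" for t
      proof (rule has_sum_Sigma')
        show "((\<lambda>(m, k). c k * vec_power (R t) k) has_sum (\<Sum>\<^sub>\<infinity>k\<in>D. c k * vec_power (R t) k))
          (SIGMA m:UNIV. {k\<in>D. k $ i = m})"
          by (rule has_sum_reindex_bij_witness[of _ "\<lambda>k. (k $ i, k)" snd "D", THEN iffD2,
                OF _ _ _ _ _ _ has_sum_infsum[OF summ[OF Rc[OF t]]]]) auto
        show "((\<lambda>k. case (m, k) of (m, k) \<Rightarrow> c k * vec_power (R t) k) has_sum b m * t ^ m) {k \<in> D. k $ i = m}" for m
        proof -
          have "((\<lambda>k. c k * vec_power (R 1) k * t ^ m) has_sum b m * t ^ m) {k \<in> D. k $ i = m}"
            unfolding b_def by (intro has_sum_cmult_left has_sum_infsum summ Rc) auto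
          then show ?thesis
            by (rule has_sum_cong[THEN iffD1, rotated]) (auto simp: Rp[of t] mult_ac)
        qed
      qed
      have "((\<lambda>m. b m * t ^ m) sums 0)" if t: "0 < t" "t \<le> 1" for t
      proof -
        have "(\<Sum>\<^sub>\<infinity>k\<in>D. c k * vec_power (R t) k) = 0"
          using 2(3) r t by (auto simp: R_def D_def)
        then show ?thesis
          using has_sum_imp_sums[OF hs[OF t]] by simp
      qed
      \<comment> \<open>At \<open>t = 1\<close> the grouped series is the series of the
        \<open>b m\<close> themselves, and unconditional summability of reals is absolute.\<close>
      moreover have "summable (\<lambda>m. \<bar>b m\<bar>)"
      proof -
        have "(\<lambda>m. b m) summable_on UNIV"
          using hs[of 1] by (auto simp: summable_on_def)
        then show ?thesis
          using summable_on_imp_summable summable_on_iff_abs_summable_on_real by fastforce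
      qed
      ultimately have b0: "b m = 0" for m
        using powser_eq_0_right_imp_coeffs_0[of b m] by (simp add: sums_iff)
      have "(\<Sum>\<^sub>\<infinity>k\<in>{k. \<forall>j\<in>insert i S. k $ j = z $ j}. c k * vec_power r k) =
        (\<Sum>\<^sub>\<infinity>k\<in>{k\<in>D. k $ i = z $ i}. (r $ i) ^ (z $ i) * (c k * vec_power (R 1) k))"
      proof (rule infsum_cong_neutral)
        have "R (r $ i) = r"
          by (simp add: R_def vec_eq_iff)
        then show "c k * vec_power r k = (r $ i) ^ (z $ i) * (c k * vec_power (R 1) k)"
          if "k \<in> {k. \<forall>j\<in>insert i S. k $ j = z $ j} \<inter> {k\<in>D. k $ i = z $ i}" for k
          using Rp[of "r $ i" k] that by auto
      qed (auto simp: D_def)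
      also have "\<dots> = (r $ i) ^ (z $ i) * b (z $ i)"
        unfolding b_def by (intro infsum_cmult_right summ Rc) auto
      finally show "(\<Sum>\<^sub>\<infinity>k\<in>{k. \<forall>j\<in>insert i S. k $ j = z $ j}. c k * vec_power r k) = 0"
        using b0 by simp
    qed
  qed
  \<comment> \<open>With every exponent fixed a single term is left, and at the point
    \<open>1\<close> it equals \<open>c z\<close>.\<close>
  have "{k. \<forall>j\<in>UNIV. k $ j = z $ j} = {z}"
    by (auto simp: vec_eq_iff)
  then show ?thesis
    using main[of UNIV] by (auto dest: spec[of _ 1])
qed

section \<open>Generating functions\<close>

lemma integrable_pmf_bounded:
  fixes f :: "'a \<Rightarrow> real"
  assumes "\<And>x. \<bar>f x\<bar> \<le> B"
  shows "integrable (measure_pmf \<pi>) f"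
  by (rule measure_pmf.integrable_const_bound[of _ B]) (auto simp: assms)

lemma expectation_pmf_abs_le:
  fixes f :: "'a \<Rightarrow> real"
  assumes "\<And>x. \<bar>f x\<bar> \<le> B"
  shows "\<bar>measure_pmf.expectation \<pi> f\<bar> \<le> B"
proof -
  have "\<bar>measure_pmf.expectation \<pi> f\<bar> \<le> measure_pmf.expectation \<pi> (\<lambda>x. \<bar>f x\<bar>)"
    by (rule integral_abs_bound)
  also have "\<dots> \<le> measure_pmf.expectation \<pi> (\<lambda>_. B)"
    by (intro integral_mono integrable_pmf_bounded[of _ B]) (auto simp: assms order_trans[OF abs_ge_zero assms])
  finally show ?thesis
    by simp
qed

lemma expectation_bind_pmf:
  fixes f :: "'b \<Rightarrow> real"
  assumes "\<And>x. \<bar>f x\<bar> \<le> B"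
  shows "measure_pmf.expectation (bind_pmf M N) f =
    measure_pmf.expectation M (\<lambda>x. measure_pmf.expectation (N x) f)"
  unfolding measure_pmf_bind
  by (rule integral_bind[where K = "count_space UNIV" and B = B and B' = 1])
     (auto simp: assms measure_pmf_in_subprob_space measure_pmf.emeasure_space_1 measure_pmf.finite_measure_axioms intro: measure_pmf.emeasure_le_1)

text \<open>Expectation form of one coordinate of \<open>gen_fun\<close>, to which monotone
  comparison and dominated convergence apply directly; the two forms agree on the unit cube.\<close>

definition pgf :: "(nat ^ 'd::finite) pmf \<Rightarrow> real ^ 'd \<Rightarrow> real" where
  "pgf \<pi> r = measure_pmf.expectation \<pi> (vec_power r)"

lemma abs_vec_power_cube: "r \<in> {0..1} \<Longrightarrow> \<bar>vec_power r k\<bar> \<le> 1"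
  using vec_power_cube[of r k] by simp

lemma integrable_vec_power: "r \<in> {0..1} \<Longrightarrow> integrable (measure_pmf \<pi>) (vec_power r)"
  by (rule integrable_pmf_bounded[of _ 1]) (rule abs_vec_power_cube)

lemma pgf_cube: assumes "r \<in> {0..1}" shows "0 \<le> pgf \<pi> r" "pgf \<pi> r \<le> 1"
proof -
  show "0 \<le> pgf \<pi> r"
    unfolding pgf_def by (intro integral_nonneg_AE AE_I2 vec_power_cube assms)
  show "pgf \<pi> r \<le> 1"
    using expectation_pmf_abs_le[of "vec_power r" 1 \<pi>] abs_vec_power_cube[OF assms] by (simp add: pgf_def)
qed

lemma pgf_mono:
  assumes "r \<in> {0..1}" "s \<in> {0..1}" "\<And>j. r $ j \<le> s $ j"
  shows "pgf \<pi> r \<le> pgf \<pi> s"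
  unfolding pgf_def using assms
  by (intro integral_mono integrable_vec_power vec_power_mono) (auto simp: less_eq_vec_def)

lemma pgf_return_pmf [simp]: "pgf (return_pmf x) r = vec_power r x"
  by (simp add: pgf_def)

lemma pmf_abs_summable_on: "(\<lambda>k. \<bar>pmf \<pi> k * f k\<bar>) summable_on A" if "\<And>k. \<bar>f k\<bar> \<le> B" for f :: "_ \<Rightarrow> real"
proof -
  have "(\<lambda>k. norm (pmf \<pi> k)) summable_on A"
    using pmf_abs_summable[of \<pi> A] by (simp only: abs_summable_equivalent)
  then have "(\<lambda>k. norm (pmf \<pi> k) * B) summable_on A"
    by (rule summable_on_cmult_left)
  then show ?thesis
    by (rule summable_on_comparison_test) (auto simp: abs_mult that mult_left_mono)
qed

lemma expectation_pmf_eq_infsum: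
  fixes f :: "_ \<Rightarrow> real"
  assumes "\<And>k. \<bar>f k\<bar> \<le> B"
  shows "measure_pmf.expectation \<pi> f = (\<Sum>\<^sub>\<infinity>k\<in>UNIV. pmf \<pi> k * f k)"
proof -
  have "(\<lambda>k. norm (pmf \<pi> k * f k)) summable_on UNIV"
    using pmf_abs_summable_on[OF assms] by simp
  then show ?thesis
    by (simp add: pmf_expectation_eq_infsetsum infsetsum_infsum flip: abs_summable_equivalent)
qed

lemma gen_fun_eq_pgf: "r \<in> {0..1} \<Longrightarrow> gen_fun p r $ i = pgf (p i) r"
  by (simp add: gen_fun_def pgf_def expectation_pmf_eq_infsum[OF abs_vec_power_cube] del: atLeastAtMost_iff)

text \<open>Both sides are absolutely convergent power series in \<open>r\<close>, so coefficients
  can be compared. The scaling \<open>q\<close> and the factor \<open>C\<close> are what relates a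
  process to its associated process; \<open>q = 1\<close> and \<open>C = 1\<close> give plain
  uniqueness.\<close>

lemma pmf_eqI_pgf_scaled:
  assumes q: "q \<in> {0..1}" and eq: "\<And>r. r \<in> {0..1} \<Longrightarrow> pgf \<mu> (q * r) = C * pgf \<nu> r"
  shows "pmf \<mu> z * vec_power q z = C * pmf \<nu> z"
proof -
  have qr: "q * r \<in> {0..1}" if "r \<in> {0..1}" for r
    using q that unfolding cube_iff by (simp add: mult_le_one)
  have s1: "(\<lambda>k. \<bar>pmf \<mu> k * vec_power q k\<bar>) summable_on UNIV"
    by (rule pmf_abs_summable_on[OF abs_vec_power_cube[OF q]])
  have s2: "(\<lambda>k. \<bar>pmf \<nu> k * C\<bar>) summable_on UNIV"
    by (intro pmf_abs_summable_on) auto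
  have "pmf \<mu> z * vec_power q z - pmf \<nu> z * C = 0"
  proof (rule infsum_vec_power_eq_0_imp_coeff_0)
    show "(\<lambda>k. \<bar>pmf \<mu> k * vec_power q k - pmf \<nu> k * C\<bar>) summable_on UNIV"
      by (rule summable_on_comparison_test[OF summable_on_add[OF s1 s2]]) auto
    fix r :: "real ^ 'a" assume r: "r \<in> {0..1}"
    have t1: "(\<lambda>k. pmf \<mu> k * vec_power (q * r) k) summable_on UNIV"
      by (rule abs_summable_summable)
         (simp only: real_norm_def, rule pmf_abs_summable_on[OF abs_vec_power_cube[OF qr[OF r]]])
    have t2: "(\<lambda>k. pmf \<nu> k * vec_power r k) summable_on UNIV"
      by (rule abs_summable_summable)
         (simp only: real_norm_def, rule pmf_abs_summable_on[OF abs_vec_power_cube[OF r]])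
    have "(\<Sum>\<^sub>\<infinity>k. (pmf \<mu> k * vec_power q k - pmf \<nu> k * C) * vec_power r k) =
      (\<Sum>\<^sub>\<infinity>k. pmf \<mu> k * vec_power (q * r) k - C * (pmf \<nu> k * vec_power r k))"
      by (simp add: vec_power_mult algebra_simps)
    also have "\<dots> = pgf \<mu> (q * r) - C * pgf \<nu> r"
      using infsum_cmult_right[of "- C", OF t2] infsum_add[OF t1 summable_on_cmult_right[OF t2, of "- C"]]
      by (simp add: pgf_def expectation_pmf_eq_infsum[OF abs_vec_power_cube[OF qr[OF r]]]
          expectation_pmf_eq_infsum[OF abs_vec_power_cube[OF r]])
    finally show "(\<Sum>\<^sub>\<infinity>k. (pmf \<mu> k * vec_power q k - pmf \<nu> k * C) * vec_power r k) = 0"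
      using eq[OF r] by simp
  qed
  then show ?thesis
    by (simp add: mult.commute)
qed

lemma pmf_eqI_pgf:
  assumes "\<And>r. r \<in> {0..1} \<Longrightarrow> pgf \<mu> r = pgf \<nu> r"
  shows "\<mu> = \<nu>"
proof (rule pmf_eqI)
  fix z
  have "pmf \<mu> z * vec_power 1 z = 1 * pmf \<nu> z"
    by (rule pmf_eqI_pgf_scaled) (use assms in \<open>auto simp: less_eq_vec_def\<close>)
  then show "pmf \<mu> z = pmf \<nu> z"
    by simp
qed

lemma gen_fun_in_cube: "r \<in> {0..1} \<Longrightarrow> gen_fun p r \<in> {0..1}"
  by (subst cube_iff) (simp add: gen_fun_eq_pgf pgf_cube del: atLeastAtMost_iff)

lemma finite_individuals [simp]: "finite (individuals x)"
  by (auto simp: individuals_def)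

text \<open>Independence turns the expectation of a product over individuals into a product of
  expectations, one factor \<open>gen_fun p r $ i\<close> for each individual of type
  \<open>i\<close>.\<close>

lemma pgf_next_generation:
  assumes r: "r \<in> {0..1}"
  shows "pgf (next_generation p x) r = vec_power (gen_fun p r) x"
proof -
  have vp: "vec_power r (\<Sum>a\<in>A. \<xi> a) = (\<Prod>a\<in>A. vec_power r (\<xi> a))" if "finite A" for A and \<xi> :: "'b \<Rightarrow> _"
    using that by induction (auto simp: vec_power_add)
  have "pgf (next_generation p x) r =
    measure_pmf.expectation (Pi_pmf (individuals x) 0 (\<lambda>(i, m). p i)) (\<lambda>\<xi>. \<Prod>a\<in>individuals x. vec_power r (\<xi> a))"
    by (simp add: pgf_def next_generation_def vp)
  also have "\<dots> = (\<Prod>a\<in>individuals x. measure_pmf.expectation ((\<lambda>(i, m). p i) a) (vec_power r))"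
    by (intro expectation_prod_Pi_pmf integrable_vec_power vec_power_cube r) auto
  also have "\<dots> = (\<Prod>a\<in>individuals x. gen_fun p r $ fst a)"
    by (intro prod.cong) (auto simp: gen_fun_eq_pgf[OF r] pgf_def)
  also have "\<dots> = (\<Prod>i\<in>UNIV. \<Prod>m<x $ i. gen_fun p r $ i)"
    unfolding individuals_def by (subst prod.Sigma) (auto simp: case_prod_unfold)
  finally show ?thesis
    by (simp add: vec_power_def)
qed

lemma next_generation_axis: "next_generation p (axis i 1) = p i"
  by (rule pmf_eqI_pgf) (simp add: pgf_next_generation gen_fun_eq_pgf del: atLeastAtMost_iff)

section \<open>Laws of the generations as mass functions\<close>

text \<open>The law of generation \<open>n\<close> from \<open>x\<close>, independent of the space
  that carries the chain. The asymptotics are proved for these laws and transferred to the chain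
  through its joint probabilities.\<close>

primrec gw :: "('d::finite \<Rightarrow> (nat ^ 'd) pmf) \<Rightarrow> nat \<Rightarrow> nat ^ 'd \<Rightarrow> (nat ^ 'd) pmf" where
  "gw p 0 x = return_pmf x"
| "gw p (Suc n) x = bind_pmf (gw p n x) (next_generation p)"

lemma gw_Suc_left: "gw p (Suc n) x = bind_pmf (next_generation p x) (gw p n)"
proof (induction n)
  case 0
  show ?case
    by (simp add: bind_return_pmf bind_return_pmf')
next
  case (Suc n)
  have "gw p (Suc (Suc n)) x = bind_pmf (bind_pmf (next_generation p x) (gw p n)) (next_generation p)"
    using Suc by simp
  then show ?case
    by (simp add: bind_assoc_pmf)
qed

lemma gen_fun_iterate_in_cube: "r \<in> {0..1} \<Longrightarrow> (gen_fun p ^^ n) r \<in> {0..1}"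
  by (induction n) (auto intro: gen_fun_in_cube simp del: atLeastAtMost_iff)

text \<open>Conditioning on generation \<open>n\<close> replaces the argument \<open>r\<close> by
  \<open>gen_fun p r\<close>; for this reason the induction leaves \<open>r\<close>
  arbitrary.\<close>

lemma pgf_gw: "r \<in> {0..1} \<Longrightarrow> pgf (gw p n x) r = vec_power ((gen_fun p ^^ n) r) x"
proof (induction n arbitrary: r)
  case 0
  then show ?case
    by (simp add: pgf_def)
next
  case (Suc n)
  have "pgf (gw p (Suc n) x) r = measure_pmf.expectation (gw p n x) (\<lambda>y. pgf (next_generation p y) r)"
    unfolding pgf_def gw.simps by (rule expectation_bind_pmf[OF abs_vec_power_cube[OF Suc.prems]])
  also have "\<dots> = pgf (gw p n x) (gen_fun p r)"
    by (simp only: pgf_next_generation[OF Suc.prems] pgf_def[of "gw p n x"])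
  also have "\<dots> = vec_power ((gen_fun p ^^ n) (gen_fun p r)) x"
    by (rule Suc.IH[OF gen_fun_in_cube[OF Suc.prems]])
  finally show ?case
    by (simp only: funpow_Suc_right o_apply)
qed

text \<open>Branching property: \<open>vec_power\<close> turns sums of populations into products,
  both in the starting state and in the independent sum on the right, so the generating functions
  agree.\<close>

lemma gw_add: "gw p n (x + y) = bind_pmf (gw p n x) (\<lambda>a. map_pmf ((+) a) (gw p n y))"
proof (rule pmf_eqI_pgf)
  fix r :: "real ^ 'a" assume r: "r \<in> {0..1}"
  have "pgf (bind_pmf (gw p n x) (\<lambda>a. map_pmf ((+) a) (gw p n y))) r =
    measure_pmf.expectation (gw p n x) (\<lambda>a. measure_pmf.expectation (map_pmf ((+) a) (gw p n y)) (vec_power r))"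
    unfolding pgf_def by (rule expectation_bind_pmf[OF abs_vec_power_cube[OF r]])
  also have "\<dots> = pgf (gw p n x) r * pgf (gw p n y) r"
    by (simp add: vec_power_add pgf_def)
  finally show "pgf (gw p n (x + y)) r = pgf (bind_pmf (gw p n x) (\<lambda>a. map_pmf ((+) a) (gw p n y))) r"
    by (simp add: pgf_gw[OF r] vec_power_add)
qed

lemma gw_one: "gw p 1 x = next_generation p x"
  by (simp add: bind_return_pmf)

lemma gw_0_right [simp]: "gw p n 0 = return_pmf 0"
  by (rule pmf_eqI_pgf) (simp add: pgf_gw pgf_return_pmf del: atLeastAtMost_iff)

lemma zero_in_cube: "0 \<in> {0..1 :: real ^ 'd}"
  by (auto simp: less_eq_vec_def)

text \<open>At the point 0 only the empty population contributes, by the convention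
  \<open>0 ^ 0 = 1\<close>.\<close>

lemma pmf_gw_0: "pmf (gw p n x) 0 = vec_power ((gen_fun p ^^ n) 0) x"
proof -
  have "pgf (gw p n x) 0 = measure_pmf.expectation (gw p n x) (indicator {0})"
    unfolding pgf_def by (rule Bochner_Integration.integral_cong) (auto simp: vec_power_zero_base)
  then show ?thesis
    by (simp add: pgf_gw[OF zero_in_cube] pmf.rep_eq)
qed

section \<open>Laws of the Galton-Watson chain\<close>

context
  fixes p :: "'d::finite \<Rightarrow> (nat ^ 'd) pmf" and P :: "nat ^ 'd \<Rightarrow> 'a measure"
    and X :: "nat \<Rightarrow> 'a \<Rightarrow> nat ^ 'd"
  assumes GW: "galton_watson p P X"
begin

lemma gw_prob_space: "prob_space (P x)"
  and gw_measurable [measurable]: "X k \<in> P x \<rightarrow>\<^sub>M count_space UNIV"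
  and gw_initial: "AE \<omega> in P x. X 0 \<omega> = x"
  using GW by (auto simp: galton_watson_def)

text \<open>\<open>galton_watson\<close> prescribes the transition after pasts of positive
  probability; after a null past both sides are 0.\<close>

lemma emeasure_gw_path_step:
  "emeasure (P x) {\<omega>\<in>space (P x). (\<forall>i\<le>m. X i \<omega> = s i) \<and> X (Suc m) \<omega> = w} =
   emeasure (P x) {\<omega>\<in>space (P x). \<forall>i\<le>m. X i \<omega> = s i} * pmf (next_generation p (s m)) w"
proof -
  interpret prob_space "P x" by (rule gw_prob_space)
  have "prob {\<omega>\<in>space (P x). (\<forall>i\<le>m. X i \<omega> = s i) \<and> X (Suc m) \<omega> = w} =
    prob {\<omega>\<in>space (P x). \<forall>i\<le>m. X i \<omega> = s i} * pmf (next_generation p (s m)) w"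
  proof (cases "prob {\<omega>\<in>space (P x). \<forall>i\<le>m. X i \<omega> = s i} > 0")
    case True
    then have "\<P>(\<omega> in P x. X (Suc m) \<omega> = w \<bar> \<forall>j\<le>m. X j \<omega> = s j) = pmf (next_generation p (s m)) w"
      using GW by (auto simp: galton_watson_def)
    then show ?thesis
      using True by (simp add: cond_prob_def field_simps conj_commute)
  next
    case False
    have "prob {\<omega>\<in>space (P x). (\<forall>i\<le>m. X i \<omega> = s i) \<and> X (Suc m) \<omega> = w} \<le>
      prob {\<omega>\<in>space (P x). \<forall>i\<le>m. X i \<omega> = s i}"
      by (rule finite_measure_mono) auto
    then show ?thesis
      using False by (simp add: not_less measure_le_0_iff)
  qed
  then show ?thesis
    by (simp add: emeasure_eq_measure ennreal_mult)
qed

text \<open>Sum the path identity over the countably many pasts that pass through \<open>z\<close>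
  at time \<open>j\<close> and end in \<open>y\<close>; the transition factor depends only on the
  last state and comes out of the sum.\<close>

lemma emeasure_gw_step:
  assumes "j \<le> m"
  shows "emeasure (P x) {\<omega>\<in>space (P x). X j \<omega> = z \<and> X m \<omega> = y \<and> X (Suc m) \<omega> = w} =
    emeasure (P x) {\<omega>\<in>space (P x). X j \<omega> = z \<and> X m \<omega> = y} * pmf (next_generation p y) w"
proof -
  \<comment> \<open>Pasts are extensional functions on \<open>{..m}\<close>, so distinct elements of
    \<open>I\<close> differ at some time up to \<open>m\<close> and give disjoint events.\<close>
  define I where "I = {s \<in> PiE {..m} (\<lambda>_. UNIV). s j = z \<and> s m = y}"
  have I: "countable I"
    by (rule countable_subset[OF _ countable_PiE[of "{..m}" "\<lambda>_. UNIV :: (nat ^ 'd) set"]]) (auto simp: I_def)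
  have disj: "disjoint_family_on (\<lambda>s. {\<omega>\<in>space (P x). (\<forall>i\<le>m. X i \<omega> = s i) \<and> R \<omega>}) I" for R
  proof (unfold disjoint_family_on_def, safe)
    fix s t \<omega> assume "s \<in> I" "t \<in> I" and *: "s \<noteq> t" "\<forall>i\<le>m. X i \<omega> = s i" "\<forall>i\<le>m. X i \<omega> = t i"
    then have "s = t"
      by (intro PiE_ext[of s "{..m}" "\<lambda>_. UNIV" t]) (auto simp: I_def)
    with * show "\<omega> \<in> {}" by simp
  qed
  have un: "{\<omega>\<in>space (P x). X j \<omega> = z \<and> X m \<omega> = y \<and> R \<omega>} =
    (\<Union>s\<in>I. {\<omega>\<in>space (P x). (\<forall>i\<le>m. X i \<omega> = s i) \<and> R \<omega>})" for R
  proof (rule set_eqI, rule iffI)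
    fix \<omega> assume "\<omega> \<in> {\<omega>\<in>space (P x). X j \<omega> = z \<and> X m \<omega> = y \<and> R \<omega>}"
    then show "\<omega> \<in> (\<Union>s\<in>I. {\<omega>\<in>space (P x). (\<forall>i\<le>m. X i \<omega> = s i) \<and> R \<omega>})"
      using assms by (intro UN_I[of "restrict (\<lambda>i. X i \<omega>) {..m}"]) (auto simp: I_def)
  qed (use assms in \<open>auto simp: I_def\<close>)
  have "emeasure (P x) {\<omega>\<in>space (P x). X j \<omega> = z \<and> X m \<omega> = y \<and> X (Suc m) \<omega> = w} =
    (\<integral>\<^sup>+s. emeasure (P x) {\<omega>\<in>space (P x). (\<forall>i\<le>m. X i \<omega> = s i) \<and> X (Suc m) \<omega> = w} \<partial>count_space I)"
    unfolding un by (rule emeasure_UN_countable) (auto intro!: I disj)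
  also have "\<dots> = (\<integral>\<^sup>+s. emeasure (P x) {\<omega>\<in>space (P x). (\<forall>i\<le>m. X i \<omega> = s i) \<and> True} * pmf (next_generation p y) w \<partial>count_space I)"
    by (intro nn_integral_cong, subst emeasure_gw_path_step) (auto simp: I_def)
  also have "\<dots> = (\<integral>\<^sup>+s. emeasure (P x) {\<omega>\<in>space (P x). (\<forall>i\<le>m. X i \<omega> = s i) \<and> True} \<partial>count_space I) * pmf (next_generation p y) w"
    by (rule nn_integral_multc) auto
  also have "(\<integral>\<^sup>+s. emeasure (P x) {\<omega>\<in>space (P x). (\<forall>i\<le>m. X i \<omega> = s i) \<and> True} \<partial>count_space I) =
    emeasure (P x) {\<omega>\<in>space (P x). X j \<omega> = z \<and> X m \<omega> = y \<and> True}"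
    unfolding un[of "\<lambda>_. True"] by (rule emeasure_UN_countable[symmetric]) (auto intro!: I disj[of "\<lambda>_. True", simplified])
  finally show ?thesis
    by simp
qed

text \<open>Markov property over \<open>n\<close> steps: splitting by the state at time
  \<open>j + n\<close> reproduces the recursion of \<open>gw\<close>.\<close>

lemma emeasure_gw_joint:
  "emeasure (P x) {\<omega>\<in>space (P x). X j \<omega> = z \<and> X (j + n) \<omega> = w} =
   emeasure (P x) {\<omega>\<in>space (P x). X j \<omega> = z} * pmf (gw p n z) w"
proof (induction n arbitrary: w)
  case 0
  have "{\<omega>\<in>space (P x). X j \<omega> = z \<and> X (j + 0) \<omega> = w} = (if z = w then {\<omega>\<in>space (P x). X j \<omega> = z} else {})"
    by auto
  then show ?case
    by (simp add: pmf_return)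
next
  case (Suc n)
  have "emeasure (P x) {\<omega>\<in>space (P x). X j \<omega> = z \<and> X (j + Suc n) \<omega> = w} =
    emeasure (P x) (\<Union>y. {\<omega>\<in>space (P x). X j \<omega> = z \<and> X (j + n) \<omega> = y \<and> X (Suc (j + n)) \<omega> = w})"
    by (intro arg_cong[where f = "emeasure (P x)"]) auto
  also have "\<dots> = (\<integral>\<^sup>+y. emeasure (P x) {\<omega>\<in>space (P x). X j \<omega> = z \<and> X (j + n) \<omega> = y \<and> X (Suc (j + n)) \<omega> = w} \<partial>count_space UNIV)"
    by (rule emeasure_UN_countable) (auto simp: disjoint_family_on_def)
  also have "\<dots> = (\<integral>\<^sup>+y. emeasure (P x) {\<omega>\<in>space (P x). X j \<omega> = z} * (ennreal (pmf (gw p n z) y) * pmf (next_generation p y) w) \<partial>count_space UNIV)"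
    by (simp add: emeasure_gw_step Suc mult.assoc)
  also have "\<dots> = emeasure (P x) {\<omega>\<in>space (P x). X j \<omega> = z} * (\<integral>\<^sup>+y. ennreal (pmf (gw p n z) y) * pmf (next_generation p y) w \<partial>count_space UNIV)"
    by (rule nn_integral_cmult) auto
  also have "(\<integral>\<^sup>+y. ennreal (pmf (gw p n z) y) * pmf (next_generation p y) w \<partial>count_space UNIV) = pmf (gw p (Suc n) z) w"
    by (simp add: ennreal_pmf_bind nn_integral_measure_pmf)
  finally show ?case .
qed

lemma prob_gw_joint:
  "measure (P x) {\<omega>\<in>space (P x). X j \<omega> = z \<and> X (j + n) \<omega> = w} =
   measure (P x) {\<omega>\<in>space (P x). X j \<omega> = z} * pmf (gw p n z) w"
proof -
  interpret prob_space "P x" by (rule gw_prob_space)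
  show ?thesis
    using emeasure_gw_joint[of x j z n w] by (simp add: emeasure_eq_measure flip: ennreal_mult)
qed

lemma prob_gw: "measure (P x) {\<omega>\<in>space (P x). X k \<omega> = z} = pmf (gw p k x) z"
proof -
  interpret prob_space "P x" by (rule gw_prob_space)
  have "measure (P x) {\<omega>\<in>space (P x). X k \<omega> = z} = measure (P x) {\<omega>\<in>space (P x). X 0 \<omega> = x \<and> X (0 + k) \<omega> = z}"
    using gw_initial[of x] by (intro finite_measure_eq_AE) auto
  also have "\<dots> = measure (P x) {\<omega>\<in>space (P x). X 0 \<omega> = x} * pmf (gw p k x) z"
    by (rule prob_gw_joint)
  also have "measure (P x) {\<omega>\<in>space (P x). X 0 \<omega> = x} = 1"
    using gw_initial[of x] by (subst prob_Collect_eq_1) auto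
  finally show ?thesis
    by simp
qed

lemma distr_gw: "distr (P x) (count_space UNIV) (X k) = measure_pmf (gw p k x)"
proof (rule measure_eqI_countable[where A = UNIV])
  interpret prob_space "P x" by (rule gw_prob_space)
  fix z
  have "emeasure (distr (P x) (count_space UNIV) (X k)) {z} = emeasure (P x) {\<omega>\<in>space (P x). X k \<omega> = z}"
    by (subst emeasure_distr) (auto intro!: arg_cong[where f = "emeasure (P x)"])
  then show "emeasure (distr (P x) (count_space UNIV) (X k)) {z} = emeasure (measure_pmf (gw p k x)) {z}"
    by (simp add: emeasure_eq_measure prob_gw emeasure_pmf_single)
qed auto

lemma integral_gw_one: "(\<integral>\<omega>. f (X 1 \<omega>) \<partial>P (axis i 1)) = measure_pmf.expectation (p i) f"
  for f :: "_ \<Rightarrow> real"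
proof -
  have "(\<integral>\<omega>. f (X 1 \<omega>) \<partial>P (axis i 1)) = (\<integral>y. f y \<partial>distr (P (axis i 1)) (count_space UNIV) (X 1))"
    by (subst integral_distr) auto
  then show ?thesis
    by (simp only: distr_gw gw_one next_generation_axis)
qed

lemma integrable_gw_one: "integrable (P (axis i 1)) (\<lambda>\<omega>. f (X 1 \<omega>)) \<longleftrightarrow> integrable (p i) f"
  for f :: "_ \<Rightarrow> real"
proof -
  have "integrable (P (axis i 1)) (\<lambda>\<omega>. f (X 1 \<omega>)) \<longleftrightarrow>
    integrable (distr (P (axis i 1)) (count_space UNIV) (X 1)) f"
    by (subst integrable_distr_eq) auto
  then show ?thesis
    by (simp only: distr_gw gw_one next_generation_axis)
qed

lemma mean_matrix_gw: "mean_matrix P X $ i $ j = measure_pmf.expectation (p i) (\<lambda>k. real (k $ j))"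
  unfolding mean_matrix_def vec_lambda_beta by (rule integral_gw_one[where f = "\<lambda>k. real (k $ j)"])

lemma finite_means_gw: "finite_means P X \<longleftrightarrow> (\<forall>i j. integrable (p i) (\<lambda>k. real (k $ j)))"
  unfolding finite_means_def using integrable_gw_one[where f = "\<lambda>k. real (k $ _)"] by simp

text \<open>An empty population stays empty under \<open>gw\<close>, so the event
  \<open>X k = 0\<close> loses no probability when \<open>X (k + n) = 0\<close> is added. The
  exceptional sets are countably many, which permits one null set for all times.\<close>

lemma gw_absorbing: "AE \<omega> in P x. \<forall>k n. X k \<omega> = 0 \<longrightarrow> X (k + n) \<omega> = 0"
proof -
  interpret prob_space "P x" by (rule gw_prob_space)
  have "AE \<omega> in P x. X k \<omega> = 0 \<longrightarrow> X (k + n) \<omega> = 0" for k n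
  proof -
    have "prob {\<omega>\<in>space (P x). X k \<omega> = 0} = prob {\<omega>\<in>space (P x). X k \<omega> = 0 \<and> X (k + n) \<omega> = 0}"
      by (simp add: prob_gw_joint)
    also have "prob {\<omega>\<in>space (P x). X k \<omega> = 0} - \<dots> =
      prob ({\<omega>\<in>space (P x). X k \<omega> = 0} - {\<omega>\<in>space (P x). X k \<omega> = 0 \<and> X (k + n) \<omega> = 0})"
      by (rule finite_measure_Diff[symmetric]) auto
    finally have "prob {\<omega>\<in>space (P x). \<not> (X k \<omega> = 0 \<longrightarrow> X (k + n) \<omega> = 0)} = 0"
      by (auto simp: set_diff_eq intro!: arg_cong[where f = prob] elim!: back_subst[where P = "\<lambda>S. prob S = 0"])
    then show ?thesis
      by (subst AE_iff_measurable[OF _ refl]) (auto simp: emeasure_eq_measure)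
  qed
  then show ?thesis
    unfolding AE_all_countable by blast
qed

lemma extinction_time_finite_iff: "extinction_time X \<omega> < \<infinity> \<longleftrightarrow> (\<exists>k. X k \<omega> = 0)"
  unfolding extinction_time_def INF_less_iff by simp

text \<open>By absorption, extinction by time \<open>k + m\<close> is almost surely the event
  \<open>X (k + m) = 0\<close>. These events increase to extinction in \<open>m\<close>, and jointly
  with \<open>X k = z\<close> their probabilities factorise by the Markov property.\<close>

lemma prob_gw_extinction:
  "(\<lambda>m. pmf (gw p k x) z * pmf (gw p m z) 0) \<longlonglongrightarrow>
     measure (P x) {\<omega>\<in>space (P x). X k \<omega> = z \<and> extinction_time X \<omega> < \<infinity>}"
proof -
  interpret prob_space "P x" by (rule gw_prob_space)
  define A where "A m = {\<omega>\<in>space (P x). X k \<omega> = z \<and> (\<exists>i\<le>m. X i \<omega> = 0)}" for m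
  have "(\<lambda>m. prob (A m)) \<longlonglongrightarrow> prob (\<Union>m. A m)"
    by (rule finite_Lim_measure_incseq) (auto simp: A_def incseq_def intro: order_trans)
  then have lim: "(\<lambda>m. prob (A (k + m))) \<longlonglongrightarrow> prob (\<Union>m. A m)"
    using LIMSEQ_ignore_initial_segment[of _ _ k] by (simp add: add.commute)
  have "prob (A (k + m)) = prob {\<omega>\<in>space (P x). X k \<omega> = z \<and> X (k + m) \<omega> = 0}" for m
  proof (rule finite_measure_eq_AE)
    show "AE \<omega> in P x. \<omega> \<in> A (k + m) \<longleftrightarrow> \<omega> \<in> {\<omega>\<in>space (P x). X k \<omega> = z \<and> X (k + m) \<omega> = 0}"
      using gw_absorbing[of x]
    proof eventually_elim
      case (elim \<omega>)
      then have "X (k + m) \<omega> = 0" if "i \<le> k + m" "X i \<omega> = 0" for i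
        using that by (metis le_add_diff_inverse)
      then show ?case
        by (auto simp: A_def)
    qed
  qed (auto simp: A_def)
  moreover have "(\<Union>m. A m) = {\<omega>\<in>space (P x). X k \<omega> = z \<and> extinction_time X \<omega> < \<infinity>}"
    unfolding extinction_time_finite_iff by (auto simp: A_def)
  ultimately show ?thesis
    using lim by (simp add: prob_gw_joint prob_gw)
qed

lemma gen_fun_iterate_tendsto: "(\<lambda>m. (gen_fun p ^^ m) 0 $ i) \<longlonglongrightarrow> extinction_prob P X $ i"
proof -
  interpret prob_space "P (axis i 1)" by (rule gw_prob_space)
  have "(\<lambda>m. pmf (gw p 0 (axis i 1)) (axis i 1) * pmf (gw p m (axis i 1)) 0) \<longlonglongrightarrow>
    prob {\<omega>\<in>space (P (axis i 1)). X 0 \<omega> = axis i 1 \<and> extinction_time X \<omega> < \<infinity>}"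
    by (rule prob_gw_extinction)
  also have "prob {\<omega>\<in>space (P (axis i 1)). X 0 \<omega> = axis i 1 \<and> extinction_time X \<omega> < \<infinity>} =
    prob {\<omega>\<in>space (P (axis i 1)). extinction_time X \<omega> < \<infinity>}"
    using gw_initial[of "axis i 1"] unfolding extinction_time_finite_iff by (intro finite_measure_eq_AE) auto
  finally show ?thesis
    by (simp add: pmf_gw_0 extinction_prob_def)
qed

lemma pmf_gw_0_tendsto: "(\<lambda>m. pmf (gw p m z) 0) \<longlonglongrightarrow> vec_power (extinction_prob P X) z"
  unfolding pmf_gw_0 vec_power_def by (intro tendsto_prod tendsto_power gen_fun_iterate_tendsto)

text \<open>Being empty at time \<open>k + n\<close> is part of extinction, so the probability is a
  difference of two. Given \<open>X k = z\<close>, extinction has probability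
  \<open>vec_power (extinction_prob P X) z\<close>, one factor for each individual.\<close>

lemma prob_gw_survival:
  "measure (P x) {\<omega>\<in>space (P x). X k \<omega> = z \<and> X (k + n) \<omega> \<noteq> 0 \<and> extinction_time X \<omega> < \<infinity>} =
   pmf (gw p k x) z * (vec_power (extinction_prob P X) z - pmf (gw p n z) 0)"
proof -
  interpret prob_space "P x" by (rule gw_prob_space)
  have "{\<omega>\<in>space (P x). X k \<omega> = z \<and> X (k + n) \<omega> \<noteq> 0 \<and> extinction_time X \<omega> < \<infinity>} =
    {\<omega>\<in>space (P x). X k \<omega> = z \<and> extinction_time X \<omega> < \<infinity>} - {\<omega>\<in>space (P x). X k \<omega> = z \<and> X (k + n) \<omega> = 0}"
    by auto
  also have "prob \<dots> = prob {\<omega>\<in>space (P x). X k \<omega> = z \<and> extinction_time X \<omega> < \<infinity>} -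
    prob {\<omega>\<in>space (P x). X k \<omega> = z \<and> X (k + n) \<omega> = 0}"
    unfolding extinction_time_finite_iff by (rule finite_measure_Diff) auto
  also have "prob {\<omega>\<in>space (P x). X k \<omega> = z \<and> extinction_time X \<omega> < \<infinity>} =
    pmf (gw p k x) z * vec_power (extinction_prob P X) z"
    by (rule LIMSEQ_unique[OF prob_gw_extinction]) (intro tendsto_mult tendsto_const pmf_gw_0_tendsto)
  finally show ?thesis
    by (simp add: prob_gw_joint prob_gw algebra_simps)
qed

lemma cond_prob_gw_survival:
  "\<P>(\<omega> in P x. X k \<omega> = z \<bar> X (k + n) \<omega> \<noteq> 0 \<and> extinction_time X \<omega> < \<infinity>) =
   pmf (gw p k x) z * (vec_power (extinction_prob P X) z - pmf (gw p n z) 0) /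
     (vec_power (extinction_prob P X) x - pmf (gw p (k + n) x) 0)"
proof -
  interpret prob_space "P x" by (rule gw_prob_space)
  \<comment> \<open>The denominator is the same joint formula at time 0 with state \<open>x\<close>,
    which is almost sure, and with horizon \<open>k + n\<close>.\<close>
  have "prob {\<omega>\<in>space (P x). X (k + n) \<omega> \<noteq> 0 \<and> extinction_time X \<omega> < \<infinity>} =
    prob {\<omega>\<in>space (P x). X 0 \<omega> = x \<and> X (0 + (k + n)) \<omega> \<noteq> 0 \<and> extinction_time X \<omega> < \<infinity>}"
    using gw_initial[of x] unfolding extinction_time_finite_iff by (intro finite_measure_eq_AE) auto
  then show ?thesis
    unfolding cond_prob_def prob_gw_survival by simp
qed

lemma cond_prob_gw_alive:
  assumes "z \<noteq> 0"
  shows "\<P>(\<omega> in P x. X k \<omega> = z \<bar> X k \<omega> \<noteq> 0) = pmf (gw p k x) z / (1 - pmf (gw p k x) 0)"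
proof -
  interpret prob_space "P x" by (rule gw_prob_space)
  have "prob {\<omega>\<in>space (P x). X k \<omega> \<noteq> 0} = 1 - prob {\<omega>\<in>space (P x). X k \<omega> = 0}"
    by (rule prob_neg) auto
  moreover have "{\<omega>\<in>space (P x). X k \<omega> = z \<and> X k \<omega> \<noteq> 0} = {\<omega>\<in>space (P x). X k \<omega> = z}"
    using assms by auto
  ultimately show ?thesis
    by (simp add: cond_prob_def prob_gw)
qed

lemma extinction_prob_in_cube: "extinction_prob P X \<in> {0..1}"
  unfolding cube_iff using prob_space.prob_le_1[OF gw_prob_space] by (auto simp: extinction_prob_def)

text \<open>Pass to the limit in the iteration of \<open>gen_fun p\<close> from 0; all iterates lie
  in the cube, so the constant 1 dominates the integrands.\<close>

lemma gen_fun_extinction_prob: "gen_fun p (extinction_prob P X) = extinction_prob P X"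
proof (subst vec_eq_iff, rule allI)
  fix i
  let ?r = "\<lambda>m. (gen_fun p ^^ m) 0"
  have r: "?r m \<in> {0..1}" for m
    by (rule gen_fun_iterate_in_cube[OF zero_in_cube])
  have "(\<lambda>m. pgf (p i) (?r m)) \<longlonglongrightarrow> pgf (p i) (extinction_prob P X)"
    unfolding pgf_def
  proof (rule integral_dominated_convergence[where w = "\<lambda>_. 1"])
    show "AE k in p i. (\<lambda>m. vec_power (?r m) k) \<longlonglongrightarrow> vec_power (extinction_prob P X) k"
      unfolding vec_power_def by (intro AE_I2 tendsto_prod tendsto_power gen_fun_iterate_tendsto)
    show "AE k in p i. norm (vec_power (?r m) k) \<le> 1" for m
      using abs_vec_power_cube[OF r] by simp
  qed auto
  moreover have "(\<lambda>m. pgf (p i) (?r m)) \<longlonglongrightarrow> extinction_prob P X $ i"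
    using LIMSEQ_Suc[OF gen_fun_iterate_tendsto[of i]] by (simp add: gen_fun_eq_pgf[OF r])
  ultimately show "gen_fun p (extinction_prob P X) $ i = extinction_prob P X $ i"
    by (simp add: gen_fun_eq_pgf[OF extinction_prob_in_cube] LIMSEQ_unique)
qed

end

section \<open>Perron-Frobenius theory\<close>

definition mat_pow :: "real ^ 'd ^ 'd::finite \<Rightarrow> nat \<Rightarrow> real ^ 'd ^ 'd" where
  "mat_pow M n = ((\<lambda>A. M ** A) ^^ n) (mat 1)"

lemma mat_pow_0 [simp]: "mat_pow M 0 = mat 1"
  and mat_pow_Suc: "mat_pow M (Suc n) = M ** mat_pow M n"
  by (simp_all add: mat_pow_def)

lemma mat_pow_vec_Suc: "mat_pow M (Suc n) *v x = M *v (mat_pow M n *v x)"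
  by (simp add: mat_pow_Suc matrix_vector_mul_assoc)

lemma mat_vec_nth: "(M *v x) $ i = (\<Sum>j\<in>UNIV. M $ i $ j * x $ j)"
  by (simp add: matrix_vector_mult_def)

lemma mat_vec_nonneg:
  fixes M :: "real ^ 'd ^ 'e"
  assumes "\<And>i j. 0 \<le> M $ i $ j" "\<And>i. 0 \<le> x $ i"
  shows "0 \<le> (M *v x) $ i"
  by (simp add: mat_vec_nth assms sum_nonneg)

lemma mat_vec_mono:
  fixes M :: "real ^ 'd ^ 'e"
  assumes "\<And>i j. 0 \<le> M $ i $ j" "\<And>i. x $ i \<le> y $ i"
  shows "(M *v x) $ i \<le> (M *v y) $ i"
  unfolding mat_vec_nth by (intro sum_mono mult_left_mono assms)

lemma mat_pow_nonneg:
  assumes "\<And>i j. 0 \<le> M $ i $ j"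
  shows "0 \<le> mat_pow M n $ i $ j"
proof (induction n arbitrary: i j)
  case 0
  then show ?case
    by (simp add: mat_def)
next
  case (Suc n)
  then show ?case
    by (simp add: mat_pow_Suc matrix_matrix_mult_def assms sum_nonneg)
qed

lemma mat_pow_eigenvector: "M *v u = \<rho> *s u \<Longrightarrow> mat_pow M n *v u = \<rho> ^ n *s u"
  by (induction n) (simp_all add: mat_pow_vec_Suc matrix_vector_mult_scaleR scalar_mult_eq_scaleR)

lemma positive_regular_iff: "positive_regular M \<longleftrightarrow> (\<exists>N\<ge>1. \<forall>i j. 0 < mat_pow M N $ i $ j)"
  by (simp add: positive_regular_def mat_pow_def)

lemma positive_mat_vec_pos:
  fixes A :: "real ^ 'd ^ 'e"
  assumes "\<And>i j. 0 < A $ i $ j" "\<And>j. 0 \<le> x $ j" "x \<noteq> 0"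
  shows "0 < (A *v x) $ i"
proof -
  obtain j where "x $ j \<noteq> 0"
    using assms(3) by (auto simp: vec_eq_iff)
  then have "0 < A $ i $ j * x $ j"
    using assms by (simp add: less_le)
  also have "\<dots> \<le> (A *v x) $ i"
    unfolding mat_vec_nth by (rule member_le_sum) (use assms in \<open>auto intro: less_imp_le mult_nonneg_nonneg\<close>)
  finally show ?thesis .
qed

text \<open>Whether an entry of a power is positive is decided by chains of positive entries, and
  such chains survive in \<open>M'\<close>. This transfers positive regularity to the associated
  mean matrix.\<close>

lemma positive_regular_mono:
  assumes "positive_regular M" "\<And>i j. 0 \<le> M $ i $ j" "\<And>i j. 0 \<le> M' $ i $ j"
    and pos: "\<And>i j. 0 < M $ i $ j \<Longrightarrow> 0 < M' $ i $ j"
  shows "positive_regular M'"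
proof -
  obtain N where N: "N \<ge> 1" "\<And>i j. 0 < mat_pow M N $ i $ j"
    using assms(1) unfolding positive_regular_iff by blast
  have "0 < mat_pow M n $ i $ j \<Longrightarrow> 0 < mat_pow M' n $ i $ j" for n i j
  proof (induction n arbitrary: i j)
    case 0
    then show ?case by (simp add: mat_def)
  next
    case (Suc n)
    then have "0 < (\<Sum>k\<in>UNIV. M $ i $ k * mat_pow M n $ k $ j)"
      by (simp add: mat_pow_Suc matrix_matrix_mult_def)
    then obtain k where "0 < M $ i $ k * mat_pow M n $ k $ j"
      by (meson not_less sum_nonpos)
    then have "0 < M $ i $ k" "0 < mat_pow M n $ k $ j"
      using assms(2)[of i k] mat_pow_nonneg[of M n k j] assms(2) by (auto simp: zero_less_mult_iff)
    then have "0 < M' $ i $ k * mat_pow M' n $ k $ j"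
      using pos Suc.IH by simp
    also have "\<dots> \<le> (\<Sum>k\<in>UNIV. M' $ i $ k * mat_pow M' n $ k $ j)"
      by (rule member_le_sum) (auto intro!: mult_nonneg_nonneg assms mat_pow_nonneg)
    finally show ?case
      by (simp add: mat_pow_Suc matrix_matrix_mult_def)
  qed
  then show ?thesis
    using N unfolding positive_regular_iff by blast
qed

text \<open>At the index of the largest ratio, the multiple of \<open>u\<close> with this ratio as
  factor dominates \<open>w\<close> and touches it. The comparison arguments for eigenvectors rest
  on this contact point.\<close>

lemma ex_max_ratio:
  fixes w u :: "'d::finite \<Rightarrow> real"
  assumes "\<And>i. 0 < u i"
  obtains i where "\<And>j. w j \<le> w i / u i * u j"
proof -
  have "Max (range (\<lambda>j. w j / u j)) \<in> range (\<lambda>j. w j / u j)"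
    by (rule Max_in) auto
  then obtain i where "Max (range (\<lambda>j. w j / u j)) = w i / u i"
    by blast
  then have i: "w j / u j \<le> w i / u i" for j
    using Max_ge[of "range (\<lambda>j. w j / u j)" "w j / u j"] by simp
  have "w j \<le> w i / u i * u j" for j
    using i[of j] assms[of j] by (simp add: pos_divide_le_eq)
  then show thesis ..
qed

text \<open>Brouwer's fixed point theorem for the map \<open>f\<close> on the simplex
  \<open>S\<close>, which applies \<open>M\<close> and rescales the coordinate sum to 1. The
  rescaling factor at the fixed point is the eigenvalue.\<close>

lemma perron_frobenius_exists:
  fixes M :: "real ^ 'd ^ 'd::finite"
  assumes reg: "positive_regular M" and nonneg: "\<And>i j. 0 \<le> M $ i $ j"
  obtains u \<rho> where "0 < \<rho>" "\<And>i. 0 < u $ i" "M *v u = \<rho> *s u" "(\<Sum>i\<in>UNIV. u $ i) = 1"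
proof -
  obtain N where N: "N \<ge> 1" "\<And>i j. 0 < mat_pow M N $ i $ j"
    using reg unfolding positive_regular_iff by blast
  define S where "S = {x :: real ^ 'd. (\<forall>i. 0 \<le> x $ i) \<and> (\<Sum>i\<in>UNIV. x $ i) = 1}"
  \<comment> \<open>If \<open>M\<close> killed \<open>x\<close>, so would
    \<open>mat_pow M N\<close>, which has positive entries. Hence the rescaling in \<open>f\<close>
    never divides by 0.\<close>
  have Mx0: "M *v x \<noteq> 0" if "x \<in> S" for x
  proof
    assume *: "M *v x = 0"
    obtain n where n: "N = Suc n"
      using N(1) by (cases N) auto
    have "mat_pow M (Suc m) *v x = 0" for m
      by (induction m) (simp_all add: mat_pow_vec_Suc *)
    then have "mat_pow M N *v x = 0"
      by (simp add: n)
    moreover have "x \<noteq> 0"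
      using that by (auto simp: S_def)
    ultimately show False
      using positive_mat_vec_pos[of "mat_pow M N" x undefined, OF N(2)] that by (simp add: S_def)
  qed
  have sum_pos: "0 < (\<Sum>i\<in>UNIV. (M *v x) $ i)" if x: "x \<in> S" for x
  proof -
    have "0 \<le> (M *v x) $ i" for i
      using x by (intro mat_vec_nonneg nonneg) (auto simp: S_def)
    moreover have "(\<Sum>i\<in>UNIV. (M *v x) $ i) \<noteq> 0"
      using Mx0[OF x] calculation by (subst sum_nonneg_eq_0_iff) (auto simp: vec_eq_iff)
    ultimately show ?thesis
      by (simp add: less_le sum_nonneg)
  qed
  define f where "f = (\<lambda>x. (1 / (\<Sum>i\<in>UNIV. (M *v x) $ i)) *\<^sub>R (M *v x))"
  have "compact S"
  proof -
    have "closed S"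
      unfolding S_def by (intro closed_Collect_conj closed_Collect_all closed_Collect_le closed_Collect_eq continuous_intros)
    moreover have "bounded S"
      unfolding bounded_iff
    proof (intro exI[of _ 1] ballI)
      fix x assume x: "x \<in> S"
      have "norm x \<le> (\<Sum>i\<in>UNIV. \<bar>x $ i\<bar>)"
        by (rule norm_le_l1_cart)
      also have "\<dots> = 1"
        using x by (simp add: S_def)
      finally show "norm x \<le> 1" .
    qed
    ultimately show ?thesis
      by (simp add: compact_eq_bounded_closed)
  qed
  moreover have "convex S"
    unfolding convex_def S_def by (auto simp: sum.distrib simp flip: sum_distrib_left)
  moreover have "(\<chi> i. 1 / real CARD('d)) \<in> S"
    by (simp add: S_def)
  then have "S \<noteq> {}"
    by blast
  moreover have "continuous_on S f"
    unfolding f_def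
    by (intro continuous_intros linear_continuous_on matrix_vector_mul_bounded_linear)
       (use sum_pos in force)
  moreover have "f \<in> S \<rightarrow> S"
  proof
    fix x assume x: "x \<in> S"
    have "0 \<le> (M *v x) $ i" for i
      using x by (intro mat_vec_nonneg nonneg) (auto simp: S_def)
    then show "f x \<in> S"
      using sum_pos[OF x] by (auto simp: f_def S_def simp flip: sum_divide_distrib)
  qed
  ultimately obtain x where x: "x \<in> S" "f x = x"
    by (rule brouwer)
  define \<rho> where "\<rho> = (\<Sum>i\<in>UNIV. (M *v x) $ i)"
  have \<rho>: "0 < \<rho>"
    using sum_pos[OF x(1)] by (simp add: \<rho>_def)
  have eig: "M *v x = \<rho> *s x"
  proof -
    have "\<rho> *\<^sub>R f x = M *v x"
      using \<rho> by (simp add: f_def \<rho>_def)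
    then show ?thesis
      using x by (simp add: scalar_mult_eq_scaleR)
  qed
  \<comment> \<open>The positive matrix \<open>mat_pow M N\<close> maps \<open>x\<close> to a vector
    with positive entries, and this vector is \<rho>^N times \<open>x\<close>.\<close>
  have "0 < x $ i" for i
  proof -
    have "0 < (mat_pow M N *v x) $ i"
      using x by (intro positive_mat_vec_pos N) (auto simp: S_def)
    then show ?thesis
      using \<rho> by (simp add: mat_pow_eigenvector[OF eig] zero_less_mult_iff)
  qed
  then show thesis
    using that[of \<rho> x] \<rho> eig x by (simp add: S_def)
qed

text \<open>For a complex eigenvector \<open>w\<close>, the row at which the ratio of the modulus of
  \<open>w\<close> to \<open>u\<close> is largest bounds the modulus of the eigenvalue by \<rho>.
  The vector \<open>u\<close> shows that the bound is attained.\<close>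

lemma perron_root_eqI:
  fixes M :: "real ^ 'd ^ 'd::finite"
  assumes nonneg: "\<And>i j. 0 \<le> M $ i $ j" and u: "\<And>i. 0 < u $ i" and eig: "M *v u = \<rho> *s u"
  shows "perron_root M = \<rho>"
proof -
  have eig': "(\<Sum>j\<in>UNIV. M $ i $ j * u $ j) = \<rho> * u $ i" for i
    using arg_cong[OF eig, of "\<lambda>v. v $ i"] by (simp add: mat_vec_nth)
  have \<rho>: "0 \<le> \<rho>"
  proof -
    have "0 \<le> \<rho> * u $ i" for i
      unfolding eig'[symmetric] by (intro sum_nonneg mult_nonneg_nonneg nonneg less_imp_le u)
    then show ?thesis
      using u by (meson not_less mult_neg_pos)
  qed
  have bound: "cmod c \<le> \<rho>" if ev: "complex_eigenvalue M c" for c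
  proof -
    obtain w :: "complex ^ 'd" where w: "w \<noteq> 0" "(\<chi> i j. complex_of_real (M $ i $ j)) *v w = c *s w"
      using ev by (auto simp: complex_eigenvalue_def)
    obtain i where i: "\<And>j. cmod (w $ j) \<le> cmod (w $ i) / u $ i * u $ j"
      using ex_max_ratio[of "\<lambda>j. u $ j" "\<lambda>j. cmod (w $ j)"] u by blast
    have wi: "0 < cmod (w $ i)"
    proof (rule ccontr)
      assume "\<not> 0 < cmod (w $ i)"
      then have "w $ j = 0" for j
        using i[of j] by simp
      then show False
        using w(1) by (simp add: vec_eq_iff)
    qed
    have "cmod c * cmod (w $ i) = cmod (\<Sum>j\<in>UNIV. complex_of_real (M $ i $ j) * w $ j)"
      using arg_cong[OF w(2), of "\<lambda>v. v $ i"] by (simp add: matrix_vector_mult_def norm_mult)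
    also have "\<dots> \<le> (\<Sum>j\<in>UNIV. M $ i $ j * cmod (w $ j))"
      by (rule sum_norm_le) (simp add: norm_mult nonneg)
    also have "\<dots> \<le> (\<Sum>j\<in>UNIV. M $ i $ j * (cmod (w $ i) / u $ i * u $ j))"
      by (intro sum_mono mult_left_mono nonneg i)
    also have "\<dots> = cmod (w $ i) / u $ i * (\<Sum>j\<in>UNIV. M $ i $ j * u $ j)"
      by (simp add: sum_distrib_left mult_ac)
    also have "\<dots> = \<rho> * cmod (w $ i)"
      using u[of i] by (simp add: eig')
    finally show ?thesis
      using wi by simp
  qed
  have "complex_eigenvalue M (complex_of_real \<rho>)"
    unfolding complex_eigenvalue_def
  proof (intro exI[of _ "\<chi> i. complex_of_real (u $ i)"] conjI)
    show "(\<chi> i. complex_of_real (u $ i)) \<noteq> 0"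
      using u by (metis less_irrefl of_real_eq_0_iff vec_lambda_beta zero_index)
    show "(\<chi> i j. complex_of_real (M $ i $ j)) *v (\<chi> i. complex_of_real (u $ i)) =
      complex_of_real \<rho> *s (\<chi> i. complex_of_real (u $ i))"
      using eig' by (simp add: vec_eq_iff matrix_vector_mult_def flip: of_real_mult of_real_sum)
  qed
  then have "\<rho> \<in> cmod ` {c. complex_eigenvalue M c}"
    using \<rho> by (intro image_eqI[of _ _ "complex_of_real \<rho>"]) auto
  then show ?thesis
    unfolding perron_root_def using bound by (intro cSup_eq_maximum) auto
qed

text \<open>For a competitor \<open>w\<close>, the smallest multiple of \<open>u\<close> above
  \<open>w\<close> leaves a nonnegative difference \<open>v\<close> with a zero entry. A positive
  power of \<open>M\<close> would make that entry positive unless \<open>v = 0\<close>, and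
  normalisation fixes the multiple.\<close>

lemma perron_right_eigenvector_eqI:
  fixes M :: "real ^ 'd ^ 'd::finite"
  assumes reg: "positive_regular M" and nonneg: "\<And>i j. 0 \<le> M $ i $ j"
    and u: "\<And>i. 0 < u $ i" and eig: "M *v u = \<rho> *s u" and sum: "(\<Sum>i\<in>UNIV. u $ i) = 1"
  shows "perron_right_eigenvector M = u"
  unfolding perron_right_eigenvector_def perron_root_eqI[OF nonneg u eig]
proof (rule the_equality)
  fix w assume w: "(\<forall>i. 0 < w $ i) \<and> M *v w = \<rho> *s w \<and> (\<Sum>i\<in>UNIV. w $ i) = 1"
  obtain i where i: "\<And>j. w $ j \<le> w $ i / u $ i * u $ j"
    using ex_max_ratio[of "\<lambda>j. u $ j" "\<lambda>j. w $ j"] u by blast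
  define t where "t = w $ i / u $ i"
  define v where "v = t *s u - w"
  obtain N where N: "N \<ge> 1" "\<And>i j. 0 < mat_pow M N $ i $ j"
    using reg unfolding positive_regular_iff by blast
  have "M *v v = \<rho> *s v"
    using eig w by (simp add: v_def matrix_vector_mult_diff_distrib matrix_vector_mult_scaleR
        scalar_mult_eq_scaleR algebra_simps)
  from mat_pow_eigenvector[OF this, of N] have "(mat_pow M N *v v) $ i = \<rho> ^ N * v $ i"
    by simp
  also have "v $ i = 0"
    using u[of i] by (simp add: v_def t_def)
  finally have "v = 0"
    using positive_mat_vec_pos[of "mat_pow M N" v i, OF N(2)] i by (auto simp: v_def t_def)
  then have wt: "w $ j = t * u $ j" for j
    by (simp add: v_def vec_eq_iff)
  then have "t = 1"
    using w sum by (simp flip: sum_distrib_left)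
  then show "w = u"
    using wt by (simp add: vec_eq_iff)
qed (use u eig sum in auto)

text \<open>A primitive matrix contracts the spread of the ratios \<open>b $ i / u $ i\<close>.\<close>

lemma perturbed_perron_iteration_converges:
  fixes M :: "real ^ 'd ^ 'd::finite"
  assumes reg: "positive_regular M" and nonneg: "\<And>i j. 0 \<le> M $ i $ j"
    and u: "\<And>i. 0 < u $ i" and eig: "M *v u = \<rho> *s u" and \<rho>: "0 < \<rho>"
    and step: "\<And>n i. \<bar>b (Suc n) $ i - (M *v b n) $ i / \<rho>\<bar> \<le> C * \<theta> ^ n * u $ i"
    and \<theta>: "0 \<le> \<theta>" "\<theta> < 1"
    and bounded: "\<And>n i. \<bar>b n $ i\<bar> \<le> K * u $ i"
  shows "\<exists>L. \<forall>i. (\<lambda>n. b n $ i) \<longlonglongrightarrow> L * u $ i"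
proof -
  obtain N where N: "N \<ge> 1" "\<And>i j. 0 < mat_pow M N $ i $ j"
    using reg unfolding positive_regular_iff by blast
  have C: "0 \<le> C"
  proof -
    have "0 \<le> C * \<theta> ^ 0 * u $ undefined"
      using order_trans[OF abs_ge_zero step] by blast
    then show ?thesis
      using u[of undefined] by (simp add: zero_le_mult_iff)
  qed
  have eigk: "(\<Sum>j\<in>UNIV. mat_pow M k $ i $ j * u $ j) = \<rho> ^ k * u $ i" for k i
    using arg_cong[OF mat_pow_eigenvector[OF eig, of k], of "\<lambda>v. v $ i"] by (simp add: mat_vec_nth)
  \<comment> \<open>Each of the \<open>k\<close> defects after time \<open>n\<close> is at most
    \<open>C * \<theta> ^ n * u $ i\<close>, and applying \<open>M\<close> and dividing by \<rho>
    preserves such bounds because \<open>u\<close> is an eigenvector; so the defects simply add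
    up.\<close>
  have k_step: "\<bar>b (n + k) $ i - (mat_pow M k *v b n) $ i / \<rho> ^ k\<bar> \<le> real k * C * \<theta> ^ n * u $ i" for n k i
  proof (induction k arbitrary: i)
    case 0
    show ?case by simp
  next
    case (Suc k)
    define e where "e = b (n + k) - (1 / \<rho> ^ k) *s (mat_pow M k *v b n)"
    have e: "\<bar>e $ j\<bar> \<le> real k * C * \<theta> ^ n * u $ j" for j
      using Suc[of j] by (simp add: e_def)
    have "(M *v e) $ i = (M *v b (n + k)) $ i - (mat_pow M (Suc k) *v b n) $ i / \<rho> ^ k"
      by (simp add: e_def mat_pow_vec_Suc matrix_vector_mult_diff_distrib matrix_vector_mult_scaleR scalar_mult_eq_scaleR)
    then have eq: "b (n + Suc k) $ i - (mat_pow M (Suc k) *v b n) $ i / \<rho> ^ Suc k =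
      (b (Suc (n + k)) $ i - (M *v b (n + k)) $ i / \<rho>) + (M *v e) $ i / \<rho>"
      by (simp add: diff_divide_distrib mult.commute)
    have "\<bar>(M *v e) $ i\<bar> \<le> (\<Sum>j\<in>UNIV. M $ i $ j * (real k * C * \<theta> ^ n * u $ j))"
      unfolding mat_vec_nth
      by (rule order_trans[OF sum_abs], rule sum_mono) (simp add: abs_mult nonneg e mult_left_mono)
    also have "\<dots> = real k * C * \<theta> ^ n * (\<Sum>j\<in>UNIV. M $ i $ j * u $ j)"
      by (simp add: sum_distrib_left mult_ac)
    also have "(\<Sum>j\<in>UNIV. M $ i $ j * u $ j) = \<rho> * u $ i"
      using arg_cong[OF eig, of "\<lambda>v. v $ i"] by (simp add: mat_vec_nth)
    finally have "\<bar>(M *v e) $ i\<bar> / \<rho> \<le> real k * C * \<theta> ^ n * u $ i"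
      using \<rho> by (simp add: field_simps)
    moreover have "\<bar>b (Suc (n + k)) $ i - (M *v b (n + k)) $ i / \<rho>\<bar> \<le> C * \<theta> ^ n * u $ i"
    proof (rule order_trans[OF step])
      have "\<theta> ^ (n + k) \<le> \<theta> ^ n"
        using \<theta> by (intro power_decreasing) auto
      then show "C * \<theta> ^ (n + k) * u $ i \<le> C * \<theta> ^ n * u $ i"
        using C u[of i] by (intro mult_right_mono mult_left_mono) auto
    qed
    ultimately show ?case
      unfolding eq using \<rho> by (intro order_trans[OF abs_triangle_ineq]) (simp add: algebra_simps)
  qed
  define a where "a n i = b n $ i / u $ i" for n i
  define Mx where "Mx n = Max (range (a n))" for n
  define Mn where "Mn n = Min (range (a n))" for n
  have ab: "b n $ i = a n i * u $ i" for n i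
    using u[of i] by (simp add: a_def)
  have a_le: "a n i \<le> Mx n" and a_ge: "Mn n \<le> a n i" for n i
    by (auto simp: Mx_def Mn_def)
  have a_K: "- K \<le> a n i" for n i
    using bounded[of n i] u[of i] by (simp add: a_def field_simps abs_le_iff)
  \<comment> \<open>Row \<open>i\<close> of \<open>mat_pow M k\<close>, weighted by
    \<open>u\<close>, has total \<rho>^k times \<open>u $ i\<close>. At least the fraction
    \<open>d\<close> falls on the index \<open>j\<close> of the smallest ratio, so the maximum drops
    by \<open>d\<close> times the spread, up to the accumulated defects.\<close>
  have upper: "Mx (n + k) \<le> Mx n - d * (Mx n - Mn n) + real k * C * \<theta> ^ n"
    if d: "\<And>i j. d * \<rho> ^ k * u $ i \<le> mat_pow M k $ i $ j * u $ j" for n k d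
  proof -
    have "Mx (n + k) \<in> range (a (n + k))"
      unfolding Mx_def by (rule Max_in) auto
    then obtain i where i: "Mx (n + k) = a (n + k) i"
      by blast
    have "Mn n \<in> range (a n)"
      unfolding Mn_def by (rule Min_in) auto
    then obtain j where j: "Mn n = a n j"
      by blast
    have "(Mx n - Mn n) * (mat_pow M k $ i $ j * u $ j) = mat_pow M k $ i $ j * (Mx n * u $ j - b n $ j)"
      by (simp add: j ab algebra_simps)
    also have "\<dots> \<le> (\<Sum>j\<in>UNIV. mat_pow M k $ i $ j * (Mx n * u $ j - b n $ j))"
      using u by (intro member_le_sum mult_nonneg_nonneg mat_pow_nonneg nonneg)
        (auto simp: ab a_le mult_right_mono less_imp_le)
    also have "\<dots> = Mx n * (\<rho> ^ k * u $ i) - (mat_pow M k *v b n) $ i"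
      unfolding eigk[symmetric] by (simp add: mat_vec_nth right_diff_distrib sum_subtractf sum_distrib_left mult_ac)
    finally have "(mat_pow M k *v b n) $ i \<le> Mx n * (\<rho> ^ k * u $ i) - (Mx n - Mn n) * (mat_pow M k $ i $ j * u $ j)"
      by simp
    also have "\<dots> \<le> Mx n * (\<rho> ^ k * u $ i) - (Mx n - Mn n) * (d * \<rho> ^ k * u $ i)"
      using d[of i j] a_le[of n j] by (intro diff_left_mono mult_left_mono) (auto simp: j)
    finally have "(mat_pow M k *v b n) $ i / \<rho> ^ k \<le> (Mx n - d * (Mx n - Mn n)) * u $ i"
      using \<rho> by (simp add: field_simps)
    then have "a (n + k) i * u $ i \<le> (Mx n - d * (Mx n - Mn n) + real k * C * \<theta> ^ n) * u $ i"
      using k_step[of n k i] by (simp add: ab algebra_simps)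
    then show ?thesis
      using u[of i] i by simp
  qed
  \<comment> \<open>The added term is the tail of the geometric series of defects. It makes the
    maxima decreasing, as the case \<open>k = 1\<close>, \<open>d = 0\<close> of
    \<open>upper\<close> shows.\<close>
  define B where "B n = Mx n + C * \<theta> ^ n / (1 - \<theta>)" for n
  have "decseq B"
  proof (rule decseq_SucI)
    fix n
    have "Mx (n + 1) \<le> Mx n - 0 * (Mx n - Mn n) + real 1 * C * \<theta> ^ n"
      by (rule upper) (use u in \<open>simp add: mat_pow_nonneg nonneg less_imp_le\<close>)
    moreover have "C * \<theta> ^ n + C * \<theta> ^ Suc n / (1 - \<theta>) = C * \<theta> ^ n / (1 - \<theta>)"
      using \<theta> by (simp add: field_simps)
    ultimately show "B (Suc n) \<le> B n"
      by (simp add: B_def)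
  qed
  moreover have "- K \<le> B n" for n
    using a_K[of n] a_le[of n] C \<theta> by (auto simp: B_def intro!: add_increasing2 intro: order_trans)
  ultimately obtain L where "B \<longlonglongrightarrow> L"
    using decseq_convergent[of B "- K"] by blast
  moreover have th: "(\<lambda>n. C * \<theta> ^ n / (1 - \<theta>)) \<longlonglongrightarrow> C * 0 / (1 - \<theta>)"
    using \<theta> by (intro tendsto_intros LIMSEQ_power_zero) auto
  ultimately have "(\<lambda>n. B n - C * \<theta> ^ n / (1 - \<theta>)) \<longlonglongrightarrow> L - C * 0 / (1 - \<theta>)"
    by (rule tendsto_diff)
  then have Mx: "Mx \<longlonglongrightarrow> L"
    by (simp add: B_def)
  \<comment> \<open>The smallest fraction that a single index receives under the power
    \<open>N\<close>; positive as a minimum over finitely many positive numbers.\<close>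
  define d where "d = Min (range (\<lambda>(i, j). mat_pow M N $ i $ j * u $ j / (\<rho> ^ N * u $ i)))"
  have d_pos: "0 < d"
    unfolding d_def using N(2) u \<rho> by (subst Min_gr_iff) auto
  have d_le: "d * \<rho> ^ N * u $ i \<le> mat_pow M N $ i $ j * u $ j" for i j
  proof -
    have "d \<le> mat_pow M N $ i $ j * u $ j / (\<rho> ^ N * u $ i)"
      unfolding d_def by (rule Min_le) auto
    then show ?thesis
      using u[of i] \<rho> by (simp add: field_simps)
  qed
  \<comment> \<open>The maxima converge, so their drop over \<open>N\<close> steps tends to 0, and
    the contraction bounds the spread by this drop.\<close>
  have gap: "Mx n - Mn n \<le> (Mx n - Mx (n + N) + real N * C * \<theta> ^ n) / d" for n
    using upper[OF d_le, of n] d_pos by (simp add: field_simps)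
  have gap0: "(\<lambda>n. (Mx n - Mx (n + N) + real N * C * \<theta> ^ n) / d) \<longlonglongrightarrow> (L - L + real N * C * 0) / d"
    using \<theta> d_pos by (intro tendsto_intros Mx LIMSEQ_ignore_initial_segment[OF Mx] LIMSEQ_power_zero) auto
  show ?thesis
  proof (intro exI[of _ L] allI)
    fix i
    have "(\<lambda>n. a n i) \<longlonglongrightarrow> L"
    proof (rule tendsto_sandwich[OF _ _ _ Mx])
      show "\<forall>\<^sub>F n in sequentially. Mx n - (Mx n - Mx (n + N) + real N * C * \<theta> ^ n) / d \<le> a n i"
      proof (intro always_eventually allI)
        show "Mx n - (Mx n - Mx (n + N) + real N * C * \<theta> ^ n) / d \<le> a n i" for n
          using gap[of n] a_ge[of n i] by linarith
      qed
      show "(\<lambda>n. Mx n - (Mx n - Mx (n + N) + real N * C * \<theta> ^ n) / d) \<longlonglongrightarrow> L"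
        using tendsto_diff[OF Mx gap0] by simp
    qed (simp add: a_le)
    then show "(\<lambda>n. b n $ i) \<longlonglongrightarrow> L * u $ i"
      unfolding ab by (intro tendsto_mult tendsto_const)
  qed
qed

section \<open>Subcritical processes with finite second moments\<close>

text \<open>Moments are first computed as nonnegative integrals; a finite value then gives
  integrability and the real expectation together.\<close>

lemma pmf_moment_eqI:
  fixes f :: "'a \<Rightarrow> real"
  assumes "\<And>k. 0 \<le> f k" "0 \<le> c" "(\<integral>\<^sup>+k. f k \<partial>measure_pmf \<pi>) = ennreal c"
  shows "integrable (measure_pmf \<pi>) f" "measure_pmf.expectation \<pi> f = c"
proof -
  show "integrable (measure_pmf \<pi>) f"
    by (rule integrableI_nn_integral_finite[OF _ _ assms(3)]) (auto simp: assms)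
  show "measure_pmf.expectation \<pi> f = c"
    using assms by (subst integral_eq_nn_integral) auto
qed

lemma pmf_moment_leI:
  fixes f :: "'a \<Rightarrow> real"
  assumes "\<And>k. 0 \<le> f k" "0 \<le> c" "(\<integral>\<^sup>+k. f k \<partial>measure_pmf \<pi>) \<le> ennreal c"
  shows "integrable (measure_pmf \<pi>) f" "measure_pmf.expectation \<pi> f \<le> c"
proof -
  obtain c' where c': "(\<integral>\<^sup>+k. f k \<partial>measure_pmf \<pi>) = ennreal c'" "0 \<le> c'"
    using assms(3) by (metis ennreal_cases ennreal_less_top less_le_trans not_less order.strict_iff_not top.extremum_strict)
  then have "c' \<le> c"
    using assms by simp
  then show "integrable (measure_pmf \<pi>) f" "measure_pmf.expectation \<pi> f \<le> c"
    using pmf_moment_eqI[OF assms(1) c'(2,1)] by auto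
qed

lemma vec_dot_mean:
  fixes w :: "real ^ 'd::finite"
  assumes "\<And>j. integrable (measure_pmf \<pi>) (\<lambda>k. real (k $ j))"
  shows "integrable (measure_pmf \<pi>) (\<lambda>k. vec_dot k w)"
    and "measure_pmf.expectation \<pi> (\<lambda>k. vec_dot k w) =
      (\<Sum>j\<in>UNIV. measure_pmf.expectation \<pi> (\<lambda>k. real (k $ j)) * w $ j)"
  unfolding vec_dot_def using assms by (auto simp: integrable_mult_left)

text \<open>The eigenvalue enters through a positive eigenvector, which makes it the Perron root.
  Second moments are stated for the weight \<open>vec_dot k u\<close>, the quantity that the
  estimates use.\<close>

locale subcritical_gw =
  fixes p :: "'d::finite \<Rightarrow> (nat ^ 'd) pmf" and M :: "real ^ 'd ^ 'd" and u :: "real ^ 'd" and \<rho> :: real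
  assumes means: "\<And>i j. integrable (measure_pmf (p i)) (\<lambda>k. real (k $ j))"
    and M_eq: "\<And>i j. M $ i $ j = measure_pmf.expectation (p i) (\<lambda>k. real (k $ j))"
    and reg: "positive_regular M"
    and u_pos: "\<And>i. 0 < u $ i" and eig: "M *v u = \<rho> *s u" and \<rho>_pos: "0 < \<rho>" and \<rho>_less: "\<rho> < 1"
    and second_moments: "\<And>i. integrable (measure_pmf (p i)) (\<lambda>k. (vec_dot k u)\<^sup>2)"
begin

abbreviation wt :: "nat ^ 'd \<Rightarrow> real" where "wt y \<equiv> vec_dot y u"

lemma wt_nonneg [simp]: "0 \<le> wt y"
  using u_pos by (intro vec_dot_nonneg less_imp_le)

lemma M_nonneg: "0 \<le> M $ i $ j"
  unfolding M_eq by (rule Bochner_Integration.integral_nonneg) simp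

lemma offspring_wt_mean:
  "integrable (measure_pmf (p i)) wt" "measure_pmf.expectation (p i) wt = \<rho> * u $ i"
proof -
  show "integrable (measure_pmf (p i)) wt"
    by (rule vec_dot_mean[OF means])
  show "measure_pmf.expectation (p i) wt = \<rho> * u $ i"
    using arg_cong[OF eig, of "\<lambda>v. v $ i"] by (simp add: vec_dot_mean[OF means] mat_vec_nth M_eq)
qed

lemma next_generation_add:
  "next_generation p (x + y) = bind_pmf (next_generation p x) (\<lambda>a. map_pmf ((+) a) (next_generation p y))"
  using gw_add[of p 1 x y] by (simp only: gw_one)

lemma next_generation_0: "next_generation p 0 = return_pmf 0"
  using gw_0_right[of p 1] by (simp only: gw_one)

text \<open>Weighting by the right eigenvector makes the mean growth scalar: an added individual of
  type \<open>i\<close> contributes \<rho> times \<open>u $ i\<close>.\<close>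

lemma nn_integral_wt_next: "(\<integral>\<^sup>+y. wt y \<partial>next_generation p x) = ennreal (\<rho> * wt x)"
proof (induction x rule: nat_vec_induct)
  case zero
  show ?case by (simp add: next_generation_0)
next
  case (step x i)
  have "(\<integral>\<^sup>+y. wt y \<partial>next_generation p (x + axis i 1)) =
    (\<integral>\<^sup>+a. \<integral>\<^sup>+b. ennreal (wt a) + ennreal (wt b) \<partial>p i \<partial>next_generation p x)"
    unfolding next_generation_add next_generation_axis by (simp add: vec_dot_add)
  also have "\<dots> = (\<integral>\<^sup>+y. wt y \<partial>next_generation p x) + (\<integral>\<^sup>+b. wt b \<partial>p i)"
    by (simp add: nn_integral_add)
  also have "(\<integral>\<^sup>+b. wt b \<partial>p i) = ennreal (\<rho> * u $ i)"
    using nn_integral_eq_integral[OF offspring_wt_mean(1)[of i]] by (simp add: offspring_wt_mean)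
  finally show ?case
    using \<rho>_pos u_pos[of i] by (simp add: step vec_dot_add distrib_left)
qed

lemma nn_integral_wt_gw: "(\<integral>\<^sup>+y. wt y \<partial>gw p n x) = ennreal (\<rho> ^ n * wt x)"
proof (induction n)
  case (Suc n)
  have "(\<integral>\<^sup>+y. wt y \<partial>gw p (Suc n) x) = (\<integral>\<^sup>+y. ennreal \<rho> * wt y \<partial>gw p n x)"
    using \<rho>_pos by (simp add: nn_integral_wt_next ennreal_mult)
  also have "\<dots> = ennreal \<rho> * ennreal (\<rho> ^ n * wt x)"
    by (simp add: nn_integral_cmult Suc)
  finally show ?case
    using \<rho>_pos by (simp add: mult.assoc flip: ennreal_mult)
qed simp

lemma gw_wt_mean: "integrable (gw p n x) wt" "measure_pmf.expectation (gw p n x) wt = \<rho> ^ n * wt x"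
  using \<rho>_pos by (auto intro!: pmf_moment_eqI[OF _ _ nn_integral_wt_gw])

text \<open>Offspring second moments measured in units of \<open>u $ i\<close>, so that over a whole
  population they add up to a multiple of \<open>wt x\<close>.\<close>

definition C2 :: real where
  "C2 = Max (range (\<lambda>i. measure_pmf.expectation (p i) (\<lambda>k. (wt k)\<^sup>2) / u $ i))"

lemma offspring_second_moment_le: "measure_pmf.expectation (p i) (\<lambda>k. (wt k)\<^sup>2) \<le> C2 * u $ i"
proof -
  have "measure_pmf.expectation (p i) (\<lambda>k. (wt k)\<^sup>2) / u $ i \<le> C2"
    unfolding C2_def by (rule Max_ge) auto
  then show ?thesis
    using u_pos[of i] by (simp add: field_simps)
qed

lemma C2_nonneg: "0 \<le> C2"
proof -
  have "0 \<le> C2 * u $ undefined"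
    by (rule order_trans[OF _ offspring_second_moment_le]) (rule Bochner_Integration.integral_nonneg, simp)
  then show ?thesis
    using u_pos[of undefined] by (simp add: zero_le_mult_iff)
qed

text \<open>Expand the square when an individual of type \<open>i\<close> is added: by independence
  the cross term has mean \<open>2 * (\<rho> * wt x) * (\<rho> * u $ i)\<close>, and the new second
  moment is at most \<open>C2 * u $ i\<close>. Completing the square only enlarges the
  bound.\<close>

lemma nn_integral_wt_square_next:
  "(\<integral>\<^sup>+y. (wt y)\<^sup>2 \<partial>next_generation p x) \<le> ennreal (\<rho>\<^sup>2 * (wt x)\<^sup>2 + C2 * wt x)"
proof (induction x rule: nat_vec_induct)
  case zero
  show ?case by (simp add: next_generation_0)
next
  case (step x i)
  have sq: "ennreal ((wt (a + b))\<^sup>2) = ennreal ((wt a)\<^sup>2) + (ennreal (2 * wt a) * ennreal (wt b) + ennreal ((wt b)\<^sup>2))" for a b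
    by (simp add: vec_dot_add power2_sum algebra_simps flip: ennreal_mult ennreal_plus)
  have m2: "(\<integral>\<^sup>+b. ennreal ((wt b)\<^sup>2) \<partial>p i) \<le> ennreal (C2 * u $ i)"
    using nn_integral_eq_integral[OF second_moments[of i]] offspring_second_moment_le[of i]
    by (simp add: ennreal_leI)
  have m1: "(\<integral>\<^sup>+b. ennreal (wt b) \<partial>p i) = ennreal (\<rho> * u $ i)"
    using nn_integral_eq_integral[OF offspring_wt_mean(1)[of i]] by (simp add: offspring_wt_mean)
  have "(\<integral>\<^sup>+y. (wt y)\<^sup>2 \<partial>next_generation p (x + axis i 1)) =
    (\<integral>\<^sup>+a. \<integral>\<^sup>+b. ennreal ((wt a)\<^sup>2) + (ennreal (2 * wt a) * ennreal (wt b) + ennreal ((wt b)\<^sup>2)) \<partial>p i \<partial>next_generation p x)"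
    unfolding next_generation_add next_generation_axis by (simp add: sq)
  also have "\<dots> = (\<integral>\<^sup>+a. ennreal ((wt a)\<^sup>2) + (ennreal (2 * wt a) * ennreal (\<rho> * u $ i) + (\<integral>\<^sup>+b. ennreal ((wt b)\<^sup>2) \<partial>p i)) \<partial>next_generation p x)"
    by (simp add: nn_integral_add nn_integral_cmult m1)
  also have "\<dots> = (\<integral>\<^sup>+a. ennreal ((wt a)\<^sup>2) \<partial>next_generation p x) +
    ((\<integral>\<^sup>+a. ennreal 2 * ennreal (wt a) \<partial>next_generation p x) * ennreal (\<rho> * u $ i) + (\<integral>\<^sup>+b. ennreal ((wt b)\<^sup>2) \<partial>p i))"
    by (simp add: nn_integral_add nn_integral_multc ennreal_mult)
  also have "(\<integral>\<^sup>+a. ennreal 2 * ennreal (wt a) \<partial>next_generation p x) = ennreal (2 * (\<rho> * wt x))"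
    using \<rho>_pos by (simp add: nn_integral_cmult nn_integral_wt_next ennreal_mult)
  also have "(\<integral>\<^sup>+a. ennreal ((wt a)\<^sup>2) \<partial>next_generation p x) +
      (ennreal (2 * (\<rho> * wt x)) * ennreal (\<rho> * u $ i) + (\<integral>\<^sup>+b. ennreal ((wt b)\<^sup>2) \<partial>p i)) \<le>
    ennreal (\<rho>\<^sup>2 * (wt x)\<^sup>2 + C2 * wt x) + (ennreal (2 * (\<rho> * wt x)) * ennreal (\<rho> * u $ i) + ennreal (C2 * u $ i))"
    by (intro add_mono step m2 order_refl)
  also have "\<dots> = ennreal ((\<rho>\<^sup>2 * (wt x)\<^sup>2 + C2 * wt x) + ((2 * (\<rho> * wt x)) * (\<rho> * u $ i) + C2 * u $ i))"
    using \<rho>_pos u_pos[of i] C2_nonneg by (simp flip: ennreal_mult ennreal_plus)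
  also have "\<dots> \<le> ennreal (\<rho>\<^sup>2 * (wt (x + axis i 1))\<^sup>2 + C2 * wt (x + axis i 1))"
  proof (rule ennreal_leI)
    have "\<rho>\<^sup>2 * (wt (x + axis i 1))\<^sup>2 + C2 * wt (x + axis i 1) =
      (\<rho>\<^sup>2 * (wt x)\<^sup>2 + C2 * wt x) + ((2 * (\<rho> * wt x)) * (\<rho> * u $ i) + C2 * u $ i) + (\<rho> * u $ i)\<^sup>2"
      by (simp add: vec_dot_add power2_eq_square algebra_simps)
    then show "(\<rho>\<^sup>2 * (wt x)\<^sup>2 + C2 * wt x) + ((2 * (\<rho> * wt x)) * (\<rho> * u $ i) + C2 * u $ i) \<le>
      \<rho>\<^sup>2 * (wt (x + axis i 1))\<^sup>2 + C2 * wt (x + axis i 1)"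
      by simp
  qed
  finally show ?case .
qed

text \<open>The square covers generation 0. The second term gives
  \<open>C2 * wt x \<le> A2 x * (\<rho> * (1 - \<rho>))\<close>, which is what the one-step
  recursion needs to reproduce the bound \<open>A2 x * \<rho> ^ n\<close>.\<close>

definition A2 :: "nat ^ 'd \<Rightarrow> real" where
  "A2 x = (wt x)\<^sup>2 + C2 * wt x / (\<rho> * (1 - \<rho>))"

lemma A2_nonneg: "0 \<le> A2 x"
  using \<rho>_pos \<rho>_less C2_nonneg by (simp add: A2_def)

text \<open>The second moment decays at the rate of the mean. Relative to \<rho>^n, no weight can
  therefore escape to large populations.\<close>

lemma nn_integral_wt_square_gw: "(\<integral>\<^sup>+y. (wt y)\<^sup>2 \<partial>gw p n x) \<le> ennreal (A2 x * \<rho> ^ n)"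
proof (induction n)
  case 0
  have "(wt x)\<^sup>2 \<le> A2 x"
    using \<rho>_pos \<rho>_less C2_nonneg by (simp add: A2_def)
  then show ?case by (simp add: ennreal_leI)
next
  case (Suc n)
  have "(\<integral>\<^sup>+y. (wt y)\<^sup>2 \<partial>gw p (Suc n) x) \<le> (\<integral>\<^sup>+y. ennreal (\<rho>\<^sup>2) * ennreal ((wt y)\<^sup>2) + ennreal C2 * ennreal (wt y) \<partial>gw p n x)"
    using C2_nonneg
    by (auto intro!: nn_integral_mono order_trans[OF nn_integral_wt_square_next] simp flip: ennreal_mult ennreal_plus)
  also have "\<dots> = ennreal (\<rho>\<^sup>2) * (\<integral>\<^sup>+y. (wt y)\<^sup>2 \<partial>gw p n x) + ennreal C2 * ennreal (\<rho> ^ n * wt x)"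
    by (simp add: nn_integral_add nn_integral_cmult nn_integral_wt_gw)
  also have "\<dots> \<le> ennreal (\<rho>\<^sup>2) * ennreal (A2 x * \<rho> ^ n) + ennreal C2 * ennreal (\<rho> ^ n * wt x)"
    by (intro add_mono mult_left_mono Suc) auto
  also have "\<dots> = ennreal (\<rho>\<^sup>2 * (A2 x * \<rho> ^ n) + C2 * (\<rho> ^ n * wt x))"
    using \<rho>_pos C2_nonneg A2_nonneg by (simp flip: ennreal_mult ennreal_plus)
  also have "\<dots> \<le> ennreal (A2 x * \<rho> ^ Suc n)"
  proof (rule ennreal_leI)
    have "C2 * wt x \<le> A2 x * (\<rho> * (1 - \<rho>))"
      using \<rho>_pos \<rho>_less by (simp add: A2_def distrib_right)
    then have "\<rho> ^ n * (C2 * wt x) \<le> \<rho> ^ n * (A2 x * (\<rho> * (1 - \<rho>)))"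
      using \<rho>_pos by (intro mult_left_mono) auto
    then show "\<rho>\<^sup>2 * (A2 x * \<rho> ^ n) + C2 * (\<rho> ^ n * wt x) \<le> A2 x * \<rho> ^ Suc n"
      by (simp add: algebra_simps power2_eq_square)
  qed
  finally show ?case .
qed

lemma gw_wt_square:
  "integrable (gw p n x) (\<lambda>y. (wt y)\<^sup>2)" "measure_pmf.expectation (gw p n x) (\<lambda>y. (wt y)\<^sup>2) \<le> A2 x * \<rho> ^ n"
  using \<rho>_pos A2_nonneg by (auto intro!: pmf_moment_leI[OF _ _ nn_integral_wt_square_gw])

definition umin :: real where "umin = Min (range (($) u))"

lemma umin_pos: "0 < umin"
  unfolding umin_def using u_pos by (subst Min_gr_iff) auto

lemma umin_le_wt: assumes "y \<noteq> 0" shows "umin \<le> wt y"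
proof -
  obtain i where "y $ i \<noteq> 0"
    using assms by (auto simp: vec_eq_iff)
  then have "1 * u $ i \<le> real (y $ i) * u $ i"
    using u_pos[of i] by (intro mult_right_mono) auto
  also have "\<dots> \<le> wt y"
    using u_pos by (intro vec_dot_ge_component less_imp_le)
  finally have "u $ i \<le> wt y"
    by simp
  moreover have "umin \<le> u $ i"
    unfolding umin_def by (rule Min_le) auto
  ultimately show ?thesis
    by simp
qed

text \<open>Real-valued so that it can be integrated. The condition
  \<open>\<bar>h y\<bar> \<le> alive y\<close> says at once that \<open>h\<close> is bounded by 1
  and vanishes on the empty population.\<close>

definition alive :: "nat ^ 'd \<Rightarrow> real" where "alive y = of_bool (y \<noteq> 0)"

text \<open>Markov's inequality: a nonempty population has weight at least
  \<open>umin\<close>.\<close>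

lemma survival_le: "measure_pmf.expectation (gw p n x) alive \<le> \<rho> ^ n * wt x / umin"
proof -
  have "measure_pmf.expectation (gw p n x) alive \<le> measure_pmf.expectation (gw p n x) (\<lambda>y. wt y / umin)"
  proof (intro integral_mono)
    show "integrable (gw p n x) alive"
      by (rule integrable_pmf_bounded[of _ 1]) (simp add: alive_def)
    show "integrable (gw p n x) (\<lambda>y. wt y / umin)"
      by (intro integrable_divide gw_wt_mean)
    show "alive y \<le> wt y / umin" for y
      using umin_pos umin_le_wt[of y] by (cases "y = 0") (auto simp: alive_def field_simps)
  qed
  then show ?thesis
    by (simp add: gw_wt_mean)
qed

lemma survival_eq: "measure_pmf.expectation (gw p n x) alive = 1 - pmf (gw p n x) 0"
proof -
  have "measure_pmf.expectation (gw p n x) alive = measure_pmf.expectation (gw p n x) (\<lambda>y. 1 - indicator {0} y)"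
    by (rule Bochner_Integration.integral_cong) (auto simp: alive_def indicator_def)
  also have "\<dots> = measure_pmf.expectation (gw p n x) (\<lambda>_. 1) - measure_pmf.expectation (gw p n x) (indicator {0})"
    by (intro Bochner_Integration.integral_diff integrable_pmf_bounded[of _ 1]) auto
  finally show ?thesis
    by (simp add: measure_pmf_single)
qed

lemma gw_functional_bound:
  assumes "\<And>y. \<bar>h y\<bar> \<le> alive y"
  shows "\<bar>measure_pmf.expectation (gw p k x) h\<bar> \<le> measure_pmf.expectation (gw p k x) alive"
proof -
  have *: "\<bar>alive y\<bar> \<le> 1" "\<bar>h y\<bar> \<le> 1" for y
    using assms[of y] by (cases "y = 0"; auto simp: alive_def)+
  have "\<bar>measure_pmf.expectation (gw p k x) h\<bar> \<le> measure_pmf.expectation (gw p k x) (\<lambda>y. \<bar>h y\<bar>)"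
    by (rule integral_abs_bound)
  also have "\<dots> \<le> measure_pmf.expectation (gw p k x) alive"
    using * by (intro integral_mono integrable_pmf_bounded[of _ 1] assms) auto
  finally show ?thesis .
qed

text \<open>The integrand \<open>h (a + b) - h a - h b\<close> vanishes unless both subpopulations are alive.\<close>

lemma gw_functional_almost_additive:
  assumes h: "\<And>y. \<bar>h y\<bar> \<le> alive y"
  shows "\<bar>measure_pmf.expectation (gw p k (x + y)) h -
      (measure_pmf.expectation (gw p k x) h + measure_pmf.expectation (gw p k y) h)\<bar> \<le>
    3 * (measure_pmf.expectation (gw p k x) alive * measure_pmf.expectation (gw p k y) alive)"
proof -
  let ?E = "\<lambda>x f. measure_pmf.expectation (gw p k x) f"
  have alive1: "\<bar>alive y\<bar> \<le> 1" and h1: "\<bar>h y\<bar> \<le> 1" for y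
    using h[of y] by (cases "y = 0"; auto simp: alive_def)+
  have h0: "h 0 = 0"
    using h[of 0] by (simp add: alive_def)
  have i: "integrable (gw p k z) (\<lambda>b. h (a + b))" "integrable (gw p k z) h" "integrable (gw p k z) alive" for z a
    by (rule integrable_pmf_bounded[of _ 1], simp add: alive1 h1)+
  have "?E (x + y) h = ?E x (\<lambda>a. ?E y (\<lambda>b. h (a + b)))"
    unfolding gw_add by (subst expectation_bind_pmf[OF h1]) simp
  moreover have "?E x (\<lambda>a. ?E y (\<lambda>b. h (a + b)) - (h a + ?E y h)) =
    ?E x (\<lambda>a. ?E y (\<lambda>b. h (a + b))) - (?E x h + ?E y h)"
  proof -
    have "integrable (gw p k x) (\<lambda>a. ?E y (\<lambda>b. h (a + b)))"
      by (rule integrable_pmf_bounded[of _ 1]) (intro expectation_pmf_abs_le h1)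
    then show ?thesis
      using i(2)[of x] by simp
  qed
  moreover have "?E y (\<lambda>b. h (a + b)) - (h a + ?E y h) = ?E y (\<lambda>b. h (a + b) - (h a + h b))" for a
    using i(1)[of y] i(2)[of y] i(3)[of y] by simp
  ultimately have "\<bar>?E (x + y) h - (?E x h + ?E y h)\<bar> = \<bar>?E x (\<lambda>a. ?E y (\<lambda>b. h (a + b) - (h a + h b)))\<bar>"
    by simp
  also have "\<dots> \<le> ?E x (\<lambda>a. \<bar>?E y (\<lambda>b. h (a + b) - (h a + h b))\<bar>)"
    by (rule integral_abs_bound)
  also have "\<dots> \<le> ?E x (\<lambda>a. 3 * alive a * ?E y alive)"
  proof (rule integral_mono)
    have 3: "\<bar>h (a + b) - (h a + h b)\<bar> \<le> 3 * alive a * alive b" for a b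
    proof (cases "a = 0 \<or> b = 0")
      case False
      then show ?thesis
        using h1[of "a + b"] h1[of a] h1[of b] by (simp add: alive_def)
    qed (auto simp: h0 alive_def)
    show "\<bar>?E y (\<lambda>b. h (a + b) - (h a + h b))\<bar> \<le> 3 * alive a * ?E y alive" for a
    proof -
      have "\<bar>?E y (\<lambda>b. h (a + b) - (h a + h b))\<bar> \<le> ?E y (\<lambda>b. \<bar>h (a + b) - (h a + h b)\<bar>)"
        by (rule integral_abs_bound)
      also have "\<dots> \<le> ?E y (\<lambda>b. 3 * alive a * alive b)"
        using i(1)[of y] i(2)[of y] i(3)[of y] by (intro integral_mono 3) auto
      finally show ?thesis
        by simp
    qed
    show "integrable (gw p k x) (\<lambda>a. \<bar>?E y (\<lambda>b. h (a + b) - (h a + h b))\<bar>)"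
    proof (rule integrable_pmf_bounded[of _ 3])
      have "\<bar>?E y (\<lambda>b. h (a + b) - (h a + h b))\<bar> \<le> 3" for a
      proof (rule expectation_pmf_abs_le)
        show "\<bar>h (a + b) - (h a + h b)\<bar> \<le> 3" for b
          using h1[of "a + b"] h1[of a] h1[of b] by linarith
      qed
      then show "\<bar>\<bar>?E y (\<lambda>b. h (a + b) - (h a + h b))\<bar>\<bar> \<le> 3" for a
        by simp
    qed
    show "integrable (gw p k x) (\<lambda>a. 3 * alive a * ?E y alive)"
      using i(3)[of x] by simp
  qed
  also have "\<dots> = 3 * (?E x alive * ?E y alive)"
    by simp
  finally show ?thesis .
qed

text \<open>Adding one individual costs three times the product of two survival probabilities, hence
  a multiple of \<open>wt x * u $ i\<close>. The square \<open>(wt x)\<^sup>2\<close> grows by at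
  least this increment, so the induction closes.\<close>

lemma gw_functional_almost_linear:
  assumes h: "\<And>y. \<bar>h y\<bar> \<le> alive y"
  shows "\<bar>measure_pmf.expectation (gw p k x) h - vec_dot x (\<chi> i. measure_pmf.expectation (gw p k (axis i 1)) h)\<bar> \<le>
    3 / umin\<^sup>2 * (\<rho> ^ k)\<^sup>2 * (wt x)\<^sup>2"
proof (induction x rule: nat_vec_induct)
  case zero
  have "h 0 = 0"
    using h[of 0] by (simp add: alive_def)
  then show ?case by simp
next
  case (step x i)
  let ?E = "\<lambda>x f. measure_pmf.expectation (gw p k x) f"
  let ?D = "3 / umin\<^sup>2 * (\<rho> ^ k)\<^sup>2"
  have nn: "0 \<le> ?E z alive" for z
    by (rule Bochner_Integration.integral_nonneg) (simp add: alive_def)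
  have "3 * (?E x alive * ?E (axis i 1) alive) \<le> 3 * ((\<rho> ^ k * wt x / umin) * (\<rho> ^ k * wt (axis i 1) / umin))"
    using \<rho>_pos umin_pos by (intro mult_left_mono mult_mono survival_le nn) auto
  also have "\<dots> = ?D * (wt x * u $ i)"
    by (simp add: power2_eq_square)
  finally have "\<bar>?E (x + axis i 1) h - (?E x h + ?E (axis i 1) h)\<bar> \<le> ?D * (wt x * u $ i)"
    using gw_functional_almost_additive[OF h, of k x "axis i 1"] by linarith
  then have "\<bar>?E (x + axis i 1) h - vec_dot (x + axis i 1) (\<chi> i. ?E (axis i 1) h)\<bar> \<le> ?D * (wt x)\<^sup>2 + ?D * (wt x * u $ i)"
    using step by (simp add: vec_dot_add)
  also have "\<dots> = ?D * ((wt x)\<^sup>2 + wt x * u $ i)"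
    by (simp add: distrib_left)
  also have "\<dots> \<le> ?D * (wt (x + axis i 1))\<^sup>2"
    using u_pos[of i] by (intro mult_left_mono) (auto simp: vec_dot_add power2_eq_square algebra_simps intro!: add_nonneg_nonneg mult_nonneg_nonneg)
  finally show ?case .
qed

text \<open>For single individuals this is the perturbed Perron iteration with geometric ratio
  \<rho>; almost linearity then extends it to all starting populations.\<close>

lemma gw_functional_tendsto:
  assumes h: "\<And>y. \<bar>h y\<bar> \<le> alive y"
  shows "\<exists>L. \<forall>x. (\<lambda>k. measure_pmf.expectation (gw p k x) h / \<rho> ^ k) \<longlonglongrightarrow> L * wt x"
proof -
  let ?E = "\<lambda>k x. measure_pmf.expectation (gw p k x) h"
  define F where "F k = (\<chi> i. ?E k (axis i 1))" for k
  define b where "b k = (1 / \<rho> ^ k) *s F k" for k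
  define D where "D = 3 / umin\<^sup>2"
  have h1: "\<bar>h y\<bar> \<le> 1" for y
    using h[of y] by (cases "y = 0"; auto simp: alive_def)+
  have lin: "\<bar>?E k x - vec_dot x (F k)\<bar> \<le> D * (\<rho> ^ k)\<^sup>2 * (wt x)\<^sup>2" for k x
    using gw_functional_almost_linear[OF h] by (simp add: F_def D_def)
  have "\<exists>L. \<forall>i. (\<lambda>k. b k $ i) \<longlonglongrightarrow> L * u $ i"
  proof (rule perturbed_perron_iteration_converges[OF reg M_nonneg u_pos eig \<rho>_pos])
    fix k i
    \<comment> \<open>Splitting at the first generation: if \<open>?E k\<close> were linear in the
      population, \<open>F (Suc k)\<close> would equal \<open>M *v F k\<close>. The defect is of
      order \<rho>^(2k), which after division by \<rho>^(k+1) leaves order \<rho>^k.\<close>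
    have "?E (Suc k) (axis i 1) = measure_pmf.expectation (p i) (?E k)"
      unfolding gw_Suc_left next_generation_axis by (rule expectation_bind_pmf[OF h1])
    then have "F (Suc k) $ i - (M *v F k) $ i = measure_pmf.expectation (p i) (\<lambda>y. ?E k y - vec_dot y (F k))"
      using vec_dot_mean[OF means, of i "F k"] integrable_pmf_bounded[of "?E k" 1 "p i", OF expectation_pmf_abs_le[OF h1]]
      by (simp add: F_def mat_vec_nth M_eq)
    also have "\<bar>\<dots>\<bar> \<le> measure_pmf.expectation (p i) (\<lambda>y. \<bar>?E k y - vec_dot y (F k)\<bar>)"
      by (rule integral_abs_bound)
    also have "\<dots> \<le> measure_pmf.expectation (p i) (\<lambda>y. D * (\<rho> ^ k)\<^sup>2 * (wt y)\<^sup>2)"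
      using vec_dot_mean(1)[OF means, of i "F k"] integrable_pmf_bounded[of "?E k" 1 "p i", OF expectation_pmf_abs_le[OF h1]]
        second_moments[of i]
      by (intro integral_mono lin) auto
    also have "\<dots> \<le> D * (\<rho> ^ k)\<^sup>2 * (C2 * u $ i)"
      using offspring_second_moment_le[of i] by (simp add: D_def mult_left_mono divide_right_mono)
    finally have "\<bar>F (Suc k) $ i - (M *v F k) $ i\<bar> / \<rho> ^ Suc k \<le> D * (\<rho> ^ k)\<^sup>2 * (C2 * u $ i) / \<rho> ^ Suc k"
      using \<rho>_pos by (intro divide_right_mono) auto
    moreover have "b (Suc k) $ i - (M *v b k) $ i / \<rho> = (F (Suc k) $ i - (M *v F k) $ i) / \<rho> ^ Suc k"
      by (simp add: b_def matrix_vector_mult_scaleR scalar_mult_eq_scaleR diff_divide_distrib mult.commute)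
    moreover have "D * (\<rho> ^ k)\<^sup>2 * (C2 * u $ i) / \<rho> ^ Suc k = D * C2 / \<rho> * \<rho> ^ k * u $ i"
      using \<rho>_pos by (simp add: power2_eq_square)
    ultimately show "\<bar>b (Suc k) $ i - (M *v b k) $ i / \<rho>\<bar> \<le> D * C2 / \<rho> * \<rho> ^ k * u $ i"
      using \<rho>_pos by (simp add: abs_divide)
  next
    fix k i
    have "\<bar>F k $ i\<bar> \<le> \<rho> ^ k * u $ i / umin"
      using gw_functional_bound[OF h, of k "axis i 1"] survival_le[of k "axis i 1"] by (simp add: F_def)
    then show "\<bar>b k $ i\<bar> \<le> 1 / umin * u $ i"
      using \<rho>_pos by (simp add: b_def abs_mult field_simps)
  qed (use \<rho>_pos \<rho>_less in auto)
  then obtain L where L: "\<And>i. (\<lambda>k. b k $ i) \<longlonglongrightarrow> L * u $ i"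
    by blast
  have "(\<lambda>k. ?E k x / \<rho> ^ k) \<longlonglongrightarrow> L * wt x" for x
  proof -
    have "(\<lambda>k. vec_dot x (b k)) \<longlonglongrightarrow> (\<Sum>j\<in>UNIV. real (x $ j) * (L * u $ j))"
      unfolding vec_dot_def by (intro tendsto_sum tendsto_mult tendsto_const L)
    moreover have "(\<Sum>j\<in>UNIV. real (x $ j) * (L * u $ j)) = L * wt x"
      by (simp add: vec_dot_def sum_distrib_left mult_ac)
    moreover have "(\<lambda>k. ?E k x / \<rho> ^ k - vec_dot x (b k)) \<longlonglongrightarrow> 0"
    proof (rule Lim_null_comparison)
      show "\<forall>\<^sub>F k in sequentially. norm (?E k x / \<rho> ^ k - vec_dot x (b k)) \<le> D * (wt x)\<^sup>2 * \<rho> ^ k"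
      proof (intro always_eventually allI)
        fix k
        have "vec_dot x (b k) = vec_dot x (F k) / \<rho> ^ k"
          by (simp add: vec_dot_def b_def sum_divide_distrib)
        then have "norm (?E k x / \<rho> ^ k - vec_dot x (b k)) = \<bar>?E k x - vec_dot x (F k)\<bar> / \<rho> ^ k"
          using \<rho>_pos by (simp flip: diff_divide_distrib)
        also have "\<dots> \<le> D * (\<rho> ^ k)\<^sup>2 * (wt x)\<^sup>2 / \<rho> ^ k"
          using \<rho>_pos by (intro divide_right_mono lin) auto
        finally show "norm (?E k x / \<rho> ^ k - vec_dot x (b k)) \<le> D * (wt x)\<^sup>2 * \<rho> ^ k"
          using \<rho>_pos by (simp add: power2_eq_square mult_ac)
      qed
      have "(\<lambda>k. D * (wt x)\<^sup>2 * \<rho> ^ k) \<longlonglongrightarrow> D * (wt x)\<^sup>2 * 0"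
        using \<rho>_pos \<rho>_less by (intro tendsto_mult tendsto_const LIMSEQ_power_zero) auto
      then show "(\<lambda>k. D * (wt x)\<^sup>2 * \<rho> ^ k) \<longlonglongrightarrow> 0"
        by simp
    qed
    ultimately show ?thesis
      using tendsto_add by fastforce
  qed
  then show ?thesis
    by blast
qed

end

section \<open>Limit constants of a subcritical process and their total mass\<close>

context subcritical_gw
begin

text \<open>Convergence is the case \<open>h = alive\<close> of the general limit. Positivity of the
  constant comes from truncating the weight at \<open>K\<close>: large populations carry too little
  of the mean, so the rest must come from the event of survival.\<close>

lemma survival_tendsto:
  "\<exists>\<gamma>>0. \<forall>x. (\<lambda>k. (1 - pmf (gw p k x) 0) / \<rho> ^ k) \<longlonglongrightarrow> \<gamma> * wt x"
proof -
  obtain L where L: "\<And>x. (\<lambda>k. (1 - pmf (gw p k x) 0) / \<rho> ^ k) \<longlonglongrightarrow> L * wt x"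
    using gw_functional_tendsto[of alive] by (auto simp: survival_eq alive_def)
  define x :: "nat ^ 'd" where "x = axis undefined 1"
  have wx: "0 < wt x"
    using u_pos by (simp add: x_def)
  have A: "0 < A2 x"
    using wx \<rho>_pos \<rho>_less C2_nonneg by (simp add: A2_def add_pos_nonneg)
  \<comment> \<open>With this level the second moment term \<open>A2 x * \<rho> ^ k / K\<close> is
    exactly half of the mean \<rho>^k times \<open>wt x\<close>.\<close>
  define K where "K = 2 * A2 x / wt x"
  have K: "0 < K"
    using A wx by (simp add: K_def)
  have lower: "wt x / (2 * K) \<le> (1 - pmf (gw p k x) 0) / \<rho> ^ k" for k
  proof -
    have "wt y \<le> K * alive y + (wt y)\<^sup>2 / K" for y
    proof (cases "wt y \<le> K")
      case True
      then show ?thesis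
        using K by (cases "y = 0") (auto simp: alive_def intro: add_increasing2)
    next
      case False
      then have "wt y * K \<le> wt y * wt y"
        by (intro mult_left_mono) auto
      then have "wt y \<le> (wt y)\<^sup>2 / K"
        using K by (simp add: field_simps power2_eq_square)
      then show ?thesis
        using K by (simp add: alive_def add_increasing)
    qed
    then have "measure_pmf.expectation (gw p k x) wt \<le> measure_pmf.expectation (gw p k x) (\<lambda>y. K * alive y + (wt y)\<^sup>2 / K)"
      by (intro integral_mono gw_wt_mean Bochner_Integration.integrable_add integrable_mult_right integrable_divide gw_wt_square
          integrable_pmf_bounded[of alive 1]) (auto simp: alive_def)
    also have "\<dots> = K * measure_pmf.expectation (gw p k x) alive + measure_pmf.expectation (gw p k x) (\<lambda>y. (wt y)\<^sup>2) / K"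
    proof -
      have "integrable (gw p k x) alive"
        by (rule integrable_pmf_bounded[of _ 1]) (simp add: alive_def)
      then show ?thesis
        using gw_wt_square(1)[of k x] by simp
    qed
    also have "\<dots> \<le> K * (1 - pmf (gw p k x) 0) + A2 x * \<rho> ^ k / K"
      using K by (intro add_mono divide_right_mono gw_wt_square) (auto simp: survival_eq)
    finally have "\<rho> ^ k * wt x - A2 x * \<rho> ^ k / K \<le> K * (1 - pmf (gw p k x) 0)"
      by (simp add: gw_wt_mean)
    moreover have "A2 x * \<rho> ^ k / K = \<rho> ^ k * wt x / 2"
      using A wx by (simp add: K_def)
    ultimately have "\<rho> ^ k * wt x / 2 \<le> K * (1 - pmf (gw p k x) 0)"
      by linarith
    then show ?thesis
      using K \<rho>_pos by (simp add: field_simps)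
  qed
  have "wt x / (2 * K) \<le> L * wt x"
    by (rule LIMSEQ_le_const[OF L]) (auto intro: lower)
  moreover have "0 < wt x / (2 * K)"
    using wx K by simp
  ultimately have "0 < L * wt x"
    by linarith
  then have "0 < L"
    using wx by (simp add: zero_less_mult_iff)
  then show ?thesis
    using L by blast
qed

lemma pmf_gw_tendsto:
  assumes "z \<noteq> 0"
  shows "\<exists>g. \<forall>x. (\<lambda>k. pmf (gw p k x) z / \<rho> ^ k) \<longlonglongrightarrow> g * wt x"
proof -
  have "\<exists>g. \<forall>x. (\<lambda>k. measure_pmf.expectation (gw p k x) (indicator {z}) / \<rho> ^ k) \<longlonglongrightarrow> g * wt x"
    by (rule gw_functional_tendsto) (use assms in \<open>auto simp: alive_def indicator_def\<close>)
  then show ?thesis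
    by (simp add: measure_pmf_single)
qed

lemma expectation_finite_set:
  fixes f :: "'c \<Rightarrow> real"
  assumes "finite Z"
  shows "measure_pmf.expectation \<pi> (\<lambda>y. f y * indicator Z y) = (\<Sum>z\<in>Z. f z * pmf \<pi> z)"
  using assms by (subst integral_measure_pmf_real[of Z]) (auto simp: indicator_def intro!: sum.cong)

text \<open>Finite partial sums pass to the limit and stay below the total mean, so the mass is at
  most 1; the second moment bound excludes any loss at infinity.\<close>

lemma has_sum_wt_limit:
  assumes G: "\<And>z x. z \<noteq> 0 \<Longrightarrow> (\<lambda>k. pmf (gw p k x) z / \<rho> ^ k) \<longlonglongrightarrow> G z * wt x"
  shows "((\<lambda>z. wt z * G z) has_sum 1) (UNIV - {0})"
proof -
  define x :: "nat ^ 'd" where "x = axis undefined 1"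
  have wx: "0 < wt x"
    using u_pos by (simp add: x_def)
  have G_nonneg: "0 \<le> G z" if "z \<noteq> 0" for z
  proof -
    have "0 \<le> G z * wt x"
      by (rule LIMSEQ_le_const[OF G[OF that]]) (use \<rho>_pos in auto)
    then show ?thesis
      using wx by (simp add: zero_le_mult_iff)
  qed
  have lim: "(\<lambda>k. (\<Sum>z\<in>Z. wt z * pmf (gw p k x) z) / \<rho> ^ k) \<longlonglongrightarrow> (\<Sum>z\<in>Z. wt z * G z) * wt x"
    if "Z \<subseteq> UNIV - {0}" for Z
  proof -
    have "(\<lambda>k. \<Sum>z\<in>Z. wt z * (pmf (gw p k x) z / \<rho> ^ k)) \<longlonglongrightarrow> (\<Sum>z\<in>Z. wt z * (G z * wt x))"
      using that by (intro tendsto_sum tendsto_mult tendsto_const G) auto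
    then show ?thesis
      by (simp add: sum_divide_distrib sum_distrib_right mult.assoc)
  qed
  have i: "integrable (gw p k x) (\<lambda>y. wt y * indicator Z y)" for k Z
    by (rule Bochner_Integration.integrable_bound[OF gw_wt_mean(1)]) (auto simp: indicator_def)
  have upper: "(\<Sum>z\<in>Z. wt z * G z) \<le> 1" if Z: "finite Z" "Z \<subseteq> UNIV - {0}" for Z
  proof -
    have "(\<Sum>z\<in>Z. wt z * pmf (gw p k x) z) / \<rho> ^ k \<le> wt x" for k
    proof -
      have "(\<Sum>z\<in>Z. wt z * pmf (gw p k x) z) \<le> measure_pmf.expectation (gw p k x) wt"
        unfolding expectation_finite_set[OF Z(1), symmetric]
        by (intro integral_mono i gw_wt_mean) (auto simp: indicator_def)
      then show ?thesis
        using \<rho>_pos by (simp add: gw_wt_mean field_simps)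
    qed
    then have "(\<Sum>z\<in>Z. wt z * G z) * wt x \<le> wt x"
      by (intro LIMSEQ_le_const2[OF lim[OF Z(2)]]) auto
    then show ?thesis
      using wx by simp
  qed
  have summ: "(\<lambda>z. wt z * G z) summable_on (UNIV - {0})"
  proof (rule nonneg_bounded_partial_sums_imp_summable_on[where C = 1])
    show "\<forall>\<^sub>F Z in finite_subsets_at_top (UNIV - {0}). (\<Sum>z\<in>Z. wt z * G z) \<le> 1"
      by (rule eventually_finite_subsets_at_top_weakI) (rule upper)
  qed (use G_nonneg in auto)
  define S where "S = (\<Sum>\<^sub>\<infinity>z\<in>UNIV - {0}. wt z * G z)"
  have "S \<le> 1"
    unfolding S_def by (intro infsum_le_finite_sums summ upper)
  \<comment> \<open>Outside \<open>Z\<close> a nonempty population weighs more than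
    \<open>K\<close>, so the omitted part of the mean is at most the second moment divided by
    \<open>K\<close>. The level \<open>K = Suc n\<close> then tends to infinity.\<close>
  have "1 - A2 x / wt x / real (Suc n) \<le> S" for n
  proof -
    define K where "K = real (Suc n)"
    have K: "0 < K"
      by (simp add: K_def)
    define Z where "Z = {z. wt z \<le> K} - {0}"
    have Z: "finite Z" "Z \<subseteq> UNIV - {0}"
      unfolding Z_def using finite_vec_dot_le[of u K] u_pos by auto
    have "wt x - A2 x / K \<le> (\<Sum>z\<in>Z. wt z * pmf (gw p k x) z) / \<rho> ^ k" for k
    proof -
      have "measure_pmf.expectation (gw p k x) (\<lambda>y. wt y - (wt y)\<^sup>2 / K) \<le>
        measure_pmf.expectation (gw p k x) (\<lambda>y. wt y * indicator Z y)"
      proof (rule integral_mono)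
        show "integrable (gw p k x) (\<lambda>y. wt y - (wt y)\<^sup>2 / K)"
          by (intro Bochner_Integration.integrable_diff integrable_divide gw_wt_mean gw_wt_square)
        show "wt y - (wt y)\<^sup>2 / K \<le> wt y * indicator Z y" for y
        proof (cases "y \<in> Z \<or> y = 0")
          case True
          then show ?thesis
            using K by auto
        next
          case False
          then have "wt y * K \<le> wt y * wt y"
            by (intro mult_left_mono) (auto simp: Z_def)
          then have "wt y \<le> (wt y)\<^sup>2 / K"
            using K by (simp add: field_simps power2_eq_square)
          then show ?thesis
            using False by simp
        qed
      qed (rule i)
      also have "measure_pmf.expectation (gw p k x) (\<lambda>y. wt y - (wt y)\<^sup>2 / K) =
        \<rho> ^ k * wt x - measure_pmf.expectation (gw p k x) (\<lambda>y. (wt y)\<^sup>2) / K"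
        using gw_wt_mean[of k x] gw_wt_square(1)[of k x] by simp
      finally have "\<rho> ^ k * wt x - measure_pmf.expectation (gw p k x) (\<lambda>y. (wt y)\<^sup>2) / K \<le>
        (\<Sum>z\<in>Z. wt z * pmf (gw p k x) z)"
        by (simp add: expectation_finite_set[OF Z(1)])
      moreover have "measure_pmf.expectation (gw p k x) (\<lambda>y. (wt y)\<^sup>2) / K \<le> A2 x * \<rho> ^ k / K"
        using K by (intro divide_right_mono gw_wt_square) auto
      ultimately have "\<rho> ^ k * (wt x - A2 x / K) \<le> (\<Sum>z\<in>Z. wt z * pmf (gw p k x) z)"
        by (simp add: right_diff_distrib mult.commute)
      then show ?thesis
        using \<rho>_pos by (simp add: pos_le_divide_eq mult.commute)
    qed
    then have "wt x - A2 x / K \<le> (\<Sum>z\<in>Z. wt z * G z) * wt x"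
      by (intro LIMSEQ_le_const[OF lim[OF Z(2)]]) auto
    then have "1 - A2 x / wt x / K \<le> (\<Sum>z\<in>Z. wt z * G z)"
      using wx K by (simp add: field_simps)
    also have "\<dots> \<le> S"
      unfolding S_def using G_nonneg by (intro finite_sum_le_infsum summ Z) auto
    finally show ?thesis
      by (simp add: K_def)
  qed
  moreover have "(\<lambda>n. 1 - A2 x / wt x * inverse (real (Suc n))) \<longlonglongrightarrow> 1 - A2 x / wt x * 0"
    by (intro tendsto_intros LIMSEQ_inverse_real_of_nat)
  ultimately have "1 \<le> S"
    using LIMSEQ_le_const2[of "\<lambda>n. 1 - A2 x / wt x * inverse (real (Suc n))" 1 S] by (simp add: divide_inverse)
  with \<open>S \<le> 1\<close> have "S = 1"
    by simp
  then show ?thesis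
    using has_sum_infsum[OF summ] by (simp add: S_def)
qed

text \<open>Distributing \<rho>^(k+n) as \<rho>^k times \<rho>^n over the factors leaves three
  quantities, each with its own limit in \<open>k\<close>, in \<open>n\<close>, or in
  \<open>k + n\<close>.\<close>

lemma double_limit:
  assumes \<gamma>: "0 < \<gamma>" "\<And>x. (\<lambda>k. (1 - pmf (gw p k x) 0) / \<rho> ^ k) \<longlonglongrightarrow> \<gamma> * wt x"
    and g: "(\<lambda>k. pmf (gw p k x) z / \<rho> ^ k) \<longlonglongrightarrow> g * wt x" and x: "x \<noteq> 0"
  shows "((\<lambda>(n, k). pmf (gw p k x) z * (1 - pmf (gw p n z) 0) / (1 - pmf (gw p (k + n) x) 0))
    \<longlongrightarrow> wt z * g) (sequentially \<times>\<^sub>F sequentially)"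
proof -
  have wx: "0 < wt x"
    using vec_dot_pos_iff[of u x] u_pos x by simp
  have sum_lim: "filterlim (\<lambda>a. snd a + fst a :: nat) sequentially (sequentially \<times>\<^sub>F sequentially)"
    by (rule filterlim_at_top_mono[OF filterlim_snd]) auto
  have "((\<lambda>a. pmf (gw p (snd a) x) z / \<rho> ^ snd a * ((1 - pmf (gw p (fst a) z) 0) / \<rho> ^ fst a) /
      ((1 - pmf (gw p (snd a + fst a) x) 0) / \<rho> ^ (snd a + fst a)))
    \<longlongrightarrow> g * wt x * (\<gamma> * wt z) / (\<gamma> * wt x)) (sequentially \<times>\<^sub>F sequentially)"
    using wx \<gamma>(1)
    by (intro tendsto_divide tendsto_mult filterlim_compose[OF g filterlim_snd]
        filterlim_compose[OF \<gamma>(2) filterlim_fst] filterlim_compose[OF \<gamma>(2) sum_lim]) auto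
  also have "g * wt x * (\<gamma> * wt z) / (\<gamma> * wt x) = wt z * g"
    using wx \<gamma>(1) by simp
  also have "(\<lambda>a. pmf (gw p (snd a) x) z / \<rho> ^ snd a * ((1 - pmf (gw p (fst a) z) 0) / \<rho> ^ fst a) /
      ((1 - pmf (gw p (snd a + fst a) x) 0) / \<rho> ^ (snd a + fst a))) =
    (\<lambda>(n, k). pmf (gw p k x) z * (1 - pmf (gw p n z) 0) / (1 - pmf (gw p (k + n) x) 0))"
    using \<rho>_pos by (auto simp: fun_eq_iff power_add)
  finally show ?thesis .
qed

end

lemma yaglom_eqI:
  assumes "\<And>x. x \<noteq> 0 \<Longrightarrow> (\<lambda>k. \<P>(\<omega> in P x. X k \<omega> = z \<bar> X k \<omega> \<noteq> 0)) \<longlonglongrightarrow> l"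
  shows "yaglom P X z = l"
  unfolding yaglom_def
proof (rule the_equality)
  fix l' assume "\<forall>x. x \<noteq> 0 \<longrightarrow> (\<lambda>k. \<P>(\<omega> in P x. X k \<omega> = z \<bar> X k \<omega> \<noteq> 0)) \<longlonglongrightarrow> l'"
  \<comment> \<open>A nonempty starting state exists, so the condition under \<open>THE\<close> is
    not vacuous and uniqueness of limits applies.\<close>
  moreover have "axis undefined 1 \<noteq> (0 :: nat ^ 'a)"
    by (simp add: axis_eq_0_iff)
  ultimately show "l' = l"
    using assms LIMSEQ_unique by blast
qed (use assms in blast)

lemma subcritical_size_biased_limit:
  assumes GW: "galton_watson p P X" and "subcritical_gw p (mean_matrix P X) u \<rho>"
    and sum: "(\<Sum>i\<in>UNIV. u $ i) = 1" and x: "x \<noteq> 0"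
  shows "((\<lambda>(n, k). pmf (gw p k x) z * (1 - pmf (gw p n z) 0) / (1 - pmf (gw p (k + n) x) 0))
    \<longlongrightarrow> size_biased_yaglom P X z) (sequentially \<times>\<^sub>F sequentially)"
proof (cases "z = 0")
  \<comment> \<open>From the empty population survival has probability 0, so the whole expression
    vanishes.\<close>
  case True
  then show ?thesis
    by (simp add: size_biased_yaglom_def case_prod_unfold)
next
  case z: False
  interpret subcritical_gw p "mean_matrix P X" u \<rho>
    by fact
  obtain \<gamma> where \<gamma>: "0 < \<gamma>" "\<And>x. (\<lambda>k. (1 - pmf (gw p k x) 0) / \<rho> ^ k) \<longlonglongrightarrow> \<gamma> * wt x"
    using survival_tendsto by blast
  obtain G where G: "\<And>z x. z \<noteq> 0 \<Longrightarrow> (\<lambda>k. pmf (gw p k x) z / \<rho> ^ k) \<longlonglongrightarrow> G z * wt x"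
    using pmf_gw_tendsto by metis
  have u: "perron_right_eigenvector (mean_matrix P X) = u"
    by (rule perron_right_eigenvector_eqI[OF reg M_nonneg u_pos eig sum])
  have yag: "yaglom P X y = G y / \<gamma>" if y: "y \<noteq> 0" for y
  proof (rule yaglom_eqI)
    fix x :: "nat ^ 'a" assume "x \<noteq> 0"
    then have wx: "0 < wt x"
      using vec_dot_pos_iff[of u x] u_pos by simp
    have "(\<lambda>k. (pmf (gw p k x) y / \<rho> ^ k) / ((1 - pmf (gw p k x) 0) / \<rho> ^ k)) \<longlonglongrightarrow> G y * wt x / (\<gamma> * wt x)"
      using wx \<gamma>(1) by (intro tendsto_divide G[OF y] \<gamma>(2)) auto
    then show "(\<lambda>k. \<P>(\<omega> in P x. X k \<omega> = y \<bar> X k \<omega> \<noteq> 0)) \<longlonglongrightarrow> G y / \<gamma>"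
      unfolding cond_prob_gw_alive[OF GW y] using wx \<rho>_pos by simp
  qed
  \<comment> \<open>The total mass 1 of the weights \<open>wt y * G y\<close> makes the normalising
    sum equal to the reciprocal of \<gamma>, which cancels the same factor in the Yaglom weight of
    \<open>z\<close>.\<close>
  have "(\<Sum>\<^sub>\<infinity>y\<in>UNIV - {0}. wt y * yaglom P X y) = (\<Sum>\<^sub>\<infinity>y\<in>UNIV - {0}. wt y * G y * (1 / \<gamma>))"
    by (rule infsum_cong) (simp add: yag)
  also have "\<dots> = 1 / \<gamma>"
    using infsumI[OF has_sum_cmult_left[OF has_sum_wt_limit[OF G], of "1 / \<gamma>"]] by simp
  finally have "size_biased_yaglom P X z = wt z * G z"
    using z \<gamma>(1) by (simp add: size_biased_yaglom_def u yag)
  then show ?thesis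
    using double_limit[OF \<gamma> G[OF z] x] by simp
qed

section \<open>The associated process\<close>

lemma vec_power_one_plus_ge: "(\<And>j. 0 \<le> a $ j) \<Longrightarrow> 1 + vec_dot k a \<le> vec_power (1 + a) k"
proof (induction k rule: nat_vec_induct)
  case (step k i)
  have "1 + vec_dot (k + axis i 1) a \<le> (1 + vec_dot k a) * (1 + a $ i)"
    using step(2) vec_dot_nonneg[of a k] by (simp add: vec_dot_add algebra_simps)
  also have "\<dots> \<le> vec_power (1 + a) k * (1 + a $ i)"
    using step by (intro mult_right_mono) auto
  finally show ?case
    by (simp add: vec_power_add)
qed simp

text \<open>Equality case of Bernoulli's inequality: with at least two individuals, the product
  \<open>vec_dot x a * a $ i\<close> dropped in the induction is positive.\<close>

lemma vec_power_one_plus_eq_imp: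
  assumes a: "\<And>j. 0 < a $ j" and eq: "vec_power (1 + a) k = 1 + vec_dot k a"
  shows "k = 0 \<or> (\<exists>i. k = axis i 1)"
proof -
  have "k = 0 \<or> (\<exists>x i. k = x + axis i 1)"
    by (induction k rule: nat_vec_induct) auto
  moreover have "x = 0" if k: "k = x + axis i 1" for x i
  proof (rule ccontr)
    assume "x \<noteq> 0"
    then have "0 < vec_dot x a * a $ i"
      using vec_dot_pos_iff[of a x] a by simp
    then have "1 + vec_dot k a < (1 + vec_dot x a) * (1 + a $ i)"
      by (simp add: k vec_dot_add algebra_simps)
    also have "\<dots> \<le> vec_power (1 + a) x * (1 + a $ i)"
      using a by (intro mult_right_mono vec_power_one_plus_ge) (auto simp: less_imp_le add_nonneg_nonneg)
    finally show False
      using eq by (simp add: k vec_power_add)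
  qed
  ultimately show ?thesis
    by (metis add_0)
qed

lemma vec_power_inverse: "(\<And>j. q $ j \<noteq> 0) \<Longrightarrow> vec_power q k * vec_power (\<chi> j. 1 / q $ j) k = 1"
  unfolding vec_power_mult[symmetric] by (simp add: vec_power_def)

text \<open>Coordinatewise \<open>(1 - x) * (1 + x) \<le> 1\<close>, so Bernoulli's inequality for
  \<open>1 + x\<close> bounds \<open>vec_power (1 - x) k\<close> from above.\<close>

lemma one_minus_vec_power_ge:
  assumes "\<And>j. 0 \<le> x $ j" "\<And>j. x $ j \<le> 1"
  shows "vec_dot k x / (1 + vec_dot k x) \<le> 1 - vec_power (1 - x) k"
proof -
  have d: "0 \<le> vec_dot k x"
    using assms by (intro vec_dot_nonneg)
  have v: "0 \<le> vec_power (1 - x) k"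
    using assms by (intro vec_power_nonneg) simp
  have "vec_power (1 - x) k * (1 + vec_dot k x) \<le> vec_power (1 - x) k * vec_power (1 + x) k"
    using assms by (intro mult_left_mono vec_power_one_plus_ge v) auto
  also have "\<dots> = vec_power ((1 - x) * (1 + x)) k"
    by (simp add: vec_power_mult)
  also have "\<dots> \<le> 1"
    using assms by (intro vec_power_le_1) (auto simp: algebra_simps mult_le_one intro!: mult_le_one)
  finally have "vec_power (1 - x) k \<le> 1 / (1 + vec_dot k x)"
    using d by (simp add: field_simps)
  then show ?thesis
    using d by (simp add: field_simps)
qed

section \<open>Extinction in the supercritical case\<close>

text \<open>A point \<open>1 - t *s u\<close> inside the cube that \<open>gen_fun p\<close> does not
  increase lies, by monotonicity, above all iterates from 0 and hence above their limit. Such a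
  point exists close to 1 because mean weights grow by the factor \<rho> > 1.\<close>

lemma supercritical_extinction_prob_less_1:
  fixes p :: "'d::finite \<Rightarrow> (nat ^ 'd) pmf"
  assumes GW: "galton_watson p P X" and means: "finite_means P X"
    and u: "\<And>i. 0 < u $ i" and eig: "mean_matrix P X *v u = \<rho> *s u" and \<rho>: "1 < \<rho>"
  shows "extinction_prob P X $ i < 1"
proof -
  have int: "integrable (measure_pmf (p i)) (\<lambda>k. real (k $ j))" for i j
    using means finite_means_gw[OF GW] by simp
  note wt = vec_dot_mean[OF int, of _ u]
  have mean: "measure_pmf.expectation (p i) (\<lambda>k. vec_dot k u) = \<rho> * u $ i" for i
    using arg_cong[OF eig, of "\<lambda>v. v $ i"] by (simp add: wt mat_vec_nth mean_matrix_gw[OF GW])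
  have nn: "0 \<le> vec_dot k u" for k
    using u by (intro vec_dot_nonneg less_imp_le)
  \<comment> \<open>Mean offspring weight truncated at \<open>n\<close>. It tends to \<rho> times
    \<open>u $ i\<close>, so for large \<open>n\<close> it exceeds \<open>u $ i\<close> for all
    types at once.\<close>
  define c where "c n i = measure_pmf.expectation (p i) (\<lambda>k. vec_dot k u * indicator {k. vec_dot k u \<le> real n} k)" for n i
  have c_int: "integrable (measure_pmf (p i)) (\<lambda>k. vec_dot k u * indicator {k. vec_dot k u \<le> real n} k)" for n i
    by (rule Bochner_Integration.integrable_bound[OF wt(1)]) (auto simp: indicator_def)
  have "\<forall>\<^sub>F n in sequentially. u $ i < c n i" for i
  proof (rule order_tendstoD(1))
    show "(\<lambda>n. c n i) \<longlonglongrightarrow> \<rho> * u $ i"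
      unfolding c_def mean[of i, symmetric]
    proof (rule integral_dominated_convergence[OF _ _ wt(1)[of i]])
      show "AE k in p i. (\<lambda>n. vec_dot k u * indicator {k. vec_dot k u \<le> real n} k) \<longlonglongrightarrow> vec_dot k u"
      proof (intro AE_I2 tendsto_eventually)
        fix k
        show "\<forall>\<^sub>F n in sequentially. vec_dot k u * indicator {k. vec_dot k u \<le> real n} k = vec_dot k u"
          using eventually_ge_at_top[of "nat \<lceil>vec_dot k u\<rceil>"]
          by eventually_elim (auto simp: indicator_def; linarith)
      qed
    qed (auto simp: indicator_def nn)
    show "u $ i < \<rho> * u $ i"
      using u[of i] \<rho> by simp
  qed
  then have "\<forall>\<^sub>F n in sequentially. \<forall>i. u $ i < c n i"
    by (rule eventually_all_finite)
  then obtain n where n: "\<And>i. u $ i < c n i"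
    using eventually_happens'[OF sequentially_bot] by blast
  \<comment> \<open>On the truncated range the denominator \<open>1 + vec_dot k x\<close> is at most
    \<open>1 + t * real n\<close>. A small \<open>t\<close> keeps this loss below the surplus of
    \<open>c n i\<close> and keeps the point inside the cube.\<close>
  have "\<forall>\<^sub>F t in at_right 0. t * u $ i < 1 \<and> u $ i * (1 + t * real n) < c n i" for i
  proof (rule eventually_conj)
    have "((\<lambda>t. t * u $ i) \<longlongrightarrow> 0 * u $ i) (at_right 0)"
      by (intro tendsto_intros)
    then show "\<forall>\<^sub>F t in at_right 0. t * u $ i < 1"
      by (rule order_tendstoD(2)) simp
    have "((\<lambda>t. u $ i * (1 + t * real n)) \<longlongrightarrow> u $ i * (1 + 0 * real n)) (at_right 0)"
      by (intro tendsto_intros)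
    then show "\<forall>\<^sub>F t in at_right 0. u $ i * (1 + t * real n) < c n i"
      by (rule order_tendstoD(2)) (simp add: n)
  qed
  then have "\<forall>\<^sub>F t in at_right 0. \<forall>i. t * u $ i < 1 \<and> u $ i * (1 + t * real n) < c n i"
    by (rule eventually_all_finite)
  then have "\<forall>\<^sub>F t in at_right (0::real). 0 < t \<and> (\<forall>i. t * u $ i < 1 \<and> u $ i * (1 + t * real n) < c n i)"
    using eventually_at_right_less[of 0] by (auto elim: eventually_elim2)
  then obtain t where t: "0 < t" "\<And>i. t * u $ i < 1" "\<And>i. u $ i * (1 + t * real n) < c n i"
    using eventually_happens'[OF trivial_limit_at_right_real] by blast
  define x where "x = t *s u"
  have x: "0 < x $ i" "x $ i < 1" for i
    using t u by (auto simp: x_def)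
  have x_cube: "1 - x \<in> {0..1}"
    unfolding cube_iff using x by (auto simp: less_imp_le)
  have fx: "gen_fun p (1 - x) $ i \<le> (1 - x) $ i" for i
  proof -
    have "t * u $ i \<le> t * c n i / (1 + t * real n)"
    proof -
      have "0 < 1 + t * real n"
        using t(1) by (simp add: add_pos_nonneg)
      moreover have "t * (u $ i * (1 + t * real n)) \<le> t * c n i"
        using t(1) t(3)[of i] by (intro mult_left_mono) auto
      ultimately show ?thesis
        by (simp add: pos_le_divide_eq mult.assoc)
    qed
    also have "\<dots> = measure_pmf.expectation (p i)
      (\<lambda>k. t / (1 + t * real n) * (vec_dot k u * indicator {k. vec_dot k u \<le> real n} k))"
      by (simp add: c_def)
    also have "\<dots> \<le> measure_pmf.expectation (p i) (\<lambda>k. 1 - vec_power (1 - x) k)"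
    proof (rule integral_mono)
      show "t / (1 + t * real n) * (vec_dot k u * indicator {k. vec_dot k u \<le> real n} k) \<le> 1 - vec_power (1 - x) k" for k
      proof (cases "vec_dot k u \<le> real n")
        case True
        have tx: "vec_dot k x = t * vec_dot k u"
          by (simp add: vec_dot_def x_def sum_distrib_left mult_ac)
        have "t * vec_dot k u / (1 + t * real n) \<le> t * vec_dot k u / (1 + t * vec_dot k u)"
          using True t(1) nn[of k] by (intro divide_left_mono) (auto intro!: mult_pos_pos add_pos_nonneg)
        also have "\<dots> \<le> 1 - vec_power (1 - x) k"
          using one_minus_vec_power_ge[of x k] x by (simp add: tx less_imp_le)
        finally show ?thesis
          using True by simp
      next
        case False
        then show ?thesis
          using vec_power_cube(2)[OF x_cube] by simp
      qed
    qed (auto intro!: integrable_mult_right c_int integrable_vec_power x_cube simp del: atLeastAtMost_iff)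
    also have "\<dots> = 1 - gen_fun p (1 - x) $ i"
      using integrable_vec_power[OF x_cube, of "p i"] by (simp add: gen_fun_eq_pgf[OF x_cube] pgf_def)
    finally show ?thesis
      by (simp add: x_def)
  qed
  have "(gen_fun p ^^ m) 0 $ i \<le> (1 - x) $ i" for m i
  proof (induction m arbitrary: i)
    case 0
    show ?case
      using x by (simp add: less_imp_le)
  next
    case (Suc m)
    have "pgf (p i) ((gen_fun p ^^ m) 0) \<le> pgf (p i) (1 - x)"
      by (intro pgf_mono gen_fun_iterate_in_cube zero_in_cube x_cube Suc)
    then show ?case
      using fx[of i] by (simp add: gen_fun_eq_pgf[OF gen_fun_iterate_in_cube[OF zero_in_cube]] gen_fun_eq_pgf[OF x_cube])
  qed
  then have "extinction_prob P X $ i \<le> (1 - x) $ i"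
    by (intro LIMSEQ_le_const2[OF gen_fun_iterate_tendsto[OF GW]]) auto
  then show ?thesis
    using x[of i] by simp
qed

section \<open>Change of measure to the associated process\<close>

context
  fixes p pa :: "'d::finite \<Rightarrow> (nat ^ 'd) pmf" and q :: "real ^ 'd"
  assumes q_cube: "q \<in> {0..1}" and q_pos: "\<And>i. 0 < q $ i" and q_fix: "gen_fun p q = q"
    and gen_fun_pa: "\<forall>r\<in>{0..1}. \<forall>i. gen_fun pa r $ i = gen_fun p (q * r) $ i / q $ i"
begin

text \<open>Multiplication by \<open>q\<close> conjugates \<open>gen_fun pa\<close> with
  \<open>gen_fun p\<close>, hence also their iterates.\<close>

lemma gen_fun_associated_iterate:
  "r \<in> {0..1} \<Longrightarrow> (gen_fun p ^^ n) (q * r) = q * (gen_fun pa ^^ n) r"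
proof (induction n)
  case (Suc n)
  have "gen_fun p (q * (gen_fun pa ^^ n) r) = q * gen_fun pa ((gen_fun pa ^^ n) r)"
    using bspec[OF gen_fun_pa gen_fun_iterate_in_cube[OF Suc.prems]] q_pos by (simp add: vec_eq_iff less_imp_neq[symmetric])
  then show ?case
    using Suc by simp
qed simp

text \<open>Coefficientwise form of the conjugacy. It exhibits the associated chain as the Doob
  transform by \<open>vec_power q\<close>, a harmonic function because \<open>q\<close> is a fixed
  point.\<close>

lemma pmf_gw_associated: "pmf (gw p n x) z * vec_power q z = vec_power q x * pmf (gw pa n x) z"
proof (rule pmf_eqI_pgf_scaled[OF q_cube])
  fix r :: "real ^ 'd" assume r: "r \<in> {0..1}"
  then have "q * r \<in> {0..1}"
    using q_cube unfolding cube_iff by (simp add: mult_le_one)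
  then show "pgf (gw p n x) (q * r) = vec_power q x * pgf (gw pa n x) r"
    by (simp only: pgf_gw r gen_fun_associated_iterate vec_power_mult)
qed

text \<open>The transform at \<open>z\<close> and at 0 leaves a common factor
  \<open>vec_power q x\<close> above and below, which cancels.\<close>

lemma associated_ratio:
  "pmf (gw p k x) z * (vec_power q z - pmf (gw p n z) 0) / (vec_power q x - pmf (gw p m x) 0) =
   pmf (gw pa k x) z * (1 - pmf (gw pa n z) 0) / (1 - pmf (gw pa m x) 0)"
proof -
  have qx: "0 < vec_power q y" for y
    by (rule vec_power_pos[OF q_pos])
  have 0: "pmf (gw p m y) 0 = vec_power q y * pmf (gw pa m y) 0" for m y
    using pmf_gw_associated[of m y 0] by simp
  have "pmf (gw p k x) z * (vec_power q z - pmf (gw p n z) 0) =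
    vec_power q x * (pmf (gw pa k x) z * (1 - pmf (gw pa n z) 0))"
  proof -
    have "pmf (gw p k x) z * (vec_power q z - pmf (gw p n z) 0) =
      (pmf (gw p k x) z * vec_power q z) * (1 - pmf (gw pa n z) 0)"
      by (simp add: 0 algebra_simps)
    then show ?thesis
      by (simp add: pmf_gw_associated)
  qed
  moreover have "vec_power q x - pmf (gw p m x) 0 = vec_power q x * (1 - pmf (gw pa m x) 0)"
    unfolding 0 by (simp add: algebra_simps)
  ultimately show ?thesis
    using qx[of x] by simp
qed

lemma pmf_offspring_associated: "pmf (pa i) z = vec_power q z / q $ i * pmf (p i) z"
proof -
  have "pmf (p i) z * vec_power q z = q $ i * pmf (pa i) z"
    using pmf_gw_associated[of 1 "axis i 1" z] by (simp only: gw_one next_generation_axis vec_power_axis)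
  then show ?thesis
    using q_pos[of i] by (simp add: field_simps)
qed

lemma measure_pmf_associated:
  "measure_pmf (pa i) = density (measure_pmf (p i)) (\<lambda>k. ennreal (vec_power q k / q $ i))"
proof (rule measure_eqI_countable[where A = UNIV])
  fix k
  have "emeasure (density (measure_pmf (p i)) (\<lambda>k. ennreal (vec_power q k / q $ i))) {k} =
    ennreal (vec_power q k / q $ i) * ennreal (pmf (p i) k)"
    by (simp add: emeasure_density nn_integral_indicator_singleton emeasure_pmf_single)
  then show "emeasure (measure_pmf (pa i)) {k} =
    emeasure (density (measure_pmf (p i)) (\<lambda>k. ennreal (vec_power q k / q $ i))) {k}"
    using vec_power_cube(1)[OF q_cube, of k] q_pos[of i]
    by (simp add: emeasure_pmf_single pmf_offspring_associated flip: ennreal_mult)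
qed auto

lemma associated_integral:
  fixes f :: "nat ^ 'd \<Rightarrow> real"
  shows "integrable (pa i) f \<longleftrightarrow> integrable (p i) (\<lambda>k. vec_power q k / q $ i * f k)"
    and "measure_pmf.expectation (pa i) f = measure_pmf.expectation (p i) (\<lambda>k. vec_power q k / q $ i * f k)"
proof -
  have "AE k in p i. 0 \<le> vec_power q k / q $ i"
    using vec_power_cube(1)[OF q_cube] q_pos[of i] by (simp add: less_imp_le)
  then show "integrable (pa i) f \<longleftrightarrow> integrable (p i) (\<lambda>k. vec_power q k / q $ i * f k)"
    and "measure_pmf.expectation (pa i) f = measure_pmf.expectation (p i) (\<lambda>k. vec_power q k / q $ i * f k)"
    unfolding measure_pmf_associated by (intro integrable_real_density integral_real_density; simp)+
qed

lemma associated_integrable: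
  fixes f :: "nat ^ 'd \<Rightarrow> real"
  assumes "integrable (p i) f"
  shows "integrable (pa i) f"
  unfolding associated_integral
proof (rule Bochner_Integration.integrable_bound)
  show "integrable (p i) (\<lambda>k. 1 / q $ i * f k)"
    using assms by simp
  show "AE k in p i. norm (vec_power q k / q $ i * f k) \<le> norm (1 / q $ i * f k)"
    using vec_power_cube[OF q_cube] q_pos[of i]
    by (auto simp: abs_mult intro!: AE_I2 divide_right_mono mult_left_le_one_le)
qed simp

text \<open>The density of \<open>pa i\<close> with respect to \<open>p i\<close> is strictly
  positive, so a nonnegative variable that vanishes almost surely under one law does so under the
  other.\<close>

lemma associated_mean_pos:
  assumes int: "integrable (p i) (\<lambda>k. real (k $ j))"
    and pos: "0 < measure_pmf.expectation (p i) (\<lambda>k. real (k $ j))"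
  shows "0 < measure_pmf.expectation (pa i) (\<lambda>k. real (k $ j))"
proof (rule ccontr)
  assume "\<not> 0 < measure_pmf.expectation (pa i) (\<lambda>k. real (k $ j))"
  moreover have "0 \<le> measure_pmf.expectation (pa i) (\<lambda>k. real (k $ j))"
    by (rule Bochner_Integration.integral_nonneg) simp
  ultimately have "measure_pmf.expectation (pa i) (\<lambda>k. real (k $ j)) = 0"
    by linarith
  then have "measure_pmf.expectation (p i) (\<lambda>k. vec_power q k / q $ i * real (k $ j)) = 0"
    by (simp only: associated_integral(2))
  moreover have "integrable (p i) (\<lambda>k. vec_power q k / q $ i * real (k $ j))"
    using associated_integrable[OF int] by (simp only: associated_integral(1))
  moreover have "AE k in p i. 0 \<le> vec_power q k / q $ i * real (k $ j)"
    using vec_power_cube(1)[OF q_cube] q_pos[of i] by (simp add: less_imp_le)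
  ultimately have "AE k in p i. vec_power q k / q $ i * real (k $ j) = 0"
    using integral_nonneg_eq_0_iff_AE by blast
  then have "AE k in p i. real (k $ j) = 0"
    using vec_power_pos[OF q_pos] q_pos[of i] by (simp add: less_imp_neq[symmetric])
  then have "measure_pmf.expectation (p i) (\<lambda>k. real (k $ j)) = measure_pmf.expectation (p i) (\<lambda>k. 0)"
    by (intro integral_cong_AE) auto
  then show False
    using pos by simp
qed

text \<open>
  Exponential weights beat quadratic growth, by Bernoulli's inequality for the square roots of \<open>1 / q\<close>.
\<close>

lemma associated_second_moment:
  assumes q_less: "\<And>i. q $ i < 1" and w: "\<And>i. 0 < w $ i"
  shows "integrable (pa i) (\<lambda>k. (vec_dot k w)\<^sup>2)"
proof -
  define a where "a = (\<chi> j. sqrt (1 / q $ j) - 1)"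
  have a: "0 < a $ j" for j
    using q_pos[of j] q_less[of j] by (simp add: a_def)
  obtain l where l: "\<And>j. w $ j \<le> w $ l / a $ l * a $ j"
    using ex_max_ratio[of "\<lambda>j. a $ j" "\<lambda>j. w $ j"] a by blast
  \<comment> \<open>The largest ratio of \<open>w\<close> to \<open>a\<close>, so that
    \<open>vec_dot k w \<le> B * vec_dot k a\<close>.\<close>
  define B where "B = w $ l / a $ l"
  have "vec_power q k * (vec_dot k w)\<^sup>2 \<le> B\<^sup>2" for k
  proof -
    have "vec_dot k w \<le> (\<Sum>j\<in>UNIV. real (k $ j) * (B * a $ j))"
      unfolding vec_dot_def using l by (intro sum_mono mult_left_mono) (auto simp: B_def)
    also have "\<dots> = B * vec_dot k a"
      by (simp add: vec_dot_def sum_distrib_left mult_ac)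
    also have "\<dots> \<le> B * vec_power (1 + a) k"
      using vec_power_one_plus_ge[of a k] a w[of l] by (intro mult_left_mono) (auto simp: B_def less_imp_le)
    finally have "(vec_dot k w)\<^sup>2 \<le> (B * vec_power (1 + a) k)\<^sup>2"
      using w by (intro power_mono vec_dot_nonneg) (auto simp: less_imp_le)
    also have "\<dots> = B\<^sup>2 * vec_power ((1 + a) * (1 + a)) k"
      by (simp add: power_mult_distrib vec_power_mult power2_eq_square)
    also have "(1 + a) * (1 + a) = (\<chi> j. 1 / q $ j)"
      using q_pos by (simp add: vec_eq_iff a_def less_imp_le)
    finally have "vec_power q k * (vec_dot k w)\<^sup>2 \<le> vec_power q k * (B\<^sup>2 * vec_power (\<chi> j. 1 / q $ j) k)"
      using vec_power_cube(1)[OF q_cube] by (intro mult_left_mono) auto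
    also have "\<dots> = B\<^sup>2 * (vec_power q k * vec_power (\<chi> j. 1 / q $ j) k)"
      by (simp add: mult_ac)
    also have "vec_power q k * vec_power (\<chi> j. 1 / q $ j) k = 1"
      using q_pos by (intro vec_power_inverse) (auto simp: less_imp_neq[symmetric])
    finally show ?thesis
      by simp
  qed
  then have "\<bar>vec_power q k / q $ i * (vec_dot k w)\<^sup>2\<bar> \<le> B\<^sup>2 / q $ i" for k
    using q_pos[of i] vec_power_cube(1)[OF q_cube, of k] by (simp add: abs_mult divide_right_mono)
  then show ?thesis
    unfolding associated_integral by (rule integrable_pmf_bounded)
qed

text \<open>
  With \<open>a = 1 / q - 1\<close>, Bernoulli's inequality gives \<open>Ma a \<le> a\<close>, and equality would force every
  individual to have at most one child.
\<close>

lemma associated_mean_matrix_strict: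
  fixes M Ma :: "real ^ 'd ^ 'd" and u :: "real ^ 'd"
  assumes q_less: "\<And>i. q $ i < 1"
    and int: "\<And>i j. integrable (p i) (\<lambda>k. real (k $ j))"
    and M: "\<And>i j. M $ i $ j = measure_pmf.expectation (p i) (\<lambda>k. real (k $ j))"
    and Ma: "\<And>i j. Ma $ i $ j = measure_pmf.expectation (pa i) (\<lambda>k. real (k $ j))"
    and u: "\<And>i. 0 < u $ i" and eig: "M *v u = \<rho> *s u" and \<rho>: "1 < \<rho>"
  defines "a \<equiv> \<chi> j. 1 / q $ j - 1"
  shows "(Ma *v a) $ i \<le> a $ i" and "Ma *v a \<noteq> a"
proof -
  have a: "0 < a $ j" for j
    using q_pos[of j] q_less[of j] by (simp add: a_def)
  have "1 + a = (\<chi> j. 1 / q $ j)"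
    by (simp add: a_def vec_eq_iff)
  then have inv: "vec_power q k * vec_power (1 + a) k = 1" for k
    using vec_power_inverse[of q k] q_pos by (simp add: less_imp_neq[symmetric])
  have Bern: "vec_power q k * (1 + vec_dot k a) \<le> 1" for k
  proof -
    have "vec_power q k * (1 + vec_dot k a) \<le> vec_power q k * vec_power (1 + a) k"
      using a vec_power_cube(1)[OF q_cube] by (intro mult_left_mono vec_power_one_plus_ge) (auto simp: less_imp_le)
    then show ?thesis
      by (simp add: inv)
  qed
  have dot_int: "integrable (p i) (\<lambda>k. vec_power q k / q $ i * vec_dot k a)" for i
    using associated_integrable[OF vec_dot_mean(1)[OF int]] by (simp only: associated_integral(1))
  have dot_int': "integrable (p i) (\<lambda>k. vec_power q k * vec_dot k a)" for i
    using integrable_mult_right[OF dot_int[of i], of "q $ i"] q_pos[of i] by (simp add: less_imp_neq[symmetric])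
  have gap_int: "integrable (p i) (\<lambda>k. 1 - vec_power q k * (1 + vec_dot k a))" for i
    using dot_int'[of i] integrable_vec_power[OF q_cube, of "p i"] by (simp add: distrib_left)
  \<comment> \<open>The expected defect in Bernoulli's inequality is \<open>q $ i\<close> times the
    deficit of row \<open>i\<close>: the density converts \<open>Ma *v a\<close>, the fixed point
    gives the mean of \<open>vec_power q\<close>, and
    \<open>q $ i * a $ i = 1 - q $ i\<close>.\<close>
  have gap: "measure_pmf.expectation (p i) (\<lambda>k. 1 - vec_power q k * (1 + vec_dot k a)) = q $ i * (a $ i - (Ma *v a) $ i)" for i
  proof -
    have "(Ma *v a) $ i = measure_pmf.expectation (pa i) (\<lambda>k. vec_dot k a)"
      by (simp add: mat_vec_nth Ma vec_dot_mean(2)[OF associated_integrable[OF int]])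
    also have "\<dots> = measure_pmf.expectation (p i) (\<lambda>k. vec_power q k * vec_dot k a) / q $ i"
      by (simp add: associated_integral(2))
    finally have "measure_pmf.expectation (p i) (\<lambda>k. vec_power q k * vec_dot k a) = q $ i * (Ma *v a) $ i"
      using q_pos[of i] by (simp add: field_simps)
    moreover have "measure_pmf.expectation (p i) (vec_power q) = q $ i"
      using gen_fun_eq_pgf[OF q_cube, of p i] q_fix by (simp add: pgf_def)
    moreover have "q $ i * a $ i = 1 - q $ i"
      using q_pos[of i] by (simp add: a_def right_diff_distrib)
    ultimately show ?thesis
      using dot_int'[of i] integrable_vec_power[OF q_cube, of "p i"] by (simp add: distrib_left right_diff_distrib)
  qed
  show "(Ma *v a) $ i \<le> a $ i"
  proof -
    have "0 \<le> measure_pmf.expectation (p i) (\<lambda>k. 1 - vec_power q k * (1 + vec_dot k a))"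
      using Bern by (intro Bochner_Integration.integral_nonneg) auto
    then show ?thesis
      unfolding gap using q_pos[of i] by (simp add: zero_le_mult_iff)
  qed
  show "Ma *v a \<noteq> a"
  proof
    assume eq: "Ma *v a = a"
    \<comment> \<open>Without deficit, the nonnegative defect vanishes almost surely. The equality
      case then leaves at most one child.\<close>
    have row: "(\<Sum>j\<in>UNIV. M $ i $ j) \<le> 1" for i
    proof -
      have "AE k in p i. 1 - vec_power q k * (1 + vec_dot k a) = 0"
        using gap[of i] Bern gap_int[of i] by (subst integral_nonneg_eq_0_iff_AE[symmetric]) (auto simp: eq)
      then have ae: "AE k in p i. vec_dot k 1 \<le> 1"
      proof eventually_elim
        case (elim k)
        have "vec_power (1 + a) k = vec_power (1 + a) k * (vec_power q k * (1 + vec_dot k a))"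
          using elim by simp
        also have "\<dots> = 1 + vec_dot k a"
          using inv[of k] by (simp add: mult.assoc[symmetric] mult.commute)
        finally have "k = 0 \<or> (\<exists>i. k = axis i 1)"
          by (rule vec_power_one_plus_eq_imp[OF a])
        then show ?case
          by auto
      qed
      have "(\<Sum>j\<in>UNIV. M $ i $ j) = measure_pmf.expectation (p i) (\<lambda>k. vec_dot k 1)"
        by (simp add: vec_dot_mean(2)[OF int] M)
      also have "\<dots> \<le> measure_pmf.expectation (p i) (\<lambda>k. 1)"
        by (intro integral_mono_AE vec_dot_mean(1)[OF int] ae) auto
      finally show ?thesis
        by simp
    qed
    \<comment> \<open>The row at which \<open>u\<close> is largest turns row sums of at most 1 into
      an eigenvalue of at most 1, against \<rho> > 1.\<close>
    obtain l where l: "\<And>j. u $ j \<le> u $ l / 1 * 1"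
      using ex_max_ratio[of "\<lambda>_. 1" "\<lambda>j. u $ j"] by auto
    have "\<rho> * u $ l = (\<Sum>j\<in>UNIV. M $ l $ j * u $ j)"
      using arg_cong[OF eig, of "\<lambda>v. v $ l"] by (simp add: mat_vec_nth)
    also have "\<dots> \<le> (\<Sum>j\<in>UNIV. M $ l $ j * u $ l)"
      using l by (intro sum_mono mult_left_mono) (auto simp: M intro!: Bochner_Integration.integral_nonneg)
    also have "\<dots> = (\<Sum>j\<in>UNIV. M $ l $ j) * u $ l"
      by (simp add: sum_distrib_right)
    also have "\<dots> \<le> 1 * u $ l"
      using row u[of l] by (intro mult_right_mono) auto
    finally show False
      using u[of l] \<rho> by simp
  qed
qed

end

lemma mat_pow_commute: "mat_pow M n *v (M *v x) = M *v (mat_pow M n *v x)"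
  by (induction n) (simp_all add: mat_pow_vec_Suc)

text \<open>A positive power of \<open>M\<close> applied to \<open>a\<close> makes the inequality
  strict in every coordinate. At the contact point of \<open>u\<close> with a multiple of the
  resulting vector \<open>c\<close>, this forces \<rho> < 1.\<close>

lemma perron_eigenvalue_less_1:
  fixes M :: "real ^ 'd ^ 'd::finite"
  assumes reg: "positive_regular M" and nonneg: "\<And>i j. 0 \<le> M $ i $ j"
    and u: "\<And>i. 0 < u $ i" and eig: "M *v u = \<rho> *s u"
    and a: "\<And>i. 0 < a $ i" and le: "\<And>i. (M *v a) $ i \<le> a $ i" and neq: "M *v a \<noteq> a"
  shows "\<rho> < 1"
proof -
  obtain N where N: "N \<ge> 1" "\<And>i j. 0 < mat_pow M N $ i $ j"
    using reg unfolding positive_regular_iff by blast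
  define c where "c = mat_pow M N *v a"
  have c: "0 < c $ i" for i
    unfolding c_def using a by (intro positive_mat_vec_pos N) (auto simp: less_imp_le vec_eq_iff less_imp_neq[symmetric])
  have Mc: "(M *v c) $ i < c $ i" for i
  proof -
    have "0 < (mat_pow M N *v (a - M *v a)) $ i"
      using le neq by (intro positive_mat_vec_pos N) auto
    then show ?thesis
      by (simp add: c_def matrix_vector_mult_diff_distrib mat_pow_commute)
  qed
  obtain i where i: "\<And>j. u $ j \<le> u $ i / c $ i * c $ j"
    using ex_max_ratio[of "\<lambda>j. c $ j" "\<lambda>j. u $ j"] c by blast
  have "\<rho> * u $ i = (M *v u) $ i"
    by (simp add: eig)
  also have "\<dots> \<le> (M *v ((u $ i / c $ i) *s c)) $ i"
    using i by (intro mat_vec_mono nonneg) simp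
  also have "\<dots> = u $ i / c $ i * (M *v c) $ i"
    by (simp add: matrix_vector_mult_scaleR scalar_mult_eq_scaleR)
  also have "\<dots> < u $ i / c $ i * c $ i"
    using u[of i] c[of i] Mc[of i] by (intro mult_strict_left_mono) auto
  also have "\<dots> = u $ i"
    using c[of i] by simp
  finally show ?thesis
    using u[of i] by simp
qed

text \<open>A raw product of coordinates is the centred product plus terms of degree at most one,
  which are integrable.\<close>

lemma finite_covariance_second_moment:
  assumes cov: "finite_covariance \<pi>" and int: "\<And>j. integrable \<pi> (\<lambda>k. real (k $ j))"
  shows "integrable \<pi> (\<lambda>k. (vec_dot k w)\<^sup>2)"
proof -
  have "integrable \<pi> (\<lambda>k. real (k $ j) * real (k $ l))" for j l
  proof -
    define m where "m j = measure_pmf.expectation \<pi> (\<lambda>k. real (k $ j))" for j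
    have "integrable \<pi> (\<lambda>k. centred_product \<pi> j l k + (m l * real (k $ j) + (m j * real (k $ l) - m j * m l)))"
      using cov int by (intro Bochner_Integration.integrable_add Bochner_Integration.integrable_diff integrable_mult_right)
        (auto simp: finite_covariance_def)
    then show ?thesis
      by (simp add: centred_product_def algebra_simps flip: m_def)
  qed
  then have "integrable \<pi> (\<lambda>k. \<Sum>j\<in>UNIV. \<Sum>l\<in>UNIV. w $ j * w $ l * (real (k $ j) * real (k $ l)))"
    by (intro Bochner_Integration.integrable_sum integrable_mult_right)
  then show ?thesis
    by (simp add: vec_dot_def power2_eq_square sum_product mult_ac)
qed

section \<open>The double limit under survival and eventual extinction\<close>

theorem theorem2:
  fixes p :: "'d::finite \<Rightarrow> (nat ^ 'd) pmf"
    and P :: "nat ^ 'd \<Rightarrow> 'a measure" and X :: "nat \<Rightarrow> 'a \<Rightarrow> nat ^ 'd"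
    and Pa :: "nat ^ 'd \<Rightarrow> 'b measure" and Xa :: "nat \<Rightarrow> 'b \<Rightarrow> nat ^ 'd"
    and x0 z :: "nat ^ 'd"
  assumes "galton_watson p P X"
    and "assumption_A1 p P X"
    and "perron_root (mean_matrix P X) \<noteq> 1"
    and "perron_root (mean_matrix P X) < 1 \<Longrightarrow> \<forall>i. finite_covariance (p i)"
    and "associated_process p (extinction_prob P X) Pa Xa"
    and "x0 \<noteq> 0"
  shows "((\<lambda>(n, k). \<P>(\<omega> in P x0. X k \<omega> = z \<bar> X (k + n) \<omega> \<noteq> 0 \<and> extinction_time X \<omega> < \<infinity>))
           \<longlongrightarrow> size_biased_yaglom Pa Xa z) (sequentially \<times>\<^sub>F sequentially)"
proof -
  note GW = assms(1)
  define q where "q = extinction_prob P X"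
  define M where "M = mean_matrix P X"
  define Ma where "Ma = mean_matrix Pa Xa"
  have means: "finite_means P X" and M_reg: "positive_regular M" and q_pos: "\<And>i. 0 < q $ i"
    using assms(2) by (auto simp: assumption_A1_def M_def q_def)
  have q_cube: "q \<in> {0..1}" and q_fix: "gen_fun p q = q"
    unfolding q_def by (rule extinction_prob_in_cube[OF GW], rule gen_fun_extinction_prob[OF GW])
  obtain pa where GWa: "galton_watson pa Pa Xa"
    and gen: "\<forall>r\<in>{0..1}. \<forall>i. gen_fun pa r $ i = gen_fun p (q * r) $ i / q $ i"
    using assms(5) q_fix unfolding associated_process_def q_def[symmetric] by auto
  note assoc = q_cube q_pos q_fix gen
  have M: "M $ i $ j = measure_pmf.expectation (p i) (\<lambda>k. real (k $ j))" for i j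
    unfolding M_def by (rule mean_matrix_gw[OF GW])
  have Ma: "Ma $ i $ j = measure_pmf.expectation (pa i) (\<lambda>k. real (k $ j))" for i j
    unfolding Ma_def by (rule mean_matrix_gw[OF GWa])
  have int: "integrable (p i) (\<lambda>k. real (k $ j))" for i j
    using means finite_means_gw[OF GW] by simp
  have int_a: "integrable (pa i) (\<lambda>k. real (k $ j))" for i j
    by (rule associated_integrable[OF assoc int])
  have M_nonneg: "0 \<le> M $ i $ j" and Ma_nonneg: "0 \<le> Ma $ i $ j" for i j
    by (auto simp: M Ma intro!: Bochner_Integration.integral_nonneg)
  obtain u \<rho> where \<rho>: "0 < \<rho>" and u: "\<And>i. 0 < u $ i" and eig: "M *v u = \<rho> *s u" and u_sum: "(\<Sum>i\<in>UNIV. u $ i) = 1"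
    using perron_frobenius_exists[OF M_reg M_nonneg] by blast
  have root: "perron_root M = \<rho>"
    by (rule perron_root_eqI[OF M_nonneg u eig])
  \<comment> \<open>Both regimes are reduced to this: the associated law is subcritical with finite
    second moments, and \<open>v\<close>, \<sigma> are its Perron data.\<close>
  have "\<exists>v \<sigma>. subcritical_gw pa Ma v \<sigma> \<and> (\<Sum>i\<in>UNIV. v $ i) = 1"
  proof (cases "\<rho> < 1")
    case True
    then have "finite_covariance (p i)" for i
      using assms(4) root by (simp add: M_def)
    then have sub: "subcritical_gw p M u \<rho>"
      by (unfold_locales) (auto intro: int M M_reg u eig \<rho> True finite_covariance_second_moment)
    interpret subcritical_gw p M u \<rho>
      by (rule sub)
    \<comment> \<open>Starting from one individual, survival to time \<open>n\<close> has
      probability of order \<rho>^n, so extinction is certain.\<close>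
    have "q $ i = 1" for i
    proof (rule LIMSEQ_unique)
      show "(\<lambda>n. pmf (gw p n (axis i 1)) 0) \<longlonglongrightarrow> q $ i"
        using pmf_gw_0_tendsto[OF GW, of "axis i 1"] by (simp add: q_def)
      show "(\<lambda>n. pmf (gw p n (axis i 1)) 0) \<longlonglongrightarrow> 1"
      proof (rule tendsto_sandwich[OF _ _ _ tendsto_const])
        show "\<forall>\<^sub>F n in sequentially. 1 - \<rho> ^ n * vec_dot (axis i 1) u / umin \<le> pmf (gw p n (axis i 1)) 0"
          using survival_le[of _ "axis i 1"] unfolding survival_eq by (simp add: algebra_simps)
        have "(\<lambda>n. 1 - \<rho> ^ n * vec_dot (axis i 1) u / umin) \<longlonglongrightarrow> 1 - 0 * vec_dot (axis i 1) u / umin"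
          using \<rho> True umin_pos by (intro tendsto_intros LIMSEQ_power_zero) auto
        then show "(\<lambda>n. 1 - \<rho> ^ n * vec_dot (axis i 1) u / umin) \<longlonglongrightarrow> 1"
          by simp
      qed (simp add: pmf_le_1)
    qed
    then have "q = 1"
      by (simp add: vec_eq_iff)
    \<comment> \<open>At \<open>q = 1\<close> the density is constant 1, so the associated law is
      the original one and inherits its second moments from the covariance assumption.\<close>
    have "pa = p"
    proof
      show "pa i = p i" for i
      proof (rule pmf_eqI)
        show "pmf (pa i) y = pmf (p i) y" for y
          using pmf_offspring_associated[OF assoc, of i y] by (simp add: \<open>q = 1\<close>)
      qed
    qed
    then have "Ma = M"
      by (simp add: vec_eq_iff M Ma)
    then show ?thesis
      using sub u_sum \<open>pa = p\<close> by blast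
  next
    case False
    then have \<rho>1: "1 < \<rho>"
      using assms(3) root by (simp add: M_def)
    have q_less: "q $ i < 1" for i
      unfolding q_def by (rule supercritical_extinction_prob_less_1[OF GW means u eig[unfolded M_def] \<rho>1])
    \<comment> \<open>The tilted means have the same positive entries as the original ones.\<close>
    have Ma_reg: "positive_regular Ma"
      by (rule positive_regular_mono[OF M_reg M_nonneg Ma_nonneg])
         (use associated_mean_pos[OF assoc int] in \<open>simp add: M Ma\<close>)
    obtain v \<sigma> where \<sigma>: "0 < \<sigma>" and v: "\<And>i. 0 < v $ i" and eig_a: "Ma *v v = \<sigma> *s v" and v_sum: "(\<Sum>i\<in>UNIV. v $ i) = 1"
      using perron_frobenius_exists[OF Ma_reg Ma_nonneg] by blast
    note strict = associated_mean_matrix_strict[OF assoc q_less int M Ma u eig \<rho>1]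
    have "\<sigma> < 1"
    proof (rule perron_eigenvalue_less_1[OF Ma_reg Ma_nonneg v eig_a])
      show "0 < (\<chi> j. 1 / q $ j - 1) $ i" for i
        using q_pos[of i] q_less[of i] by simp
    qed (use strict in auto)
    then have "subcritical_gw pa Ma v \<sigma>"
      by (unfold_locales) (auto intro: int_a Ma Ma_reg v eig_a \<sigma> associated_second_moment[OF assoc q_less v])
    then show ?thesis
      using v_sum by blast
  qed
  then obtain v \<sigma> where "subcritical_gw pa Ma v \<sigma>" "(\<Sum>i\<in>UNIV. v $ i) = 1"
    by blast
  then have "((\<lambda>(n, k). pmf (gw pa k x0) z * (1 - pmf (gw pa n z) 0) / (1 - pmf (gw pa (k + n) x0) 0))
    \<longlongrightarrow> size_biased_yaglom Pa Xa z) (sequentially \<times>\<^sub>F sequentially)"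
    unfolding Ma_def by (intro subcritical_size_biased_limit[OF GWa _ _ assms(6)])
  then show ?thesis
    unfolding cond_prob_gw_survival[OF GW] q_def[symmetric] associated_ratio[OF assoc] .
qed

end
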